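(* Let $T>0$ be fixed. There exists a (nonempty) class of $\mathbb{R}^d$-valued Volterra-Lévy processes $z_t=\int_0^t k(t,s)\,\mathrm{d}\mathscr{L}_s$, $t\in[0,T]$, such that for each $t\in[0,T]$ the associated local time $L_t$ is a test function. More precisely, $(t,x)\mapsto L_t(x)$ belongs to $\mathcal{C}^\gamma([0,T];\mathcal{D}(\mathbb{R}^d))$, $\mathbb{P}$-a.s., for any $\gamma\in(0,1)$.
   Context: A Lévy process $(\mathscr{L}_t)_{t\in[0,T]}$ is a càdlàg adapted process with $\mathscr{L}_0=0$ a.s., with independent and stationary increments, continuous in probability, on a complete filtered probability space $(\Omega,\mathcal{F},(\mathcal{F}_t),\mathbb{P})$ satisfying the usual assumptions. A Volterra-Lévy process is $z_t=\int_0^t k(t,s)\,\mathrm{d}\mathscr{L}_s$, where $k:\{(t,s):0\le s\le t\le T\}\to\mathbb{R}$ satisfies $k(t,\cdot)\in L^\beta([0,t])$ for every $t$, for some $\beta\in(0,2]$. The integral is defined on step functions by $\sum_j a_j(\mathscr{L}_{s_{j+1}}-\mathscr{L}_{s_j})$ and extended to $k(t,\cdot)$ as the limit in $L^p(\Omega)$ (some $p\in(0,\beta]$) of integrals of step functions approximating $k(t,\cdot)$ in $L^\beta([0,t])$, this limit being required to exist independently of the approximating sequence. Occupation measure and local time: for a measurable path $z$, $\mu_t(A)=\lambda\{s\in[0,t]:z_s\in A\}$ for Borel $A\subset\mathbb{R}^d$ ($\lambda$ Lebesgue measure); the local time is a function $L:[0,T]\times\mathbb{R}^d\to\mathbb{R}_+$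 with $\mu_t(A)=\int_A L_t(x)\,\mathrm{d}x$ for all $t$ and Borel $A$. $\mathcal{D}(\mathbb{R}^d)$ is the space of test functions (smooth, compactly supported functions) on $\mathbb{R}^d$ with its usual locally convex topology. $\mathcal{C}^\gamma([0,T];\mathcal{D}(\mathbb{R}^d))$ is the space of functions $[0,T]\to\mathcal{D}(\mathbb{R}^d)$ that are $\gamma$-Hölder continuous with respect to every continuous seminorm on $\mathcal{D}(\mathbb{R}^d)$. *)

theory Defs
  imports "HOL-Probability.Probability"
begin

definition usual_conditions :: "real \<Rightarrow> 'w measure \<Rightarrow> (real \<Rightarrow> 'w measure) \<Rightarrow> bool" where
  "usual_conditions T M F \<longleftrightarrow>
     prob_space M \<and> complete_measure M \<and>
     (\<forall>t\<in>{0..T}. subalgebra M (F t)) \<and>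
     (\<forall>s\<in>{0..T}. \<forall>t\<in>{s..T}. sets (F s) \<subseteq> sets (F t)) \<and>
     null_sets M \<subseteq> sets (F 0) \<and>
     (\<forall>t\<in>{0..<T}. sets (F t) = (\<Inter>s\<in>{t<..T}. sets (F s)))"

definition cadlag_on :: "real \<Rightarrow> (real \<Rightarrow> 'b::topological_space) \<Rightarrow> bool" where
  "cadlag_on T f \<longleftrightarrow>
     (\<forall>t\<in>{0..<T}. (f \<longlongrightarrow> f t) (at_right t)) \<and>
     (\<forall>t\<in>{0<..T}. \<exists>l. (f \<longlongrightarrow> l) (at_left t))"

text \<open>Independence of increments is relative to the filtration: the increment over
  $[s,t]$ is independent of the past up to time $s$.\<close>

definition levy_process ::
  "real \<Rightarrow> 'w measure \<Rightarrow> (real \<Rightarrow> 'w measure) \<Rightarrow> (real \<Rightarrow> 'w \<Rightarrow> 'b::euclidean_space) \<Rightarrow> bool" where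
  "levy_process T M F X \<longleftrightarrow>
     (\<forall>\<omega>\<in>space M. cadlag_on T (\<lambda>t. X t \<omega>)) \<and>
     (\<forall>t\<in>{0..T}. X t \<in> borel_measurable (F t)) \<and>
     (AE \<omega> in M. X 0 \<omega> = 0) \<and>
     (\<forall>s\<in>{0..T}. \<forall>t\<in>{s..T}.
        prob_space.indep_set M (sets (F s))
          (sets (vimage_algebra (space M) (\<lambda>\<omega>. X t \<omega> - X s \<omega>) borel))) \<and>
     (\<forall>s h. 0 \<le> s \<and> 0 \<le> h \<and> s + h \<le> T \<longrightarrow>
        distr M borel (\<lambda>\<omega>. X (s + h) \<omega> - X s \<omega>) = distr M borel (\<lambda>\<omega>. X h \<omega> - X 0 \<omega>)) \<and>
     (\<forall>t\<in>{0..T}. \<forall>\<epsilon>>0.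
        ((\<lambda>s. measure M {\<omega> \<in> space M. norm (X s \<omega> - X t \<omega>) > \<epsilon>}) \<longlongrightarrow> 0)
          (at t within {0..T}))"

definition in_Lp :: "'a measure \<Rightarrow> real \<Rightarrow> ('a \<Rightarrow> 'b::euclidean_space) \<Rightarrow> bool" where
  "in_Lp M p f \<longleftrightarrow>
     f \<in> borel_measurable M \<and> integrable M (\<lambda>x. norm (f x) powr p)"

text \<open>For $p < 1$ this is convergence in the metric of the quasi-normed space $L^p$.\<close>

definition tendsto_Lp ::
  "'a measure \<Rightarrow> real \<Rightarrow> (nat \<Rightarrow> 'a \<Rightarrow> 'b::euclidean_space) \<Rightarrow> ('a \<Rightarrow> 'b) \<Rightarrow> bool" where
  "tendsto_Lp M p f g \<longleftrightarrow>
     (\<forall>m. in_Lp M p (f m)) \<and> in_Lp M p g \<and>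
     (\<lambda>m. \<integral>x. norm (f m x - g x) powr p \<partial>M) \<longlonglongrightarrow> 0"

text \<open>Step functions on $[0,t]$ are given by nodes $0 \le s_0 \le \dots \le s_n \le t$ and
  coefficients $a_0, \dots, a_{n-1}$.\<close>

definition step_nodes :: "real \<Rightarrow> nat \<Rightarrow> (nat \<Rightarrow> real) \<Rightarrow> bool" where
  "step_nodes t n s \<longleftrightarrow> 0 \<le> s 0 \<and> (\<forall>j<n. s j \<le> s (Suc j)) \<and> s n \<le> t"

definition step_fun :: "nat \<Rightarrow> (nat \<Rightarrow> real) \<Rightarrow> (nat \<Rightarrow> real) \<Rightarrow> real \<Rightarrow> real" where
  "step_fun n s a u = (\<Sum>j<n. a j * indicator {s j<..s (Suc j)} u)"

definition step_integral ::
  "(real \<Rightarrow> 'w \<Rightarrow> 'b::real_vector) \<Rightarrow> nat \<Rightarrow> (nat \<Rightarrow> real) \<Rightarrow> (nat \<Rightarrow> real) \<Rightarrow> 'w \<Rightarrow> 'b" where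
  "step_integral X n s a \<omega> = (\<Sum>j<n. a j *\<^sub>R (X (s (Suc j)) \<omega> - X (s j) \<omega>))"

text \<open>For \<open>f\<close> in $L^\beta([0,t])$ approximating sequences exist by density, so the condition is not
  vacuous and \<open>Y\<close> is unique almost surely.\<close>

definition is_integral ::
  "'w measure \<Rightarrow> (real \<Rightarrow> 'w \<Rightarrow> 'b::euclidean_space) \<Rightarrow> real \<Rightarrow> real \<Rightarrow> real \<Rightarrow>
   (real \<Rightarrow> real) \<Rightarrow> ('w \<Rightarrow> 'b) \<Rightarrow> bool" where
  "is_integral M X \<beta> p t f Y \<longleftrightarrow>
     (\<forall>n s a.
        (\<forall>m. step_nodes t (n m) (s m)) \<and>
        (\<lambda>m. LINT u:{0..t}|lborel. \<bar>f u - step_fun (n m) (s m) (a m) u\<bar> powr \<beta>) \<longlonglongrightarrow> 0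
        \<longrightarrow> tendsto_Lp M p (\<lambda>m. step_integral X (n m) (s m) (a m)) Y)"

definition volterra_levy_process ::
  "real \<Rightarrow> 'w measure \<Rightarrow> (real \<Rightarrow> 'w measure) \<Rightarrow> (real \<Rightarrow> 'w \<Rightarrow> 'b::euclidean_space) \<Rightarrow>
   (real \<Rightarrow> real \<Rightarrow> real) \<Rightarrow> (real \<Rightarrow> 'w \<Rightarrow> 'b) \<Rightarrow> bool" where
  "volterra_levy_process T M F X k z \<longleftrightarrow>
     usual_conditions T M F \<and> levy_process T M F X \<and>
     (\<exists>\<beta> p. 0 < \<beta> \<and> \<beta> \<le> 2 \<and> 0 < p \<and> p \<le> \<beta> \<and>
        (\<forall>t\<in>{0..T}.
           in_Lp (restrict_space lborel {0..t}) \<beta> (k t) \<and>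
           is_integral M X \<beta> p t (k t) (z t)))"

text \<open>The integrals determine \<open>z t\<close> only up to a null set depending on \<open>t\<close>.  Joint
  measurability makes the paths measurable and, by Fubini, the occupation measure
  almost surely independent of the version chosen.\<close>

definition measurable_process ::
  "real \<Rightarrow> 'w measure \<Rightarrow> (real \<Rightarrow> 'w \<Rightarrow> 'b::topological_space) \<Rightarrow> bool" where
  "measurable_process T M z \<longleftrightarrow>
     (\<lambda>(t, \<omega>). z t \<omega>) \<in> borel_measurable (restrict_space borel {0..T} \<Otimes>\<^sub>M M)"

definition occupation_measure ::
  "(real \<Rightarrow> 'b::euclidean_space) \<Rightarrow> real \<Rightarrow> 'b set \<Rightarrow> ennreal" where
  "occupation_measure z t A = emeasure lborel {s \<in> {0..t}. z s \<in> A}"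

definition is_local_time ::
  "real \<Rightarrow> (real \<Rightarrow> 'b::euclidean_space) \<Rightarrow> (real \<Rightarrow> 'b \<Rightarrow> real) \<Rightarrow> bool" where
  "is_local_time T z L \<longleftrightarrow>
     z \<in> borel_measurable (restrict_space borel {0..T}) \<and>
     (\<forall>t\<in>{0..T}. L t \<in> borel_measurable borel \<and> (\<forall>x. 0 \<le> L t x) \<and>
        (\<forall>A\<in>sets borel. occupation_measure z t A = (\<integral>\<^sup>+x\<in>A. ennreal (L t x) \<partial>lborel)))"

text \<open>Iterated partial derivatives are indexed by lists of coordinates; a list of length
  $m$ stands for a partial derivative of order $m$.\<close>

fun iter_partial :: "'n list \<Rightarrow> (real^'n \<Rightarrow> real) \<Rightarrow> real^'n::finite \<Rightarrow> real" where
  "iter_partial [] f = f"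
| "iter_partial (j # js) f = (\<lambda>x. frechet_derivative (iter_partial js f) (at x) (axis j 1))"

definition smooth :: "(real^'n::finite \<Rightarrow> real) \<Rightarrow> bool" where
  "smooth f \<longleftrightarrow> (\<forall>js x. iter_partial js f differentiable (at x))"

definition test_functions :: "(real^'n::finite \<Rightarrow> real) set" where
  "test_functions = {f. smooth f \<and> compact (closure {x. f x \<noteq> 0})}"

definition test_functions_on :: "(real^'n::finite) set \<Rightarrow> (real^'n \<Rightarrow> real) set" where
  "test_functions_on K = {f \<in> test_functions. closure {x. f x \<noteq> 0} \<subseteq> K}"

definition deriv_norm :: "nat \<Rightarrow> (real^'n::finite \<Rightarrow> real) \<Rightarrow> real" where
  "deriv_norm N f = (SUP (js, x) \<in> {js. length js \<le> N} \<times> UNIV. \<bar>iter_partial js f x\<bar>)"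

text \<open>The open sets of the Fr\'echet space of test functions supported in \<open>K\<close>.\<close>

definition open_in_test_functions_on ::
  "(real^'n::finite) set \<Rightarrow> (real^'n \<Rightarrow> real) set \<Rightarrow> bool" where
  "open_in_test_functions_on K U \<longleftrightarrow>
     U \<subseteq> test_functions_on K \<and>
     (\<forall>f\<in>U. \<exists>N. \<exists>\<epsilon>>0. \<forall>g\<in>test_functions_on K.
        deriv_norm N (\<lambda>x. g x - f x) < \<epsilon> \<longrightarrow> g \<in> U)"

text \<open>Convex balanced sets whose traces on all these Fr\'echet spaces are open.  Their
  translates generate the usual inductive limit topology on the test functions.\<close>

definition basic_zero_nhd :: "(real^'n::finite \<Rightarrow> real) set \<Rightarrow> bool" where
  "basic_zero_nhd W \<longleftrightarrow>
     W \<subseteq> test_functions \<and>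
     (\<forall>f\<in>W. \<forall>g\<in>W. \<forall>u\<in>{0..1}. (\<lambda>x. u * f x + (1 - u) * g x) \<in> W) \<and>
     (\<forall>f\<in>W. \<forall>c. \<bar>c\<bar> \<le> 1 \<longrightarrow> (\<lambda>x. c * f x) \<in> W) \<and>
     (\<forall>K. compact K \<longrightarrow> open_in_test_functions_on K (W \<inter> test_functions_on K))"

definition test_topology :: "(real^'n::finite \<Rightarrow> real) topology" where
  "test_topology =
     topology_generated_by
       {(\<lambda>g x. f x + g x) ` W |f W. f \<in> test_functions \<and> basic_zero_nhd W}"

definition continuous_test_seminorm :: "((real^'n::finite \<Rightarrow> real) \<Rightarrow> real) \<Rightarrow> bool" where
  "continuous_test_seminorm q \<longleftrightarrow>
     (\<forall>f\<in>test_functions. 0 \<le> q f) \<and>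
     (\<forall>f\<in>test_functions. \<forall>g\<in>test_functions. q (\<lambda>x. f x + g x) \<le> q f + q g) \<and>
     (\<forall>f\<in>test_functions. \<forall>c. q (\<lambda>x. c * f x) = \<bar>c\<bar> * q f) \<and>
     continuous_map test_topology euclideanreal q"

definition holder_test :: "real \<Rightarrow> real \<Rightarrow> (real \<Rightarrow> real^'n::finite \<Rightarrow> real) set" where
  "holder_test \<gamma> T =
     {L. (\<forall>t\<in>{0..T}. L t \<in> test_functions) \<and>
         (\<forall>q. continuous_test_seminorm q \<longrightarrow>
            (\<exists>C. \<forall>s\<in>{0..T}. \<forall>t\<in>{0..T}.
               q (\<lambda>x. L t x - L s x) \<le> C * \<bar>t - s\<bar> powr \<gamma>))}"

end

theory Submission imports Defs "HOL-Combinatorics.Multiset_Permutations"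
begin

text \<open>
  Fix a smooth probability density \<open>bump\<close> on the unit interval and split the binary digits of \<open>t\<close> into
  infinitely many infinite rows. Row \<open>j\<close>, read as a binary expansion and pushed through the quantile
  function of \<open>bump\<close>, is a function \<open>digit_bump j\<close>; for \<open>t\<close> uniform on a dyadic interval of level
  \<open>n\<close>, the \<open>digit_bump j\<close> with \<open>n \<le> j ^ 3\<close> are i.i.d. with density \<open>bump\<close> and independent of the
  remaining rows. Hence the path \<open>z t = (\<Sum>j. digit_bump j t *\<^sub>R v j)\<close> has, on every dyadic
  interval, an occupation measure with a smooth compactly supported density, as soon as some \<open>d\<close> of
  the vectors \<open>v j\<close> with \<open>n \<le> j ^ 3\<close> form a basis. If the inverse of the corresponding matrix grows
  like \<open>2 powr o(n)\<close>, cutting a time interval into maximal dyadic intervals shows that the local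
  time is Hoelder continuous of every order below 1 in every derivative norm.

  Such a path is a Volterra-Levy process: \<open>v j = \<kappa> j *\<^sub>R X (ell j)\<close> with \<open>ell j = 1 / 2 ^ (j ^ 3)\<close>, where
  \<open>X\<close> is a Levy process, corresponds to the kernel
  \<open>k t s = (\<Sum>j. digit_bump j t * \<kappa> j * indicator {0<..ell j} s)\<close>, restricted to \<open>ell j \<le> t\<close>.
  Take for \<open>X\<close> the superposition of Poisson processes whose \<open>m\<close>-th one has jumps in direction
  \<open>m mod d\<close>, with the rate growing and the jump size decreasing so fast that at time \<open>ell j\<close> with high
  probability the \<open>m\<close>-th process has not jumped yet for \<open>m < j\<close>, has jumped for \<open>m = j\<close>, and contributes
  negligibly for \<open>m > j\<close>. By the Borel-Cantelli argument, almost surely \<open>X (ell j)\<close> is nearly parallel to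
  a coordinate axis for all large \<open>j\<close>, so any \<open>d\<close> consecutive \<open>v j\<close> form a basis, quantitatively.
\<close>

section \<open>Smooth functions and bumps\<close>

text \<open>Only \<open>X\<close> is random: the digits are deterministic functions of time, so the
  local time is built for one fixed \<omega> at a time from the vectors \<open>v j\<close>. The
  difficulty is a competition of exponents. On dyadic intervals of level \<open>n\<close> only rows
  with \<open>j ^ 3 \<ge> n\<close> are certain to be free, their vectors are small, and every
  derivative of the density costs another factor of the inverse matrix, which therefore has to stay
  of size 2^o(n). At time \<open>ell j\<close> the process \<open>X\<close> is about 2^-(j^3 + 2 j^2
  + j) times a number of jumps, far too small. The cubic part is what separates the Poisson clocks;
  the kernel weight \<open>\<kappa> j\<close> = 2^(j^3 - j) undoes it and is just small enough for
  the kernel to be integrable, since its \<open>j\<close>-th piece has mass at most 2^-j. What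
  remains is 2^-(2 j^2 + 2 j), and with \<open>j\<close> of order n^(1/3) a quadratic exponent in
  \<open>j\<close> is negligible against \<open>n\<close>. The integral is taken with \<beta> = p =
  1, where Campbell's formula bounds the mean norm of an integral by the L^1 norm of the
  integrand.\<close>

lemma iter_partial_append: "iter_partial (js @ ks) f = iter_partial js (iter_partial ks f)"
  by (induction js) auto

lemma smooth_iter_partial: "smooth f \<Longrightarrow> smooth (iter_partial ks f)"
  by (simp add: smooth_def flip: iter_partial_append)

lemma smooth_differentiable: "smooth f \<Longrightarrow> f differentiable (at x)"
  unfolding smooth_def using iter_partial.simps(1)[of f] by (auto dest: spec[of _ "[]"])

lemma linear_eq_sum_axis:
  fixes D :: "real^'n::finite \<Rightarrow> real"
  assumes "linear D"
  shows "D h = (\<Sum>i\<in>UNIV. h$i * D (axis i 1))"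
proof -
  interpret linear D by fact
  have "D h = D (\<Sum>i\<in>UNIV. h$i *\<^sub>R axis i 1)"
    using basis_expansion[of h] by (simp add: scalar_mult_eq_scaleR)
  then show ?thesis by (simp add: sum scaleR)
qed

lemma has_derivative_partials:
  fixes f :: "real^'n::finite \<Rightarrow> real"
  assumes "f differentiable (at x)"
  shows "(f has_derivative (\<lambda>h. \<Sum>i\<in>UNIV. h$i * iter_partial [i] f x)) (at x)"
proof -
  have D: "(f has_derivative frechet_derivative f (at x)) (at x)"
    using assms frechet_derivative_works by blast
  have "linear (frechet_derivative f (at x))"
    using D has_derivative_linear by blast
  from linear_eq_sum_axis[OF this]
  have "frechet_derivative f (at x) = (\<lambda>h. \<Sum>i\<in>UNIV. h$i * iter_partial [i] f x)"
    unfolding iter_partial.simps by (rule ext)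
  then show ?thesis by (rule has_derivative_eq_rhs[OF D])
qed

lemma partial_eqI:
  assumes "(f has_derivative D) (at x)"
  shows "iter_partial [i] f x = D (axis i 1)"
  using frechet_derivative_at[OF assms] by simp

text \<open>Stability under a single partial derivative replaces formulas for all iterated ones.
  This is how affine compositions and the products in \<open>flat_algebra\<close> are shown to be
  smooth.\<close>

lemma smooth_coinduct:
  assumes "f \<in> S" and S: "\<And>f x. f \<in> S \<Longrightarrow> f differentiable (at x)"
    "\<And>f j. f \<in> S \<Longrightarrow> iter_partial [j] f \<in> S"
  shows "smooth f"
proof -
  have "iter_partial js f \<in> S" for js
    by (induction js) (use assms(1) S(2) in auto)
  then show ?thesis using S(1) by (auto simp: smooth_def)
qed

lemma smooth_add_aux:
  assumes "smooth f" "smooth g"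
  shows "iter_partial js (\<lambda>x. f x + g x) = (\<lambda>x. iter_partial js f x + iter_partial js g x)"
proof (induction js)
  case (Cons j js)
  show ?case
  proof
    fix x
    have "((\<lambda>x. iter_partial js f x + iter_partial js g x) has_derivative
      (\<lambda>h. frechet_derivative (iter_partial js f) (at x) h + frechet_derivative (iter_partial js g) (at x) h)) (at x)"
      using assms unfolding smooth_def frechet_derivative_works by (intro has_derivative_add) auto
    from frechet_derivative_at[OF this]
    show "iter_partial (j # js) (\<lambda>x. f x + g x) x = iter_partial (j # js) f x + iter_partial (j # js) g x"
      by (simp add: Cons.IH fun_eq_iff)
  qed
qed simp

lemma smooth_add: "smooth f \<Longrightarrow> smooth g \<Longrightarrow> smooth (\<lambda>x. f x + g x)"
  using smooth_add_aux[of f g] by (simp add: smooth_def)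

lemma smooth_cmult_aux:
  assumes "smooth f"
  shows "iter_partial js (\<lambda>x. c * f x) = (\<lambda>x. c * iter_partial js f x)"
proof (induction js)
  case (Cons j js)
  show ?case
  proof
    fix x
    have "((\<lambda>x. c * iter_partial js f x) has_derivative
      (\<lambda>h. c * frechet_derivative (iter_partial js f) (at x) h)) (at x)"
      using assms unfolding smooth_def frechet_derivative_works by (intro has_derivative_mult_right) auto
    from frechet_derivative_at[OF this]
    show "iter_partial (j # js) (\<lambda>x. c * f x) x = c * iter_partial (j # js) f x"
      by (simp add: Cons.IH fun_eq_iff)
  qed
qed simp

lemma smooth_cmult: "smooth f \<Longrightarrow> smooth (\<lambda>x. c * f x)"
  using smooth_cmult_aux[of f] by (simp add: smooth_def)

lemma smooth_zero: "smooth (\<lambda>x. 0)"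
  by (rule smooth_coinduct[where S="{\<lambda>x. 0}"]) auto

lemma smooth_sum_aux:
  assumes "finite A" "\<And>a. a \<in> A \<Longrightarrow> smooth (f a)"
  shows "smooth (\<lambda>x. \<Sum>a\<in>A. f a x) \<and>
    iter_partial js (\<lambda>x. \<Sum>a\<in>A. f a x) = (\<lambda>x. \<Sum>a\<in>A. iter_partial js (f a) x)"
  using assms
proof (induction A rule: finite_induct)
  case empty
  have "iter_partial js (\<lambda>x. 0) = (\<lambda>x. 0)"
    using smooth_cmult_aux[OF smooth_zero, of js 0] by simp
  then show ?case by (simp add: smooth_zero)
next
  case (insert a A)
  then show ?case by (simp add: smooth_add smooth_add_aux)
qed

lemmas smooth_sum = smooth_sum_aux[THEN conjunct1]
lemmas iter_partial_sum = smooth_sum_aux[THEN conjunct2]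

lemma partial_affine:
  fixes h :: "real^'n::finite \<Rightarrow> real" and B :: "real^'n^'n"
  assumes "h differentiable (at (B *v x + y))"
  shows "(\<lambda>x. h (B *v x + y)) differentiable (at x)"
    and "iter_partial [j] (\<lambda>x. h (B *v x + y)) x = (\<Sum>k\<in>UNIV. B$k$j * iter_partial [k] h (B *v x + y))"
proof -
  have 1: "((\<lambda>x. B *v x + y) has_derivative (\<lambda>u. B *v u)) (at x)"
    by (auto intro!: derivative_eq_intros linear_imp_has_derivative)
  have D: "((\<lambda>x. h (B *v x + y)) has_derivative (\<lambda>u. \<Sum>i\<in>UNIV. (B *v u)$i * iter_partial [i] h (B *v x + y))) (at x)"
    using has_derivative_compose[OF 1 has_derivative_partials[OF assms]] by simp
  then show "(\<lambda>x. h (B *v x + y)) differentiable (at x)" by (auto simp: differentiable_def)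
  show "iter_partial [j] (\<lambda>x. h (B *v x + y)) x = (\<Sum>k\<in>UNIV. B$k$j * iter_partial [k] h (B *v x + y))"
    by (subst partial_eqI[OF D]) (simp add: matrix_vector_mul_component inner_axis)
qed

text \<open>A partial derivative of h(Bx + y) is again such a composition, with \<open>h\<close>
  replaced by a linear combination of its partials; the set of all these compositions is therefore
  closed under derivatives.\<close>

lemma smooth_affine:
  fixes h :: "real^'n::finite \<Rightarrow> real" and B :: "real^'n^'n"
  assumes "smooth h"
  shows "smooth (\<lambda>x. h (B *v x + y))"
proof (rule smooth_coinduct)
  show "(\<lambda>x. h (B *v x + y)) \<in> {\<lambda>x. h (B *v x + y) |h. smooth h}" using assms by blast
  fix f :: "real^'n \<Rightarrow> real" and x j assume "f \<in> {\<lambda>x. h (B *v x + y) |h. smooth h}"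
  then obtain h where h: "smooth h" and f: "f = (\<lambda>x. h (B *v x + y))" by blast
  show "f differentiable (at x)"
    unfolding f by (intro partial_affine smooth_differentiable h)
  have "iter_partial [j] f = (\<lambda>x. (\<lambda>z. \<Sum>k\<in>UNIV. B$k$j * iter_partial [k] h z) (B *v x + y))"
    unfolding f by (rule ext) (rule partial_affine(2)[OF smooth_differentiable[OF h]])
  moreover have "smooth (\<lambda>z. \<Sum>k\<in>UNIV. B$k$j * iter_partial [k] h z)"
    by (intro smooth_sum smooth_cmult smooth_iter_partial h) auto
  ultimately show "iter_partial [j] f \<in> {\<lambda>x. h (B *v x + y) |h. smooth h}"
    by (intro CollectI exI conjI)
qed

text \<open>Each derivative replaces \<open>h\<close> by a sum of CARD('n) partials with
  coefficients from \<open>B\<close>, hence costs one factor CARD('n) * \<beta>.\<close>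

lemma iter_partial_affine_bound:
  fixes h :: "real^'n::finite \<Rightarrow> real" and B :: "real^'n^'n"
  assumes "smooth h" "\<And>js x. length js = N \<Longrightarrow> \<bar>iter_partial js h x\<bar> \<le> C"
    and B: "\<And>k j. \<bar>B$k$j\<bar> \<le> \<beta>" and "length js = N"
  shows "\<bar>iter_partial js (\<lambda>x. h (B *v x + y)) x\<bar> \<le> (real CARD('n) * \<beta>) ^ N * C"
  using assms(1,2,4)
proof (induction N arbitrary: h C js x)
  case 0
  then show ?case by fastforce
next
  case (Suc N)
  \<comment> \<open>The last list entry is the derivative taken first; peeling it off leaves an
    affine composition with \<open>h'\<close>, to which the induction hypothesis applies.\<close>
  obtain ks j where js: "js = ks @ [j]" and ks: "length ks = N"
    using Suc.prems(3) by (metis length_Suc_conv_rev)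
  define h' where "h' = (\<lambda>z. \<Sum>k\<in>UNIV. B$k$j * iter_partial [k] h z)"
  have sm: "smooth h'"
    unfolding h'_def by (intro smooth_sum smooth_cmult smooth_iter_partial Suc.prems) auto
  have "\<bar>B $ undefined $ undefined\<bar> \<le> \<beta>" using B .
  then have "\<beta> \<ge> 0" by linarith
  have bd: "\<bar>iter_partial js h' x\<bar> \<le> real CARD('n) * \<beta> * C" if "length js = N" for js x
  proof -
    have "iter_partial js h' x = (\<Sum>k\<in>UNIV. B$k$j * iter_partial (js @ [k]) h x)"
      unfolding h'_def
      by (simp add: iter_partial_sum smooth_cmult smooth_iter_partial Suc.prems smooth_cmult_aux
          del: iter_partial.simps) (simp only: iter_partial_append)
    also have "\<bar>\<dots>\<bar> \<le> (\<Sum>k\<in>(UNIV::'n set). \<beta> * C)"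
      using Suc.prems(2) that \<open>\<beta> \<ge> 0\<close>
      by (intro order.trans[OF sum_abs] sum_mono) (auto simp: abs_mult intro!: mult_mono B)
    finally show ?thesis by simp
  qed
  have "iter_partial [j] (\<lambda>x. h (B *v x + y)) = (\<lambda>x. h' (B *v x + y))"
    unfolding h'_def by (rule ext) (rule partial_affine(2)[OF smooth_differentiable[OF Suc.prems(1)]])
  then have "iter_partial js (\<lambda>x. h (B *v x + y)) x = iter_partial ks (\<lambda>x. h' (B *v x + y)) x"
    unfolding js iter_partial_append by simp
  with Suc.IH[OF sm bd ks, of x] show ?case by (simp add: algebra_simps)
qed

lemma iter_partial_translate:
  fixes h :: "real^'n::finite \<Rightarrow> real"
  assumes "smooth h"
  shows "iter_partial js (\<lambda>x. h (x - y)) = (\<lambda>x. iter_partial js h (x - y))"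
proof (induction js)
  case (Cons j js)
  have "iter_partial [j] (\<lambda>x. iter_partial js h (x - y)) x = iter_partial (j # js) h (x - y)" for x
  proof -
    have "((\<lambda>x. iter_partial js h (x - y)) has_derivative
        (\<lambda>u. frechet_derivative (iter_partial js h) (at (x - y)) u)) (at x)"
    proof (rule has_derivative_compose[where f="\<lambda>x. x - y" and f'="\<lambda>u. u", simplified])
      show "((\<lambda>x. x - y) has_derivative (\<lambda>u. u)) (at x)" by (auto intro!: derivative_eq_intros)
      show "(iter_partial js h has_derivative frechet_derivative (iter_partial js h) (at (x - y))) (at (x - y))"
        using assms unfolding smooth_def frechet_derivative_works by blast
    qed
    from partial_eqI[OF this] show ?thesis by simp
  qed
  then show ?case using Cons.IH by auto
qed simp

lemma smooth_translate: "smooth h \<Longrightarrow> smooth (\<lambda>x. h (x - y))"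
  using smooth_affine[of h "mat 1" "- y"] by simp

lemma iter_partial_zero_open:
  fixes f :: "real^'n::finite \<Rightarrow> real"
  assumes "open W" "\<And>x. x \<in> W \<Longrightarrow> f x = 0" "x \<in> W"
  shows "iter_partial js f x = 0"
  using assms(3)
proof (induction js arbitrary: x)
  case (Cons j js)
  have "((\<lambda>x. 0) has_derivative (\<lambda>_. 0)) (at x)" by simp
  then have "(iter_partial js f has_derivative (\<lambda>_. 0)) (at x)"
    by (rule has_derivative_transform_within_open[OF _ assms(1) Cons.prems]) (use Cons.IH in auto)
  from partial_eqI[OF this] show ?case by simp
qed (use assms in auto)

lemma continuous_iter_partial: "smooth f \<Longrightarrow> continuous_on UNIV (iter_partial js f)"
  unfolding smooth_def
  by (auto intro!: continuous_at_imp_continuous_on differentiable_imp_continuous_within)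

text \<open>Derivatives are continuous, hence bounded on \<open>K\<close>, and they vanish on its
  open complement. Only finitely many lists have length \<open>N\<close>, so the sum of their bounds
  serves all of them; the summand 1 makes it positive.\<close>

lemma iter_partial_bounded:
  fixes f :: "real^'n::finite \<Rightarrow> real"
  assumes "smooth f" "compact K" "\<And>x. x \<notin> K \<Longrightarrow> f x = 0"
  obtains C where "C > 0" "\<And>x js. length js = N \<Longrightarrow> \<bar>iter_partial js f x\<bar> \<le> C"
proof -
  have "\<exists>C. \<forall>x. \<bar>iter_partial js f x\<bar> \<le> C" for js
  proof -
    have "bounded (iter_partial js f ` K)"
      using assms continuous_iter_partial[OF assms(1)]
      by (intro compact_imp_bounded compact_continuous_image) (auto intro: continuous_on_subset)
    then obtain C where "\<forall>x\<in>K. \<bar>iter_partial js f x\<bar> \<le> C" unfolding bounded_iff by auto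
    moreover have "iter_partial js f x = 0" if "x \<notin> K" for x
      by (rule iter_partial_zero_open[of "-K"]) (use assms that compact_imp_closed in auto)
    ultimately have "\<forall>x. \<bar>iter_partial js f x\<bar> \<le> max C 0" by (auto simp: le_max_iff_disj split: if_splits)
    then show ?thesis by blast
  qed
  then obtain C where C: "\<And>js x. \<bar>iter_partial js f x\<bar> \<le> C js" by metis
  have fin: "finite {js :: 'n list. length js = N}"
    using finite_lists_length_eq[of "UNIV :: 'n set" N] by simp
  show ?thesis
  proof (rule that[of "1 + (\<Sum>js | length js = N. \<bar>C js\<bar>)"])
    show "1 + (\<Sum>js | length js = N. \<bar>C js\<bar>) > 0" by (smt (verit) sum_nonneg abs_ge_zero)
    fix x and js :: "'n list" assume "length js = N"
    then have "\<bar>C js\<bar> \<le> (\<Sum>js | length js = N. \<bar>C js\<bar>)"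
      by (intro member_le_sum) (auto simp: fin)
    with C[of js x] show "\<bar>iter_partial js f x\<bar> \<le> 1 + (\<Sum>js | length js = N. \<bar>C js\<bar>)" by linarith
  qed
qed

section \<open>Flat exponentials and the bump density\<close>

definition flat_exp :: "real poly \<Rightarrow> real \<Rightarrow> real" where
  "flat_exp p x = (if x > 0 then poly p (1 / x) * exp (- (1 / x)) else 0)"

lemma poly_times_exp_tendsto_0: "((\<lambda>y::real. poly p y * exp (- y)) \<longlongrightarrow> 0) at_top"
proof -
  have "((\<lambda>y::real. \<Sum>i\<le>degree p. coeff p i * (y ^ i / exp y)) \<longlongrightarrow> 0) at_top"
    by (intro tendsto_null_sum tendsto_mult_right_zero tendsto_power_div_exp_0)
  then show ?thesis
    by (simp add: poly_altdef sum_distrib_right exp_minus divide_inverse mult.assoc)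
qed

lemma flat_exp_tendsto_0: "(flat_exp p \<longlongrightarrow> 0) (at 0)"
proof (rule filterlim_split_at)
  have "\<forall>\<^sub>F x in at_left 0. 0 = flat_exp p x"
    by (auto simp: eventually_at_filter flat_exp_def)
  then show "(flat_exp p \<longlongrightarrow> 0) (at_left 0)"
    by (rule tendsto_eventually[OF eventually_mono]) auto
  have "((\<lambda>y. flat_exp p (inverse y)) \<longlongrightarrow> 0) at_top"
  proof (rule Lim_transform_eventually[OF poly_times_exp_tendsto_0[of p]])
    show "\<forall>\<^sub>F y in at_top. poly p y * exp (- y) = flat_exp p (inverse y)"
      using eventually_gt_at_top[of 0] by eventually_elim (simp add: flat_exp_def field_simps)
  qed
  then show "(flat_exp p \<longlongrightarrow> 0) (at_right 0)"
    by (subst filterlim_at_right_to_top)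
qed

text \<open>With y = 1/x the derivative of p(y) exp(-y) is y^2 (p - p')(y) exp(-y), and the two
  \<open>pCons 0\<close> multiply by y^2. Keeping the polynomial as a parameter closes the family
  under differentiation. At 0 the difference quotient is \<open>flat_exp (pCons 0 p)\<close> on the
  positive side, which tends to 0.\<close>

lemma flat_exp_has_derivative:
  "(flat_exp p has_real_derivative flat_exp (pCons 0 (pCons 0 (p - pderiv p))) x) (at x)"
proof -
  consider "x > 0" | "x < 0" | "x = 0" by linarith
  then show ?thesis
  proof cases
    case 1
    have "((\<lambda>x. poly p (1 / x) * exp (- (1 / x))) has_real_derivative
        flat_exp (pCons 0 (pCons 0 (p - pderiv p))) x) (at x)"
      using 1 by (auto intro!: derivative_eq_intros simp: flat_exp_def field_simps power2_eq_square)
    then show ?thesis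
      by (rule has_field_derivative_transform_within_open[of _ _ _ "{0<..}"])
        (use 1 in \<open>auto simp: flat_exp_def\<close>)
  next
    case 2
    have "((\<lambda>x. 0) has_real_derivative 0) (at x)" by simp
    then have "(flat_exp p has_real_derivative 0) (at x)"
      by (rule has_field_derivative_transform_within_open[of _ _ _ "{..<0}"])
        (use 2 in \<open>auto simp: flat_exp_def\<close>)
    then show ?thesis using 2 by (simp add: flat_exp_def)
  next
    case 3
    have "((\<lambda>y. (flat_exp p y - flat_exp p 0) / (y - 0)) \<longlongrightarrow> 0) (at 0)"
      by (rule Lim_transform_eventually[OF flat_exp_tendsto_0[of "pCons 0 p"]])
        (auto simp: flat_exp_def eventually_at_filter)
    then show ?thesis using 3 by (simp add: has_field_derivative_iff flat_exp_def)
  qed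
qed

lemma continuous_flat_exp [continuous_intros]:
  "continuous_on S f \<Longrightarrow> continuous_on S (\<lambda>x. flat_exp p (f x))"
proof -
  have "continuous_on UNIV (flat_exp p)"
    using flat_exp_has_derivative by (intro DERIV_continuous_on) (auto intro: has_field_derivative_at_within)
  then show "continuous_on S f \<Longrightarrow> continuous_on S (\<lambda>x. flat_exp p (f x))"
    by (rule continuous_on_compose2) auto
qed

text \<open>Designed to be closed under partial derivatives, so that products of one-variable bumps
  are smooth by \<open>smooth_coinduct\<close>.\<close>

inductive_set flat_algebra :: "(real^'n::finite \<Rightarrow> real) set" where
  const: "(\<lambda>x. c) \<in> flat_algebra"
| flat: "(\<lambda>x. flat_exp p (a * x$i + b)) \<in> flat_algebra"
| add: "f \<in> flat_algebra \<Longrightarrow> g \<in> flat_algebra \<Longrightarrow> (\<lambda>x. f x + g x) \<in> flat_algebra"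
| mult: "f \<in> flat_algebra \<Longrightarrow> g \<in> flat_algebra \<Longrightarrow> (\<lambda>x. f x * g x) \<in> flat_algebra"

lemma flat_algebra_derivative:
  fixes f :: "real^'n::finite \<Rightarrow> real"
  assumes "f \<in> flat_algebra"
  shows "(\<forall>x. f differentiable (at x)) \<and> (\<forall>j. iter_partial [j] f \<in> flat_algebra)"
  using assms
proof induction
  case (const c)
  then show ?case by (auto intro: flat_algebra.const)
next
  case (flat p a i b)
  let ?p = "pCons 0 (pCons 0 (p - pderiv p))"
  have D: "((\<lambda>x. flat_exp p (a * x$i + b)) has_derivative (\<lambda>h. flat_exp ?p (a * x$i + b) * (a * h$i))) (at x)" for x :: "real^'n"
  proof -
    have "((\<lambda>x. a * x$i + b) has_derivative (\<lambda>h. a * h$i)) (at x)"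
      by (auto intro!: derivative_eq_intros bounded_linear_imp_has_derivative bounded_linear_vec_nth)
    from has_derivative_compose[OF this flat_exp_has_derivative[unfolded has_field_derivative_def]]
    show ?thesis .
  qed
  have "iter_partial [j] (\<lambda>x. flat_exp p (a * x$i + b))
      = (\<lambda>x. (a * axis j 1 $ i) * flat_exp ?p (a * x$i + b))" for j
    by (rule ext, subst partial_eqI[OF D]) simp
  then have "iter_partial [j] (\<lambda>x. flat_exp p (a * x$i + b)) \<in> flat_algebra" for j
    by (simp only:) (intro flat_algebra.intros)
  then show ?case using D by (auto simp: differentiable_def)
next
  case (add f g)
  have D: "((\<lambda>x. f x + g x) has_derivative (\<lambda>h. frechet_derivative f (at x) h + frechet_derivative g (at x) h)) (at x)" for x
    using add by (intro has_derivative_add) (auto simp: frechet_derivative_works)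
  have "iter_partial [j] (\<lambda>x. f x + g x) = (\<lambda>x. iter_partial [j] f x + iter_partial [j] g x)" for j
    by (rule ext, subst partial_eqI[OF D]) simp
  moreover have "(\<lambda>x. iter_partial [j] f x + iter_partial [j] g x) \<in> flat_algebra" for j
    by (intro flat_algebra.add) (use add in auto)
  ultimately show ?case using D by (auto simp: differentiable_def simp del: iter_partial.simps)
next
  case (mult f g)
  have D: "((\<lambda>x. f x * g x) has_derivative (\<lambda>h. f x * frechet_derivative g (at x) h + frechet_derivative f (at x) h * g x)) (at x)" for x
    using mult by (intro has_derivative_mult) (auto simp: frechet_derivative_works)
  have "iter_partial [j] (\<lambda>x. f x * g x) = (\<lambda>x. f x * iter_partial [j] g x + iter_partial [j] f x * g x)" for j
    by (rule ext, subst partial_eqI[OF D]) simp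
  moreover have "(\<lambda>x. f x * iter_partial [j] g x + iter_partial [j] f x * g x) \<in> flat_algebra" for j
    by (intro flat_algebra.add flat_algebra.mult) (use mult in auto)
  ultimately show ?case using D by (auto simp: differentiable_def simp del: iter_partial.simps)
qed

lemma smooth_flat_algebra: "f \<in> flat_algebra \<Longrightarrow> smooth f"
  by (rule smooth_coinduct[where S=flat_algebra]) (use flat_algebra_derivative in blast)+

lemma flat_algebra_prod:
  assumes "finite A" "\<And>a. a \<in> A \<Longrightarrow> f a \<in> flat_algebra"
  shows "(\<lambda>x. \<Prod>a\<in>A. f a x) \<in> flat_algebra"
  using assms by (induction A rule: finite_induct) (auto intro: flat_algebra.intros)

text \<open>exp(-1/x) times its mirror image under x -> 1 - x: positive exactly on the open unit
  interval and flat at both ends.\<close>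

definition bump0 :: "real \<Rightarrow> real" where
  "bump0 x = flat_exp 1 x * flat_exp 1 (1 - x)"

definition bump :: "real \<Rightarrow> real" where
  "bump x = bump0 x / (\<integral>x. bump0 x \<partial>lborel)"

lemma continuous_bump0: "continuous_on S bump0"
  unfolding bump0_def by (intro continuous_intros)

lemma bump0_nonneg: "bump0 x \<ge> 0"
  by (simp add: bump0_def flat_exp_def)

lemma bump0_eq_0: "x \<notin> {0..1} \<Longrightarrow> bump0 x = 0"
  by (auto simp: bump0_def flat_exp_def)

lemma integrable_bump0: "integrable lborel bump0"
proof -
  have "set_integrable lborel {0..1} bump0"
    unfolding set_integrable_def
    by (rule borel_integrable_compact) (auto intro: continuous_bump0)
  moreover have "(\<lambda>x. indicator {0..1} x *\<^sub>R bump0 x) = bump0"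
    using bump0_eq_0 by (auto simp: indicator_def fun_eq_iff)
  ultimately show ?thesis by (simp add: set_integrable_def)
qed

lemma integral_bump0_pos: "(\<integral>x. bump0 x \<partial>lborel) > 0"
proof (rule ccontr)
  assume "\<not> ?thesis"
  then have "(\<integral>x. bump0 x \<partial>lborel) = 0"
    using Bochner_Integration.integral_nonneg[of lborel bump0] bump0_nonneg by (simp add: order_antisym not_less)
  then have "AE x in lborel. bump0 x = 0"
    using integral_nonneg_eq_0_iff_AE[OF integrable_bump0] bump0_nonneg by simp
  then have "AE x in lborel. x \<notin> {0<..<1::real}"
    by eventually_elim (auto simp: bump0_def flat_exp_def)
  then have "{0<..<1::real} \<in> null_sets lborel"
    by (subst AE_iff_null_sets) auto
  then show False by (simp add: null_sets_def)
qed

lemma bump_nonneg: "bump x \<ge> 0"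
  using integral_bump0_pos bump0_nonneg by (simp add: bump_def)

lemma bump_eq_0: "x \<notin> {0..1} \<Longrightarrow> bump x = 0"
  using bump0_eq_0 by (simp add: bump_def)

lemma continuous_bump: "continuous_on S bump"
  unfolding bump_def using integral_bump0_pos by (intro continuous_intros continuous_bump0) auto

lemma bump_measurable [measurable]: "bump \<in> borel_measurable borel"
  by (intro borel_measurable_continuous_onI continuous_bump)

lemma nn_integral_bump: "(\<integral>\<^sup>+x. ennreal (bump x) \<partial>lborel) = 1"
proof -
  have "integrable lborel bump" unfolding bump_def using integrable_bump0 by simp
  moreover have "(\<integral>x. bump x \<partial>lborel) = 1" unfolding bump_def using integral_bump0_pos by simp
  ultimately show ?thesis using bump_nonneg by (subst nn_integral_eq_integral) auto
qed

definition bump_prod :: "real^'n::finite \<Rightarrow> real" where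
  "bump_prod x = (\<Prod>i\<in>UNIV. bump (x$i))"

lemma smooth_bump_prod: "smooth bump_prod"
proof -
  have "(\<lambda>x::real^'n. bump (x$i)) \<in> flat_algebra" for i
  proof -
    let ?c = "1 / (\<integral>x. bump0 x \<partial>lborel)"
    have "(\<lambda>x::real^'n. bump (x$i)) = (\<lambda>x. ?c * (flat_exp 1 (1 * x$i + 0) * flat_exp 1 ((-1) * x$i + 1)))"
      by (simp add: bump_def bump0_def)
    also have "\<dots> \<in> flat_algebra" by (intro flat_algebra.intros)
    finally show ?thesis .
  qed
  then have "(\<lambda>x::real^'n. \<Prod>i\<in>UNIV. bump (x$i)) \<in> flat_algebra" by (intro flat_algebra_prod) auto
  then have "bump_prod \<in> flat_algebra" by (simp add: bump_prod_def[abs_def])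
  then show ?thesis by (rule smooth_flat_algebra)
qed

lemma bump_prod_nonneg: "bump_prod x \<ge> 0"
  by (simp add: bump_prod_def prod_nonneg bump_nonneg)

lemma bump_prod_eq_0:
  assumes "x \<notin> cbox 0 1"
  shows "bump_prod (x :: real^'n::finite) = 0"
proof -
  from assms obtain i where "x$i \<notin> {0..1}"
    by (auto simp: mem_box_cart)
  then show ?thesis
    using bump_eq_0 by (auto simp: bump_prod_def)
qed

section \<open>Taylor bounds and differentiation under the integral\<close>

lemma smooth_lipschitz:
  fixes f :: "real^'n::finite \<Rightarrow> real"
  assumes "smooth f" "\<And>j x. \<bar>iter_partial [j] f x\<bar> \<le> C"
  shows "\<bar>f x - f y\<bar> \<le> real CARD('n) * C * norm (x - y)"
proof -
  have "norm (f x - f y) \<le> (real CARD('n) * C) * norm (x - y)"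
  proof (rule differentiable_bound[of UNIV])
    fix x
    show "(f has_derivative (\<lambda>h. \<Sum>i\<in>UNIV. h$i * iter_partial [i] f x)) (at x within UNIV)"
      using has_derivative_partials[OF smooth_differentiable[OF assms(1)]] by simp
    show "onorm (\<lambda>h. \<Sum>i\<in>UNIV. h$i * iter_partial [i] f x) \<le> real CARD('n) * C"
    proof (rule onorm_le)
      fix h :: "real^'n"
      have "norm (\<Sum>i\<in>UNIV. h$i * iter_partial [i] f x) \<le> (\<Sum>i\<in>(UNIV::'n set). norm h * C)"
        by (rule sum_norm_le) (auto simp: abs_mult simp del: iter_partial.simps
            intro!: mult_mono assms component_le_norm_cart)
      then show "norm (\<Sum>i\<in>UNIV. h$i * iter_partial [i] f x) \<le> real CARD('n) * C * norm h"
        by (simp add: mult_ac)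
    qed
  qed auto
  then show ?thesis by simp
qed

text \<open>Mean value inequality for \<open>f\<close> minus its linear part at \<open>x\<close>:
  the derivative of this difference at \<open>u\<close> is the difference of the gradients of
  \<open>f\<close> at \<open>u\<close> and \<open>x\<close>, which \<open>smooth_lipschitz\<close>
  bounds by second derivatives.\<close>

lemma taylor_remainder_bound:
  fixes f :: "real^'n::finite \<Rightarrow> real"
  assumes "smooth f" "\<And>js x. length js = 2 \<Longrightarrow> \<bar>iter_partial js f x\<bar> \<le> C"
  shows "\<bar>f y - f x - (\<Sum>i\<in>UNIV. (y - x)$i * iter_partial [i] f x)\<bar> \<le> (real CARD('n))\<^sup>2 * C * (norm (y - x))\<^sup>2"
proof -
  define r where "r = norm (y - x)"
  define g where "g = (\<lambda>u. f u - (\<Sum>i\<in>UNIV. u$i * iter_partial [i] f x))"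
  have "C \<ge> 0" using assms(2)[of "[undefined, undefined]" 0] by (simp del: iter_partial.simps)
  have "norm (g y - g x) \<le> (real CARD('n) * (real CARD('n) * C * r)) * norm (y - x)"
  proof (rule differentiable_bound[of "cball x r"])
    fix u assume u: "u \<in> cball x r"
    have lip: "\<bar>iter_partial [i] f u - iter_partial [i] f x\<bar> \<le> real CARD('n) * C * r" for i
    proof -
      have "\<bar>iter_partial [i] f u - iter_partial [i] f x\<bar> \<le> real CARD('n) * C * norm (u - x)"
      proof (rule smooth_lipschitz)
        show "\<bar>iter_partial [j] (iter_partial [i] f) x\<bar> \<le> C" for j x
          using assms(2)[of "[j] @ [i]" x] unfolding iter_partial_append by (simp del: iter_partial.simps)
      qed (rule smooth_iter_partial[OF assms(1)])
      also have "\<dots> \<le> real CARD('n) * C * r"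
        using u \<open>C \<ge> 0\<close> by (intro mult_left_mono) (auto simp: dist_norm norm_minus_commute)
      finally show ?thesis .
    qed
    have "((\<lambda>u. \<Sum>i\<in>UNIV. u$i * iter_partial [i] f x) has_derivative (\<lambda>h. \<Sum>i\<in>UNIV. h$i * iter_partial [i] f x)) (at u)"
      by (intro has_derivative_sum has_derivative_mult_left bounded_linear_imp_has_derivative bounded_linear_vec_nth)
    from has_derivative_diff[OF has_derivative_partials[OF smooth_differentiable[OF assms(1), of u]] this]
    have "(g has_derivative (\<lambda>h. (\<Sum>i\<in>UNIV. h$i * iter_partial [i] f u) - (\<Sum>i\<in>UNIV. h$i * iter_partial [i] f x))) (at u)"
      unfolding g_def .
    then show "(g has_derivative (\<lambda>h. (\<Sum>i\<in>UNIV. h$i * iter_partial [i] f u) - (\<Sum>i\<in>UNIV. h$i * iter_partial [i] f x))) (at u within cball x r)"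
      by (rule has_derivative_at_withinI)
    show "onorm (\<lambda>h. (\<Sum>i\<in>UNIV. h$i * iter_partial [i] f u) - (\<Sum>i\<in>UNIV. h$i * iter_partial [i] f x)) \<le> real CARD('n) * (real CARD('n) * C * r)"
    proof (rule onorm_le)
      fix h :: "real^'n"
      have "norm ((\<Sum>i\<in>UNIV. h$i * iter_partial [i] f u) - (\<Sum>i\<in>UNIV. h$i * iter_partial [i] f x))
        = norm (\<Sum>i\<in>UNIV. h$i * (iter_partial [i] f u - iter_partial [i] f x))"
        by (simp only: sum_subtractf right_diff_distrib)
      also have "\<dots> \<le> (\<Sum>i\<in>(UNIV::'n set). norm h * (real CARD('n) * C * r))"
        by (rule sum_norm_le) (auto simp: abs_mult simp del: iter_partial.simps
            intro!: mult_mono lip component_le_norm_cart)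
      finally show "norm ((\<Sum>i\<in>UNIV. h$i * iter_partial [i] f u) - (\<Sum>i\<in>UNIV. h$i * iter_partial [i] f x)) \<le> real CARD('n) * (real CARD('n) * C * r) * norm h"
        by (simp add: mult_ac)
    qed
  qed (auto simp: r_def dist_norm norm_minus_commute)
  moreover have "g y - g x = f y - f x - (\<Sum>i\<in>UNIV. (y - x)$i * iter_partial [i] f x)"
    unfolding g_def by (simp add: left_diff_distrib sum_subtractf del: iter_partial.simps)
  ultimately show ?thesis by (simp add: r_def power2_eq_square mult_ac del: iter_partial.simps)
qed

text \<open>The second-order Taylor remainder is bounded by the majorant two orders higher,
  uniformly in \<open>x\<close>; integrating it yields Frechet differentiability of the integral,
  and induction on the list gives all orders. It serves the local time, a time integral of smooth
  functions.\<close>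

lemma smooth_integral:
  fixes G :: "'y \<Rightarrow> real^'n::finite \<Rightarrow> real"
  assumes sm: "\<And>y. smooth (G y)"
    and meas: "\<And>js x. (\<lambda>y. iter_partial js (G y) x) \<in> borel_measurable \<nu>"
    and int: "\<And>N. integrable \<nu> (M N)"
    and bd: "\<And>js x y. y \<in> space \<nu> \<Longrightarrow> \<bar>iter_partial js (G y) x\<bar> \<le> M (length js) y"
  shows "smooth (\<lambda>x. \<integral>y. G y x \<partial>\<nu>)"
    and "iter_partial js (\<lambda>x. \<integral>y. G y x \<partial>\<nu>) = (\<lambda>x. \<integral>y. iter_partial js (G y) x \<partial>\<nu>)"
proof -
  have int': "integrable \<nu> (\<lambda>y. iter_partial js (G y) x)" for js x
    by (rule Bochner_Integration.integrable_bound[OF int[of "length js"] meas])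
      (auto intro!: AE_I2 order.trans[OF bd])
  have D: "((\<lambda>x. \<integral>y. iter_partial js (G y) x \<partial>\<nu>) has_derivative
      (\<lambda>h. \<Sum>i\<in>UNIV. h$i * (\<integral>y. iter_partial (i # js) (G y) x \<partial>\<nu>))) (at x)" for js x
  proof (rule has_derivativeI_sandwich[where e=1 and H="\<lambda>u. (real CARD('n))\<^sup>2 * (\<integral>y. M (Suc (Suc (length js))) y \<partial>\<nu>) * norm (u - x)"])
    show "bounded_linear (\<lambda>h. \<Sum>i\<in>UNIV. h$i * (\<integral>y. iter_partial (i # js) (G y) x \<partial>\<nu>))"
      by (intro bounded_linear_sum bounded_linear_mult_const bounded_linear_vec_nth)
    show "((\<lambda>u. (real CARD('n))\<^sup>2 * (\<integral>y. M (Suc (Suc (length js))) y \<partial>\<nu>) * norm (u - x)) \<longlongrightarrow> 0) (at x)"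
      by (auto intro!: tendsto_eq_intros)
    fix u assume "u \<noteq> x"
    let ?R = "\<lambda>y. iter_partial js (G y) u - iter_partial js (G y) x - (\<Sum>i\<in>UNIV. (u - x)$i * iter_partial (i # js) (G y) x)"
    have R: "\<bar>?R y\<bar> \<le> (real CARD('n))\<^sup>2 * M (Suc (Suc (length js))) y * (norm (u - x))\<^sup>2" if "y \<in> space \<nu>" for y
    proof -
      have "\<bar>iter_partial js (G y) u - iter_partial js (G y) x - (\<Sum>i\<in>UNIV. (u - x)$i * iter_partial [i] (iter_partial js (G y)) x)\<bar>
        \<le> (real CARD('n))\<^sup>2 * M (Suc (Suc (length js))) y * (norm (u - x))\<^sup>2"
      proof (rule taylor_remainder_bound)
        show "smooth (iter_partial js (G y))" by (rule smooth_iter_partial[OF sm])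
        fix ks :: "'n list" and x assume "length ks = 2"
        then show "\<bar>iter_partial ks (iter_partial js (G y)) x\<bar> \<le> M (Suc (Suc (length js))) y"
          using bd[OF that, of "ks @ js" x] by (simp add: iter_partial_append)
      qed
      then show ?thesis by (simp flip: iter_partial_append)
    qed
    have eq: "(\<integral>y. iter_partial js (G y) u \<partial>\<nu>) - (\<integral>y. iter_partial js (G y) x \<partial>\<nu>) -
        (\<Sum>i\<in>UNIV. (u - x)$i * (\<integral>y. iter_partial (i # js) (G y) x \<partial>\<nu>)) = (\<integral>y. ?R y \<partial>\<nu>)"
      using int'[of js] int'[of "_ # js" x] by (simp add: Bochner_Integration.integral_sum del: iter_partial.simps vector_minus_component)
    have "norm (\<integral>y. ?R y \<partial>\<nu>) \<le> (\<integral>y. (real CARD('n))\<^sup>2 * M (Suc (Suc (length js))) y * (norm (u - x))\<^sup>2 \<partial>\<nu>)"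
      using R int by (intro order.trans[OF Bochner_Integration.integral_norm_bound Bochner_Integration.integral_mono]) (auto intro!: int' Bochner_Integration.integrable_diff Bochner_Integration.integrable_sum integrable_mult_right simp del: iter_partial.simps)
    then show "norm ((\<integral>y. iter_partial js (G y) u \<partial>\<nu>) - (\<integral>y. iter_partial js (G y) x \<partial>\<nu>) -
        (\<Sum>i\<in>UNIV. (u - x)$i * (\<integral>y. iter_partial (i # js) (G y) x \<partial>\<nu>))) / norm (u - x)
        \<le> (real CARD('n))\<^sup>2 * (\<integral>y. M (Suc (Suc (length js))) y \<partial>\<nu>) * norm (u - x)"
      unfolding eq using \<open>u \<noteq> x\<close> by (simp add: field_simps power2_eq_square del: iter_partial.simps)
  qed auto
  have eq: "iter_partial js (\<lambda>x. \<integral>y. G y x \<partial>\<nu>) = (\<lambda>x. \<integral>y. iter_partial js (G y) x \<partial>\<nu>)" for js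
  proof (induction js)
    case (Cons j js)
    have "iter_partial (j # js) (\<lambda>x. \<integral>y. G y x \<partial>\<nu>) x = (\<integral>y. iter_partial (j # js) (G y) x \<partial>\<nu>)" for x
    proof -
      have "iter_partial (j # js) (\<lambda>x. \<integral>y. G y x \<partial>\<nu>) x = iter_partial [j] (\<lambda>x. \<integral>y. iter_partial js (G y) x \<partial>\<nu>) x"
        by (simp add: Cons.IH)
      also have "\<dots> = (\<integral>y. iter_partial (j # js) (G y) x \<partial>\<nu>)"
        by (subst partial_eqI[OF D]) (simp add: axis_def if_distrib[of "\<lambda>x. x * _"] cong: if_cong)
      finally show ?thesis .
    qed
    then show ?case by (rule ext)
  qed simp
  show "iter_partial js (\<lambda>x. \<integral>y. G y x \<partial>\<nu>) = (\<lambda>x. \<integral>y. iter_partial js (G y) x \<partial>\<nu>)" by (rule eq)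
  show "smooth (\<lambda>x. \<integral>y. G y x \<partial>\<nu>)"
    unfolding smooth_def eq using D by (auto simp: differentiable_def)
qed

section \<open>Test functions and their inductive limit topology\<close>

lemma test_functions_onI:
  fixes f :: "real^'n::finite \<Rightarrow> real"
  assumes "smooth f" "compact K" "\<And>x. x \<notin> K \<Longrightarrow> f x = 0"
  shows "f \<in> test_functions_on K"
proof -
  have "closure {x. f x \<noteq> 0} \<subseteq> K"
    by (rule closure_minimal) (use assms compact_imp_closed in auto)
  moreover from this have "compact (closure {x. f x \<noteq> 0})"
    using assms(2) by (meson closed_closure compact_imp_bounded bounded_subset compact_eq_bounded_closed)
  ultimately show ?thesis using assms by (simp add: test_functions_on_def test_functions_def)
qed

lemma test_functions_on_eq_0: "f \<in> test_functions_on K \<Longrightarrow> x \<notin> K \<Longrightarrow> f x = 0"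
  using closure_subset[of "{x. f x \<noteq> 0}"] by (auto simp: test_functions_on_def)

lemma test_functions_on_lincomb:
  assumes "compact K" "f \<in> test_functions_on K" "g \<in> test_functions_on K"
  shows "(\<lambda>x. a * f x + b * g x) \<in> test_functions_on K"
proof (rule test_functions_onI)
  show "smooth (\<lambda>x. a * f x + b * g x)"
    using assms by (intro smooth_add smooth_cmult) (simp_all add: test_functions_on_def test_functions_def)
  show "a * f x + b * g x = 0" if "x \<notin> K" for x
    using test_functions_on_eq_0[OF assms(2) that] test_functions_on_eq_0[OF assms(3) that] by simp
qed (rule assms(1))

lemma test_functions_subset: "test_functions_on K \<subseteq> test_functions"
  by (auto simp: test_functions_on_def)

lemma test_functions_on_mono: "K \<subseteq> K' \<Longrightarrow> test_functions_on K \<subseteq> test_functions_on K'"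
  by (auto simp: test_functions_on_def)

lemma test_functions_lincomb:
  assumes "f \<in> test_functions" "g \<in> test_functions"
  shows "(\<lambda>x. a * f x + b * g x) \<in> test_functions"
proof -
  let ?K = "closure {x. f x \<noteq> 0} \<union> closure {x. g x \<noteq> 0}"
  have "compact ?K" "f \<in> test_functions_on ?K" "g \<in> test_functions_on ?K"
    using assms by (auto simp: test_functions_on_def test_functions_def)
  from test_functions_on_lincomb[OF this] show ?thesis
    using test_functions_subset by blast
qed

lemma zero_test_function_on: "compact K \<Longrightarrow> (\<lambda>x. 0) \<in> test_functions_on K"
  by (rule test_functions_onI[OF smooth_zero]) auto

text \<open>Makes the whole space a generator of \<open>test_topology\<close>, so that the zero
  function lies in its topspace.\<close>

lemma basic_zero_nhd_test_functions: "basic_zero_nhd (test_functions :: (real^'n::finite \<Rightarrow> real) set)"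
proof -
  have "test_functions \<inter> test_functions_on K = (test_functions_on K :: (real^'n \<Rightarrow> real) set)" for K
    using test_functions_subset by blast
  moreover have "open_in_test_functions_on K (test_functions_on K)" for K :: "(real^'n) set"
    unfolding open_in_test_functions_on_def by (intro conjI ballI exI[of _ 0] exI[of _ "1::real"]) auto
  ultimately show ?thesis
    unfolding basic_zero_nhd_def
    using test_functions_lincomb test_functions_lincomb[of _ _ _ 0] by auto
qed

lemma open_in_test_functions_on_Int:
  fixes U :: "(real^'n::finite \<Rightarrow> real) set"
  assumes "open_in_test_functions_on K U" "open_in_test_functions_on K V"
  shows "open_in_test_functions_on K (U \<inter> V)"
  unfolding open_in_test_functions_on_def
proof (intro conjI ballI)
  fix f assume "f \<in> U \<inter> V"
  obtain N \<epsilon> where 1: "\<epsilon> > 0" "\<And>g. g \<in> test_functions_on K \<Longrightarrow> deriv_norm N (\<lambda>x. g x - f x) < \<epsilon> \<Longrightarrow> g \<in> U"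
    using assms(1) \<open>f \<in> U \<inter> V\<close> unfolding open_in_test_functions_on_def by fast
  obtain N' \<epsilon>' where 2: "\<epsilon>' > 0" "\<And>g. g \<in> test_functions_on K \<Longrightarrow> deriv_norm N' (\<lambda>x. g x - f x) < \<epsilon>' \<Longrightarrow> g \<in> V"
    using assms(2) \<open>f \<in> U \<inter> V\<close> unfolding open_in_test_functions_on_def by fast
  \<comment> \<open>A real-valued supremum is monotone in its index set only if it is bounded above,
    which compact support provides.\<close>
  have mono: "deriv_norm N h \<le> deriv_norm N' h"
    if h: "h \<in> test_functions_on K" and N: "N \<le> N'" for N N' and h :: "real^'n \<Rightarrow> real"
    unfolding deriv_norm_def
  proof (rule cSUP_subset_mono)
    have "\<exists>C. \<forall>n\<le>N'. \<forall>js x. length js = n \<longrightarrow> \<bar>iter_partial js h x\<bar> \<le> C"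
    proof -
      have "\<exists>C. \<forall>js x. length js = n \<longrightarrow> \<bar>iter_partial js h x\<bar> \<le> C" for n
        by (rule iter_partial_bounded[of h "closure {x. h x \<noteq> 0}" n])
          (use h closure_subset[of "{x. h x \<noteq> 0}"] in \<open>auto simp: test_functions_on_def test_functions_def\<close>)
      then obtain C where C: "\<And>n js x. length js = n \<Longrightarrow> \<bar>iter_partial js h x\<bar> \<le> C n" by metis
      have "C n \<le> Max (C ` {..N'})" if "n \<le> N'" for n using that by (intro Max_ge) auto
      then show ?thesis by (intro exI[of _ "Max (C ` {..N'})"]) (auto intro!: order_trans[OF C])
    qed
    then obtain C where "\<And>js x. length js \<le> N' \<Longrightarrow> \<bar>iter_partial js h x\<bar> \<le> C" by blast
    then show "bdd_above ((\<lambda>(js, x). \<bar>iter_partial js h x\<bar>) ` ({js. length js \<le> N'} \<times> UNIV))"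
      by (intro bdd_aboveI[of _ C]) auto
    show "{js. length js \<le> N} \<times> UNIV \<noteq> {}" by (auto intro: exI[of _ "[]"])
  qed (use N in auto)
  show "\<exists>N. \<exists>\<epsilon>>0. \<forall>g\<in>test_functions_on K. deriv_norm N (\<lambda>x. g x - f x) < \<epsilon> \<longrightarrow> g \<in> U \<inter> V"
  proof (intro exI conjI ballI impI)
    show "0 < min \<epsilon> \<epsilon>'" using 1 2 by simp
    fix g assume g: "g \<in> test_functions_on K" and lt: "deriv_norm (max N N') (\<lambda>x. g x - f x) < min \<epsilon> \<epsilon>'"
    have f: "f \<in> test_functions_on K"
      using assms(1) \<open>f \<in> U \<inter> V\<close> unfolding open_in_test_functions_on_def by blast
    \<comment> \<open>\<open>K\<close> is not known to be compact, so the difference is formed on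
      the union of the two supports.\<close>
    have h: "(\<lambda>x. g x - f x) \<in> test_functions_on K"
    proof -
      let ?K = "closure {x. f x \<noteq> 0} \<union> closure {x. g x \<noteq> 0}"
      have "compact ?K" "f \<in> test_functions_on ?K" "g \<in> test_functions_on ?K" "?K \<subseteq> K"
        using f g by (auto simp: test_functions_on_def test_functions_def)
      with test_functions_on_lincomb[of ?K g f 1 "-1"] test_functions_on_mono[of ?K K] show ?thesis by auto
    qed
    show "g \<in> U \<inter> V"
      using 1(2)[OF g] 2(2)[OF g] lt mono[OF h, of N "max N N'"] mono[OF h, of N' "max N N'"] by auto
  qed
qed (use assms in \<open>auto simp: open_in_test_functions_on_def\<close>)

text \<open>Continuity of the inclusion of each Frechet space into the inductive limit, by induction
  over the generated topology. For a generator, subtracting \<open>f\<close> carries functions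
  supported in \<open>K\<close> to functions supported in \<open>K\<close> united with the support
  of \<open>f\<close>, where the trace of \<open>W\<close> is open.\<close>

lemma openin_test_topology_trace:
  fixes U :: "(real^'n::finite \<Rightarrow> real) set"
  assumes "openin test_topology U" "compact K"
  shows "open_in_test_functions_on K (U \<inter> test_functions_on K)"
proof -
  have "generate_topology_on {(\<lambda>g x. f x + g x) ` W |f W. f \<in> test_functions \<and> basic_zero_nhd W} U"
    using assms(1) by (simp add: test_topology_def openin_topology_generated_by_iff)
  then show ?thesis
  proof induction
    case Empty
    then show ?case by (simp add: open_in_test_functions_on_def)
  next
    case (Int a b)
    from open_in_test_functions_on_Int[OF Int.IH] show ?case by (simp add: Int_ac)
  next
    case (UN \<K>)
    then show ?case unfolding open_in_test_functions_on_def by blast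
  next
    case (Basis s)
    then obtain f W where s: "s = (\<lambda>g x. f x + g x) ` W" and f: "f \<in> test_functions" and W: "basic_zero_nhd W"
      by blast
    have in_s: "g \<in> s \<longleftrightarrow> (\<lambda>x. g x - f x) \<in> W" for g
      unfolding s by (auto intro!: image_eqI[where x="\<lambda>x. g x - f x"])
    let ?K = "K \<union> closure {x. f x \<noteq> 0}"
    have K: "compact ?K" using assms(2) f by (auto simp: test_functions_def)
    have f': "f \<in> test_functions_on ?K" using f by (auto simp: test_functions_on_def)
    have shift: "(\<lambda>x. g x - f x) \<in> test_functions_on ?K" if "g \<in> test_functions_on K" for g
    proof -
      have "g \<in> test_functions_on ?K" using that test_functions_on_mono[of K ?K] by auto
      from test_functions_on_lincomb[OF K this f', of 1 "-1"] show ?thesis by simp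
    qed
    have op: "open_in_test_functions_on ?K (W \<inter> test_functions_on ?K)"
      using W K unfolding basic_zero_nhd_def by blast
    show ?case
      unfolding open_in_test_functions_on_def
    proof (intro conjI ballI)
      fix g assume g: "g \<in> s \<inter> test_functions_on K"
      have "(\<lambda>x. g x - f x) \<in> W \<inter> test_functions_on ?K"
        by (rule IntI[OF in_s[THEN iffD1, OF IntD1[OF g]] shift[OF IntD2[OF g]]])
      from op[unfolded open_in_test_functions_on_def, THEN conjunct2, THEN bspec, OF this]
      obtain N \<epsilon> where "\<epsilon> > 0" and \<epsilon>: "\<forall>h\<in>test_functions_on ?K.
          deriv_norm N (\<lambda>x. h x - (g x - f x)) < \<epsilon> \<longrightarrow> h \<in> W \<inter> test_functions_on ?K"
        by (elim exE conjE)
      show "\<exists>N. \<exists>\<epsilon>>0. \<forall>h\<in>test_functions_on K. deriv_norm N (\<lambda>x. h x - g x) < \<epsilon> \<longrightarrow> h \<in> s \<inter> test_functions_on K"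
      proof (intro exI conjI ballI impI)
        fix h assume h: "h \<in> test_functions_on K" and "deriv_norm N (\<lambda>x. h x - g x) < \<epsilon>"
        then have "(\<lambda>x. h x - f x) \<in> W" by (intro IntD1[OF \<epsilon>[THEN bspec, THEN mp]] shift) simp_all
        then show "h \<in> s \<inter> test_functions_on K" by (intro IntI in_s[THEN iffD2] h)
      qed (rule \<open>\<epsilon> > 0\<close>)
    qed blast
  qed
qed

text \<open>The trace of the open set {q < 1} contains a ball of some derivative norm around 0, and
  homogeneity of \<open>q\<close> turns this into a bound. Hoelder continuity in every continuous
  seminorm is thereby reduced to estimates of derivatives on one compact set.\<close>

lemma continuous_test_seminorm_bound:
  fixes q :: "(real^'n::finite \<Rightarrow> real) \<Rightarrow> real"
  assumes q: "continuous_test_seminorm q" and K: "compact K"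
  obtains N C where "C \<ge> 0" "\<And>f B. f \<in> test_functions_on K \<Longrightarrow> B > 0 \<Longrightarrow>
    (\<And>js x. length js \<le> N \<Longrightarrow> \<bar>iter_partial js f x\<bar> \<le> B) \<Longrightarrow> q f \<le> C * B"
proof -
  have hom: "q (\<lambda>x. c * f x) = \<bar>c\<bar> * q f" if "f \<in> test_functions" for f c
    using q that by (auto simp: continuous_test_seminorm_def)
  let ?U = "{f \<in> topspace test_topology. q f \<in> {..<1}}"
  have 0: "(\<lambda>x. 0) \<in> (test_functions :: (real^'n \<Rightarrow> real) set)"
    using zero_test_function_on[OF K] test_functions_subset by blast
  have "openin test_topology ?U"
  proof -
    have "continuous_map test_topology euclideanreal q"
      using q by (simp add: continuous_test_seminorm_def)
    moreover have "openin euclideanreal {..<1::real}" by simp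
    ultimately show ?thesis by (rule openin_continuous_map_preimage)
  qed
  then have op: "open_in_test_functions_on K (?U \<inter> test_functions_on K)"
    by (rule openin_test_topology_trace[OF _ K])
  have "openin test_topology ((\<lambda>g (x::real^'n). 0 + g x) ` test_functions)"
    unfolding test_topology_def
    by (intro topology_generated_by_Basis CollectI exI[of _ "\<lambda>x. 0"] exI[of _ test_functions]
        conjI refl 0 basic_zero_nhd_test_functions)
  then have "(\<lambda>x. 0) \<in> topspace (test_topology :: (real^'n \<Rightarrow> real) topology)"
    using 0 openin_subset by fastforce
  moreover have "q (\<lambda>x. 0) = 0" using hom[OF 0, of 0] by simp
  ultimately have "(\<lambda>x. 0) \<in> ?U \<inter> test_functions_on K"
    using zero_test_function_on[OF K] by simp
  from op[unfolded open_in_test_functions_on_def, THEN conjunct2, THEN bspec, OF this]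
  obtain N \<epsilon> where N: "\<epsilon> > 0" "\<forall>g\<in>test_functions_on K. deriv_norm N (\<lambda>x. g x - 0) < \<epsilon> \<longrightarrow> g \<in> ?U \<inter> test_functions_on K"
    by (elim exE conjE)
  show ?thesis
  proof (rule that[of "2 / \<epsilon>" N])
    show "0 \<le> 2 / \<epsilon>" using N by simp
    fix f and B :: real
    assume f: "f \<in> test_functions_on K" and B: "B > 0"
      and bd: "\<And>js x. length js \<le> N \<Longrightarrow> \<bar>iter_partial js f x\<bar> \<le> B"
    \<comment> \<open>Scales the derivatives of \<open>f\<close> down to \<epsilon> / 2, strictly
      inside the ball; the factor 2 reappears in the constant 2 / \<epsilon>.\<close>
    define c where "c = \<epsilon> / (2 * B)"
    have c: "c > 0" using N B by (simp add: c_def)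
    have sf: "smooth f" using f by (auto simp: test_functions_on_def test_functions_def)
    have cf: "(\<lambda>x. c * f x) \<in> test_functions_on K"
      using test_functions_on_lincomb[OF K f f, of c 0] by simp
    have "deriv_norm N (\<lambda>x. c * f x - 0) \<le> \<epsilon> / 2"
      unfolding deriv_norm_def
    proof (rule cSUP_least)
      show "{js. length js \<le> N} \<times> UNIV \<noteq> {}" by (auto intro: exI[of _ "[]"])
      fix p :: "'n list \<times> (real^'n)" assume "p \<in> {js. length js \<le> N} \<times> UNIV"
      then obtain js x where p: "p = (js, x)" "length js \<le> N" by auto
      have "c * \<bar>iter_partial js f x\<bar> \<le> c * B" using bd[OF p(2)] c by (intro mult_left_mono) auto
      also have "\<dots> = \<epsilon> / 2" using B by (simp add: c_def)
      finally show "(case p of (js, x) \<Rightarrow> \<bar>iter_partial js (\<lambda>x. c * f x - 0) x\<bar>) \<le> \<epsilon> / 2"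
        using c by (simp add: p smooth_cmult_aux[OF sf] abs_mult)
    qed
    with N(1) have "deriv_norm N (\<lambda>x. c * f x - 0) < \<epsilon>" by linarith
    from IntD1[OF N(2)[THEN bspec, OF cf, THEN mp, OF this]]
    have "q (\<lambda>x. c * f x) < 1" by simp
    moreover have "q (\<lambda>x. c * f x) = c * q f"
      using hom[OF subsetD[OF test_functions_subset f], of c] c by simp
    ultimately have "c * q f < 1" by simp
    then show "q f \<le> 2 / \<epsilon> * B" using N B c by (simp add: c_def field_simps)
  qed
qed

section \<open>Binary digits as independent random variables\<close>

text \<open>Digit 0 has weight 1/2. Being defined on all reals, digits are compatible with
  translations, which \<open>digit_flip\<close> exploits.\<close>

definition bin_digit :: "nat \<Rightarrow> real \<Rightarrow> bool" where
  "bin_digit i r = odd \<lfloor>2 ^ Suc i * r\<rfloor>"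

definition dyadic :: "nat \<Rightarrow> int \<Rightarrow> real set" where
  "dyadic n k = {r. \<lfloor>2 ^ n * r\<rfloor> = k}"

lemma dyadic_eq: "dyadic n k = {real_of_int k / 2 ^ n ..< (real_of_int k + 1) / 2 ^ n}"
proof -
  have "r \<in> dyadic n k \<longleftrightarrow> r \<in> {real_of_int k / 2 ^ n ..< (real_of_int k + 1) / 2 ^ n}" for r
    unfolding dyadic_def mem_Collect_eq floor_eq_iff by (simp add: field_simps)
  then show ?thesis by (rule set_eqI)
qed

lemma dyadic_measurable [measurable]: "dyadic n k \<in> sets borel"
  by (simp add: dyadic_eq)

lemma emeasure_dyadic: "emeasure lborel (dyadic n k) = ennreal (1 / 2 ^ n)"
  by (simp add: dyadic_eq field_simps flip: diff_divide_distrib)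

text \<open>A coarse floor is a function of a finer one, so everything decided by the digits before
  \<open>m\<close> depends only on \<lfloor>2 ^ m * r\<rfloor>.\<close>

lemma floor_scale_div:
  assumes "m \<le> n"
  shows "\<lfloor>2 ^ m * (r::real)\<rfloor> = \<lfloor>2 ^ n * r\<rfloor> div 2 ^ (n - m)"
proof -
  have "2 ^ m * r = 2 ^ n * r / real_of_int (2 ^ (n - m))"
  proof -
    have "(2::real) ^ n = 2 ^ m * 2 ^ (n - m)" using assms by (simp flip: power_add)
    then show ?thesis by simp
  qed
  moreover have "\<lfloor>2 ^ n * r / real_of_int (2 ^ (n - m))\<rfloor> = \<lfloor>2 ^ n * r\<rfloor> div 2 ^ (n - m)"
    by (rule floor_divide_real_eq_div) simp
  ultimately show ?thesis by (simp only:)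
qed

lemma bin_digit_measurable [measurable]: "bin_digit i \<in> measurable borel (count_space UNIV)"
  unfolding bin_digit_def by measurable

abbreviation dyadic_prob :: "nat \<Rightarrow> int \<Rightarrow> real measure" where
  "dyadic_prob n k \<equiv> uniform_measure lborel (dyadic n k)"

lemma prob_space_dyadic: "prob_space (dyadic_prob n k)"
  by (rule prob_space_uniform_measure) (auto simp: emeasure_dyadic)

lemma dyadic_prob_eq: "B \<in> sets borel \<Longrightarrow> measure (dyadic_prob n k) B = 2 ^ n * measure lborel (dyadic n k \<inter> B)"
  by (subst measure_uniform_measure) (auto simp: emeasure_dyadic measure_def)

text \<open>Translation by half a dyadic interval of level \<open>i\<close> carries the points with
  digit 0 onto those with digit 1 and leaves them in their interval, that is, preserves \<lfloor>2 ^
  i * r\<rfloor>.\<close>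

lemma digit_flip:
  "measure lborel {r. Q \<lfloor>2 ^ i * r\<rfloor> \<and> bin_digit i r} = measure lborel {r. Q \<lfloor>2 ^ i * r\<rfloor> \<and> \<not> bin_digit i r}"
proof -
  let ?c = "1 / 2 ^ Suc i :: real"
  have [measurable]: "Measurable.pred borel (\<lambda>r::real. Q \<lfloor>2 ^ i * r\<rfloor>)" by measurable
  have "{r. Q \<lfloor>2 ^ i * r\<rfloor> \<and> \<not> bin_digit i r} = (+) ?c -` {r. Q \<lfloor>2 ^ i * r\<rfloor> \<and> bin_digit i r}"
  proof -
    have "Q \<lfloor>2 ^ i * r\<rfloor> \<and> \<not> bin_digit i r \<longleftrightarrow> Q \<lfloor>2 ^ i * (?c + r)\<rfloor> \<and> bin_digit i (?c + r)" for r
    proof -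
      have 1: "\<lfloor>2 ^ Suc i * (?c + r)\<rfloor> = \<lfloor>2 ^ Suc i * r\<rfloor> + 1"
        by (simp add: distrib_left)
      have 2: "\<lfloor>2 ^ i * s\<rfloor> = \<lfloor>2 ^ Suc i * s\<rfloor> div 2" for s :: real
        using floor_scale_div[of i "Suc i" s] by simp
      show ?thesis
        unfolding bin_digit_def 2 1 by (cases "even \<lfloor>2 ^ Suc i * r\<rfloor>") auto
    qed
    then show ?thesis by auto
  qed
  then have "measure lborel {r. Q \<lfloor>2 ^ i * r\<rfloor> \<and> \<not> bin_digit i r}
      = measure (distr lborel borel ((+) ?c)) {r. Q \<lfloor>2 ^ i * r\<rfloor> \<and> bin_digit i r}"
    by (subst measure_distr) auto
  then show ?thesis by (simp add: lborel_distr_plus)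
qed

context
  fixes n :: nat and k :: int
begin

interpretation P: prob_space "dyadic_prob n k" by (rule prob_space_dyadic)

lemma digit_prob_half:
  assumes "n \<le> i"
  shows "P.prob {r. Q \<lfloor>2 ^ i * r\<rfloor> \<and> bin_digit i r = b} = P.prob {r. Q \<lfloor>2 ^ i * r\<rfloor>} / 2"
proof -
  have [measurable]: "Measurable.pred borel (\<lambda>r::real. Q \<lfloor>2 ^ i * r\<rfloor>)" for Q by measurable
  \<comment> \<open>The second conjunct expresses membership in \<open>dyadic n k\<close> through
    the finer floor of level \<open>i\<close>.\<close>
  let ?Q = "\<lambda>j. Q j \<and> j div 2 ^ (i - n) = k"
  have D: "dyadic n k \<inter> {r. R r} = {r. R r \<and> \<lfloor>2 ^ i * r\<rfloor> div 2 ^ (i - n) = k}" for R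
    using floor_scale_div[OF assms] by (auto simp: dyadic_def)
  have eq: "P.prob {r. Q \<lfloor>2 ^ i * r\<rfloor> \<and> bin_digit i r} = P.prob {r. Q \<lfloor>2 ^ i * r\<rfloor> \<and> \<not> bin_digit i r}"
    using digit_flip[of ?Q i] by (simp add: dyadic_prob_eq D conj_ac)
  have "{r. Q \<lfloor>2 ^ i * r\<rfloor>} = {r. Q \<lfloor>2 ^ i * r\<rfloor> \<and> bin_digit i r} \<union> {r. Q \<lfloor>2 ^ i * r\<rfloor> \<and> \<not> bin_digit i r}" by auto
  also have "P.prob \<dots> = P.prob {r. Q \<lfloor>2 ^ i * r\<rfloor> \<and> bin_digit i r} + P.prob {r. Q \<lfloor>2 ^ i * r\<rfloor> \<and> \<not> bin_digit i r}"
    by (rule P.finite_measure_Union) auto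
  finally show ?thesis using eq by (cases b) auto
qed

text \<open>Digits from \<open>n\<close> on are fair given the earlier ones; digits before
  \<open>n\<close> are almost surely constant on the dyadic interval, which makes them independent
  of everything. Independence thus holds for all digits, as needed for rows that are only partly
  free.\<close>

lemma digit_step_indep:
  "P.prob {r. Q \<lfloor>2 ^ m * r\<rfloor> \<and> bin_digit m r \<in> B}
    = P.prob {r. Q \<lfloor>2 ^ m * r\<rfloor>} * P.prob {r. bin_digit m r \<in> B}"
proof -
  have [measurable]: "Measurable.pred borel (\<lambda>r::real. Q \<lfloor>2 ^ m * r\<rfloor>)" by measurable
  have "B \<in> {{}, {True}, {False}, UNIV}"
    using Pow_UNIV UNIV_I[of B] by (simp add: UNIV_bool Pow_insert flip: Pow_UNIV) blast
  then consider "B = UNIV" | "B = {}" | b where "B = {b}" "n \<le> m" | "m < n"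
    by (cases "n \<le> m") auto
  then show ?thesis
  proof cases
    case 1
    then show ?thesis using P.prob_space by simp
  next
    case 3
    have "P.prob {r. bin_digit m r = b} = 1 / 2"
      using digit_prob_half[of m "\<lambda>_. True" b] 3 P.prob_space by simp
    moreover have "P.prob {r. Q \<lfloor>2 ^ m * r\<rfloor> \<and> bin_digit m r = b} = P.prob {r. Q \<lfloor>2 ^ m * r\<rfloor>} / 2"
      using 3 by (intro digit_prob_half)
    ultimately show ?thesis using 3(1) by (simp only: singleton_iff times_divide_eq_right mult_1_right)
  next
    case 4
    define c where "c = odd (k div 2 ^ (n - Suc m))"
    have AE: "AE r in dyadic_prob n k. bin_digit m r = c"
    proof (rule AE_uniform_measureI)
      show "AE r in lborel. r \<in> dyadic n k \<longrightarrow> bin_digit m r = c"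
        using floor_scale_div[of "Suc m" n] 4
        by (auto simp: dyadic_def bin_digit_def c_def)
    qed simp
    show ?thesis
    proof (cases "c \<in> B")
      case True
      have "P.prob {r. Q \<lfloor>2 ^ m * r\<rfloor> \<and> bin_digit m r \<in> B} = P.prob {r. Q \<lfloor>2 ^ m * r\<rfloor>}"
        by (rule P.finite_measure_eq_AE) (use AE True in auto)
      moreover have "P.prob {r. bin_digit m r \<in> B} = 1"
        using AE True P.prob_Collect_eq_1[of "\<lambda>r. bin_digit m r \<in> B"] by auto
      ultimately show ?thesis by simp
    next
      case False
      have "P.prob {r. Q \<lfloor>2 ^ m * r\<rfloor> \<and> bin_digit m r \<in> B} = 0"
        by (subst P.prob_eq_0) (use AE False in auto)
      moreover have "P.prob {r. bin_digit m r \<in> B} = 0"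
        by (subst P.prob_eq_0) (use AE False in auto)
      ultimately show ?thesis by simp
    qed
  qed simp
qed

text \<open>The induction adds the largest index last: the smaller digits are then a function of
  \<lfloor>2 ^ m * r\<rfloor>, and \<open>digit_step_indep\<close> applies.\<close>

lemma digits_indep: "P.indep_vars (\<lambda>_. count_space UNIV) bin_digit UNIV"
proof -
  have prod: "P.prob {r. \<forall>j\<in>J. bin_digit j r \<in> B j} = (\<Prod>j\<in>J. P.prob {r. bin_digit j r \<in> B j})"
    if "finite J" for J B
    using that
  proof (induction J rule: finite_linorder_max_induct)
    case empty
    then show ?case using P.prob_space by simp
  next
    case (insert m J)
    let ?Q = "\<lambda>a. \<forall>j\<in>J. odd (a div 2 ^ (m - Suc j)) \<in> B j"
    have Q: "(\<forall>j\<in>J. bin_digit j r \<in> B j) \<longleftrightarrow> ?Q \<lfloor>2 ^ m * r\<rfloor>" for r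
    proof (rule ball_cong[OF refl])
      fix j assume "j \<in> J"
      then have "Suc j \<le> m" using insert.hyps by (auto simp: Suc_le_eq)
      then show "bin_digit j r \<in> B j \<longleftrightarrow> odd (\<lfloor>2 ^ m * r\<rfloor> div 2 ^ (m - Suc j)) \<in> B j"
        unfolding bin_digit_def by (subst floor_scale_div[of "Suc j" m]) (assumption, rule refl)
    qed
    have "P.prob {r. \<forall>j\<in>insert m J. bin_digit j r \<in> B j} = P.prob {r. ?Q \<lfloor>2 ^ m * r\<rfloor> \<and> bin_digit m r \<in> B m}"
      using Q by (auto intro!: arg_cong[where f="P.prob"])
    also have "\<dots> = P.prob {r. \<forall>j\<in>J. bin_digit j r \<in> B j} * P.prob {r. bin_digit m r \<in> B m}"
      using digit_step_indep[of ?Q m "B m"] Q by simp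
    also have "\<dots> = (\<Prod>j\<in>insert m J. P.prob {r. bin_digit j r \<in> B j})"
      using insert by (subst prod.insert) auto
    finally show ?case .
  qed
  show ?thesis
    unfolding P.indep_vars_def2
  proof (intro conjI ballI P.indep_setsI)
    fix A :: "nat \<Rightarrow> real set" and J :: "nat set"
    assume J: "J \<noteq> {}" "finite J"
      and A: "\<forall>j\<in>J. A j \<in> {bin_digit j -` A \<inter> space (dyadic_prob n k) |A. A \<in> sets (count_space UNIV)}"
    from A have "\<forall>j\<in>J. \<exists>B. A j = {r. bin_digit j r \<in> B}" by (simp add: vimage_def)
    then obtain B where B: "\<And>j. j \<in> J \<Longrightarrow> A j = {r. bin_digit j r \<in> B j}" by metis
    have "(\<Inter>j\<in>J. A j) = {r. \<forall>j\<in>J. bin_digit j r \<in> B j}" using B J by auto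
    moreover have "(\<Prod>j\<in>J. P.prob (A j)) = (\<Prod>j\<in>J. P.prob {r. bin_digit j r \<in> B j})" using B by simp
    ultimately show "P.prob (\<Inter>j\<in>J. A j) = (\<Prod>j\<in>J. P.prob (A j))" using prod[OF J(2)] by simp
  qed (auto intro!: measurable_sets_borel[OF bin_digit_measurable])
qed

lemma digit_distr:
  assumes "n \<le> i"
  shows "distr (dyadic_prob n k) (count_space UNIV) (bin_digit i) = uniform_count_measure UNIV"
proof (rule measure_eqI_finite[of _ UNIV])
  fix b :: bool
  have "emeasure (distr (dyadic_prob n k) (count_space UNIV) (bin_digit i)) {b} = P.prob {r. bin_digit i r = b}"
    by (subst emeasure_distr) (auto simp: P.emeasure_eq_measure vimage_def)
  also have "P.prob {r. bin_digit i r = b} = 1 / 2"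
    using digit_prob_half[OF assms, of "\<lambda>_. True" b] P.prob_space by simp
  finally show "emeasure (distr (dyadic_prob n k) (count_space UNIV) (bin_digit i)) {b} = emeasure (uniform_count_measure UNIV) {b}"
    by (simp add: emeasure_uniform_count_measure)
qed (auto simp: sets_uniform_count_measure)

end

section \<open>Uniform variables from digits and the quantile transform\<close>

definition digit_value :: "(nat \<Rightarrow> bool) \<Rightarrow> real" where
  "digit_value b = (\<Sum>k. of_bool (b k) / 2 ^ Suc k)"

lemma digit_value_measurable [measurable]:
  "digit_value \<in> borel_measurable (PiM UNIV (\<lambda>_. count_space UNIV))"
  unfolding digit_value_def by measurable

lemma digit_value_bin_digit:
  assumes "0 \<le> r" "r < 1"
  shows "digit_value (\<lambda>i. bin_digit i r) = r"
proof -
  have part: "(\<Sum>k<m. of_bool (bin_digit k r) / 2 ^ Suc k) = \<lfloor>2 ^ m * r\<rfloor> / 2 ^ m" for m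
  proof (induction m)
    case 0
    then show ?case using assms by (simp add: floor_eq_iff)
  next
    case (Suc m)
    have "\<lfloor>2 ^ Suc m * r\<rfloor> = 2 * \<lfloor>2 ^ m * r\<rfloor> + of_bool (bin_digit m r)"
      using floor_scale_div[of m "Suc m" r] unfolding bin_digit_def
      by (simp add: odd_two_times_div_two_succ del: power_Suc)
    then have "real_of_int \<lfloor>2 ^ Suc m * r\<rfloor> = 2 * \<lfloor>2 ^ m * r\<rfloor> + of_bool (bin_digit m r)"
      by (simp only: of_int_add of_int_mult of_int_of_bool of_int_numeral)
    with Suc.IH show ?case by (simp add: field_simps del: floor_eq_iff)
  qed
  have "(\<lambda>m. \<lfloor>2 ^ m * r\<rfloor> / 2 ^ m) \<longlonglongrightarrow> r"
  proof (rule tendsto_sandwich)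
    show "\<forall>\<^sub>F m in sequentially. r - (1 / 2) ^ m \<le> \<lfloor>2 ^ m * r\<rfloor> / 2 ^ m"
    proof (rule always_eventually, rule allI)
      fix m :: nat
      have "2 ^ m * r - 1 \<le> \<lfloor>2 ^ m * r\<rfloor>" by linarith
      then have "(2 ^ m * r - 1) / 2 ^ m \<le> \<lfloor>2 ^ m * r\<rfloor> / 2 ^ m" by (rule divide_right_mono) simp
      then show "r - (1 / 2) ^ m \<le> \<lfloor>2 ^ m * r\<rfloor> / 2 ^ m"
        by (simp add: diff_divide_distrib power_one_over)
    qed
    show "\<forall>\<^sub>F m in sequentially. \<lfloor>2 ^ m * r\<rfloor> / 2 ^ m \<le> r"
      by (auto simp: field_simps)
    show "(\<lambda>m. r - (1 / 2) ^ m) \<longlonglongrightarrow> r"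
      by (auto intro!: tendsto_eq_intros LIMSEQ_power_zero)
  qed simp
  then have "(\<lambda>k. of_bool (bin_digit k r) / 2 ^ Suc k) sums r"
    unfolding sums_def part .
  then show ?thesis unfolding digit_value_def by (rule sums_unique[symmetric])
qed

text \<open>Fair independent bits have the same joint law as the digits of a uniform point of [0,1)
  = \<open>dyadic 0 0\<close>, and \<open>digit_value\<close> reassembles that point.\<close>

lemma (in prob_space) distr_digit_value:
  assumes ind: "indep_vars (\<lambda>_. count_space UNIV) B (UNIV :: nat set)"
    and d: "\<And>i. distr M (count_space UNIV) (B i) = uniform_count_measure UNIV"
  shows "distr M borel (\<lambda>\<omega>. digit_value (\<lambda>i. B i \<omega>)) = uniform_measure lborel {0..<1}"
proof -
  interpret D: prob_space "dyadic_prob 0 0" by (rule prob_space_dyadic)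
  let ?S = "PiM UNIV (\<lambda>_::nat. count_space (UNIV::bool set))"
  have B [measurable]: "B i \<in> measurable M (count_space UNIV)" for i
    using ind by (auto simp: indep_vars_def)
  have 1: "distr M ?S (\<lambda>\<omega> i. B i \<omega>) = PiM UNIV (\<lambda>_. uniform_count_measure UNIV)"
    using indep_vars_iff_distr_eq_PiM[of UNIV B "\<lambda>_. count_space UNIV"] ind d
    by (simp add: restrict_UNIV)
  have 2: "distr (dyadic_prob 0 0) ?S (\<lambda>\<omega> i. bin_digit i \<omega>) = PiM UNIV (\<lambda>_. uniform_count_measure UNIV)"
    using D.indep_vars_iff_distr_eq_PiM[of UNIV bin_digit "\<lambda>_. count_space UNIV"] digits_indep[of 0 0] digit_distr[of 0]
    by (simp add: restrict_UNIV)
  have [measurable]: "(\<lambda>\<omega> i. B i \<omega>) \<in> measurable M ?S" by (intro measurable_PiM_single') auto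
  have [measurable]: "(\<lambda>\<omega> i. bin_digit i \<omega>) \<in> measurable borel ?S" by (intro measurable_PiM_single') auto
  have "distr M borel (\<lambda>\<omega>. digit_value (\<lambda>i. B i \<omega>)) = distr (distr M ?S (\<lambda>\<omega> i. B i \<omega>)) borel digit_value"
    by (subst distr_distr) (auto simp: comp_def)
  also have "\<dots> = distr (dyadic_prob 0 0) borel (\<lambda>\<omega>. digit_value (\<lambda>i. bin_digit i \<omega>))"
    unfolding 1 2[symmetric] by (subst distr_distr) (auto simp: comp_def)
  also have "\<dots> = distr (dyadic_prob 0 0) borel (\<lambda>\<omega>. \<omega>)"
  proof (rule distr_cong_AE)
    show "AE x in dyadic_prob 0 0. digit_value (\<lambda>i. bin_digit i x) = x"
      by (rule AE_uniform_measureI) (auto simp: dyadic_eq digit_value_bin_digit)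
  qed auto
  also have "\<dots> = uniform_measure lborel {0..<1}"
    by (subst distr_id2) (auto simp: dyadic_eq)
  finally show ?thesis .
qed

definition bump_measure :: "real measure" where
  "bump_measure = density lborel (\<lambda>x. ennreal (bump x))"

lemma prob_space_bump_measure: "prob_space bump_measure"
  unfolding bump_measure_def
  by (rule prob_spaceI) (simp add: emeasure_density nn_integral_bump)

text \<open>The generalised inverse \<open>D.I\<close> of the distribution function transports the
  uniform law on the open unit interval. Extension by 0 and clipping to [0,1] give a bounded
  function on all reals and change nothing almost surely, as \<open>bump\<close> vanishes outside
  [0,1].\<close>

lemma bump_quantile_exists:
  "\<exists>q \<in> (borel_measurable borel :: (real \<Rightarrow> real) set). (\<forall>x. 0 \<le> q x \<and> q x \<le> 1) \<and>
    distr (uniform_measure lborel {0..<1}) borel q = bump_measure"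
proof -
  interpret D: prob_space bump_measure by (rule prob_space_bump_measure)
  interpret D: cdf_distribution bump_measure
    by (unfold_locales) (auto simp: bump_measure_def)
  let ?R = "restrict_space lborel {0<..<1::real}"
  define q0 where "q0 = (\<lambda>x. if x \<in> {0<..<1} then D.I x else 0)"
  have [measurable]: "q0 \<in> borel_measurable borel"
  proof -
    have "(\<lambda>x. indicator {0<..<1} x *\<^sub>R D.I x) \<in> borel_measurable borel"
      using D.measurable_CI by (subst (asm) borel_measurable_restrict_space_iff) auto
    also have "(\<lambda>x. indicator {0<..<1} x *\<^sub>R D.I x) = q0" by (auto simp: q0_def indicator_def)
    finally show ?thesis .
  qed
  define q where "q = (\<lambda>x. max 0 (min 1 (q0 x)))"
  have [measurable]: "q \<in> borel_measurable borel" unfolding q_def by measurable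
  have q0: "distr (uniform_measure lborel {0..<1}) borel q0 = bump_measure"
  proof (rule measure_eqI)
    fix A assume "A \<in> sets (distr (uniform_measure lborel {0..<1}) borel q0)"
    then have [measurable]: "A \<in> sets borel" by simp
    have [measurable]: "q0 -` A \<in> sets borel" 
      using measurable_sets[OF \<open>q0 \<in> borel_measurable borel\<close> \<open>A \<in> sets borel\<close>] by simp
    have "emeasure (distr (uniform_measure lborel {0..<1}) borel q0) A = emeasure lborel ({0..<1} \<inter> (q0 -` A))"
      by (subst emeasure_distr) (auto simp: divide_ennreal_def)
    also have "\<dots> = emeasure lborel ({0<..<1} \<inter> (q0 -` A))"
      by (rule emeasure_eq_AE) (use AE_lborel_singleton[of 0] in \<open>auto elim!: eventually_mono\<close>)
    also have "{0<..<1} \<inter> (q0 -` A) = D.I -` A \<inter> {0<..<1}" by (auto simp: q0_def)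
    also have "emeasure lborel \<dots> = emeasure (distr ?R borel D.I) A"
      by (subst emeasure_distr) (auto simp: emeasure_restrict_space space_restrict_space)
    finally show "emeasure (distr (uniform_measure lborel {0..<1}) borel q0) A = emeasure bump_measure A"
      by (simp add: D.distr_I_eq_M)
  qed (simp add: bump_measure_def)
  have "distr (uniform_measure lborel {0..<1}) borel q = distr bump_measure borel (\<lambda>x. max 0 (min 1 x))"
    unfolding q0[symmetric] by (subst distr_distr) (auto simp: comp_def q_def)
  also have "\<dots> = distr bump_measure borel (\<lambda>x. x)"
  proof (rule distr_cong_AE)
    show "AE x in bump_measure. max 0 (min 1 x) = x"
    proof -
      have "0 < bump x \<longrightarrow> max 0 (min 1 x) = x" for x
        using bump_eq_0[of x] by (cases "x \<in> {0..1}") auto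
      then show ?thesis unfolding bump_measure_def by (subst AE_density) auto
    qed
  qed (auto simp: bump_measure_def)
  also have "\<dots> = bump_measure" by (rule distr_id2) (simp add: bump_measure_def)
  finally have 1: "distr (uniform_measure lborel {0..<1}) borel q = bump_measure" .
  have 2: "\<forall>x. 0 \<le> q x \<and> q x \<le> 1" by (simp add: q_def)
  show ?thesis
  proof (rule bexI[where x=q])
    show "(\<forall>x. 0 \<le> q x \<and> q x \<le> 1) \<and> distr (uniform_measure lborel {0..<1}) borel q = bump_measure"
      by (rule conjI[OF 2 1])
  qed measurable
qed

definition bump_quantile :: "real \<Rightarrow> real" where
  "bump_quantile = (SOME q. q \<in> borel_measurable borel \<and> (\<forall>x. 0 \<le> q x \<and> q x \<le> 1) \<and>
    distr (uniform_measure lborel {0..<1}) borel q = bump_measure)"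

lemma bump_quantile:
  "bump_quantile \<in> borel_measurable borel" "0 \<le> bump_quantile x" "bump_quantile x \<le> 1"
  "distr (uniform_measure lborel {0..<1}) borel bump_quantile = bump_measure"
proof -
  have "bump_quantile \<in> borel_measurable borel \<and> (\<forall>x. 0 \<le> bump_quantile x \<and> bump_quantile x \<le> 1) \<and>
    distr (uniform_measure lborel {0..<1}) borel bump_quantile = bump_measure"
    using someI_ex[OF bump_quantile_exists[unfolded Bex_def]] unfolding bump_quantile_def .
  then show "bump_quantile \<in> borel_measurable borel" "0 \<le> bump_quantile x" "bump_quantile x \<le> 1"
    "distr (uniform_measure lborel {0..<1}) borel bump_quantile = bump_measure" by auto
qed

declare bump_quantile(1) [measurable]

text \<open>The shift by \<open>j ^ 3\<close> leaves row \<open>j\<close> untouched by the first \<open>j ^ 3\<close> digits.\<close>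

definition digit_row :: "nat \<Rightarrow> nat \<Rightarrow> nat" where
  "digit_row j k = prod_encode (j, k + j ^ 3)"

definition digit_bump :: "nat \<Rightarrow> real \<Rightarrow> real" where
  "digit_bump j r = bump_quantile (digit_value (\<lambda>k. bin_digit (digit_row j k) r))"

lemma digits_measurable [measurable]:
  "(\<lambda>r k. bin_digit (h k) r) \<in> measurable borel (PiM UNIV (\<lambda>_. count_space UNIV))"
  by (intro measurable_PiM_single') auto

lemma digit_bump_measurable [measurable]: "digit_bump j \<in> borel_measurable borel"
  unfolding digit_bump_def by measurable

lemma digit_bump_bounds: "0 \<le> digit_bump j r" "digit_bump j r \<le> 1"
  by (auto simp: digit_bump_def bump_quantile)

text \<open>Distinct rows use disjoint sets of digits. Rows with some digits frozen on the interval
  are included, so a block of free rows is independent of all remaining rows together.\<close>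

lemma digit_bump_indep:
  "prob_space.indep_vars (dyadic_prob n k) (\<lambda>_. borel) digit_bump UNIV"
proof -
  interpret P: prob_space "dyadic_prob n k" by (rule prob_space_dyadic)
  have "P.indep_vars (\<lambda>j. PiM (range (digit_row j)) (\<lambda>_. count_space UNIV))
      (\<lambda>j r. restrict (\<lambda>i. bin_digit i r) (range (digit_row j))) UNIV"
    by (rule P.indep_vars_restrict[OF digits_indep])
      (auto simp: disjoint_family_on_def digit_row_def)
  then have "P.indep_vars (\<lambda>_. borel) (\<lambda>j r. (\<lambda>f. bump_quantile (digit_value (\<lambda>k. f (digit_row j k))))
      (restrict (\<lambda>i. bin_digit i r) (range (digit_row j)))) UNIV"
  proof (rule P.indep_vars_compose2)
    fix j
    have [measurable]: "(\<lambda>f k. f (digit_row j k)) \<in> measurable (PiM (range (digit_row j)) (\<lambda>_. count_space UNIV))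
        (PiM UNIV (\<lambda>_. count_space (UNIV::bool set)))"
      by (intro measurable_PiM_single') auto
    show "(\<lambda>f. bump_quantile (digit_value (\<lambda>k. f (digit_row j k))))
        \<in> borel_measurable (PiM (range (digit_row j)) (\<lambda>_. count_space UNIV))"
      by measurable
  qed
  then show ?thesis by (simp add: digit_bump_def[abs_def])
qed

text \<open>\<open>prod_encode\<close> dominates its second argument, so every position in row
  \<open>j\<close> is at least j^3 \<ge> n and carries a fair digit.\<close>

lemma distr_digit_bump:
  assumes "n \<le> j ^ 3"
  shows "distr (dyadic_prob n k) borel (digit_bump j) = bump_measure"
proof -
  interpret P: prob_space "dyadic_prob n k" by (rule prob_space_dyadic)
  have "P.indep_vars (\<lambda>k. PiM {digit_row j k} (\<lambda>_. count_space UNIV))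
      (\<lambda>k r. restrict (\<lambda>i. bin_digit i r) {digit_row j k}) UNIV"
    by (rule P.indep_vars_restrict[OF digits_indep])
      (auto simp: disjoint_family_on_def digit_row_def)
  then have "P.indep_vars (\<lambda>_. count_space UNIV) (\<lambda>k r. (\<lambda>f. f (digit_row j k))
      (restrict (\<lambda>i. bin_digit i r) {digit_row j k})) UNIV"
    by (rule P.indep_vars_compose2) auto
  then have "P.indep_vars (\<lambda>_. count_space UNIV) (\<lambda>k. bin_digit (digit_row j k)) UNIV"
    by simp
  moreover have "n \<le> digit_row j i" for i
    using assms le_prod_encode_2[of "i + j ^ 3" j] by (simp add: digit_row_def)
  ultimately have "distr (dyadic_prob n k) borel (\<lambda>r. digit_value (\<lambda>i. bin_digit (digit_row j i) r)) = uniform_measure lborel {0..<1}"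
    by (intro P.distr_digit_value digit_distr)
  then have "distr (distr (dyadic_prob n k) borel (\<lambda>r. digit_value (\<lambda>i. bin_digit (digit_row j i) r))) borel bump_quantile = bump_measure"
    using bump_quantile(4) by simp
  then show ?thesis
    by (subst (asm) distr_distr) (auto simp: comp_def digit_bump_def[abs_def])
qed

lemma borel_measurable_vec_lambda:
  fixes f :: "'n::finite \<Rightarrow> 'a \<Rightarrow> real"
  assumes "\<And>i. f i \<in> borel_measurable M"
  shows "(\<lambda>r. (\<chi> i. f i r)) \<in> borel_measurable M"
  using assms by (subst borel_measurable_euclidean_space) (auto simp: Basis_vec_def inner_axis)

lemma bump_prod_measurable [measurable]: "bump_prod \<in> borel_measurable borel"
  by (intro borel_measurable_continuous_onI continuous_iter_partial[OF smooth_bump_prod, of "[]", simplified])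

text \<open>Open boxes are a generating system stable under intersection; on a box, independence
  factorises the law into one-dimensional integrals of \<open>bump\<close>.\<close>

lemma distr_digit_bump_vec:
  fixes s :: "'n::finite \<Rightarrow> nat"
  assumes "inj s" "\<And>i. n \<le> s i ^ 3"
  shows "distr (dyadic_prob n k) borel (\<lambda>r. (\<chi> i. digit_bump (s i) r)) = density lborel (\<lambda>x. ennreal (bump_prod x))"
    (is "?M = ?N")
proof -
  interpret P: prob_space "dyadic_prob n k" by (rule prob_space_dyadic)
  have [measurable]: "(\<lambda>r. (\<chi> i. digit_bump (s i) r)) \<in> borel_measurable borel"
    by (intro borel_measurable_vec_lambda) auto
  interpret M: prob_space ?M by (intro P.prob_space_distr) simp
  have Basis: "(Basis :: (real^'n) set) = range (\<lambda>i. axis i 1)" by (auto simp: Basis_vec_def)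
  have inj_axis: "inj (\<lambda>i::'n. axis i (1::real))" by (auto intro!: injI simp: axis_eq_axis)
  show ?thesis
  proof (rule measure_eqI_generator_eq)
    let ?E = "range (\<lambda>(a, b). box a b::(real^'n) set)"
    show "Int_stable ?E"
      by (auto simp: Int_stable_def box_Int_box)
    show "?E \<subseteq> Pow UNIV" "sets ?M = sigma_sets UNIV ?E" "sets ?N = sigma_sets UNIV ?E"
      by (simp_all add: borel_eq_box)
    let ?A = "\<lambda>n::nat. box (- (real n *\<^sub>R One)) (real n *\<^sub>R One) :: (real^'n) set"
    show "range ?A \<subseteq> ?E" "(\<Union>i. ?A i) = UNIV"
      unfolding UN_box_eq_UNIV by auto
    show "emeasure ?M (?A i) \<noteq> \<infinity>" for i
      using M.emeasure_finite by simp
    fix X assume "X \<in> ?E"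
    then obtain a b where X: "X = box a b" by auto
    have "emeasure ?M X = ennreal (P.prob (\<Inter>j\<in>range s. digit_bump j -` {a$(inv s j)<..<b$(inv s j)} \<inter> space (dyadic_prob n k)))"
    proof -
      have "(\<lambda>r. (\<chi> i. digit_bump (s i) r)) -` X \<inter> space (dyadic_prob n k)
        = (\<Inter>j\<in>range s. digit_bump j -` {a$(inv s j)<..<b$(inv s j)} \<inter> space (dyadic_prob n k))"
        using \<open>inj s\<close> by (auto simp: X mem_box_cart)
      then show ?thesis unfolding X by (subst emeasure_distr) (auto simp: P.emeasure_eq_measure)
    qed
    also have "P.prob (\<Inter>j\<in>range s. digit_bump j -` {a$(inv s j)<..<b$(inv s j)} \<inter> space (dyadic_prob n k))
      = (\<Prod>j\<in>range s. P.prob (digit_bump j -` {a$(inv s j)<..<b$(inv s j)} \<inter> space (dyadic_prob n k)))"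
      by (rule P.indep_varsD_finite[OF P.indep_vars_subset[OF digit_bump_indep]]) auto
    also have "\<dots> = (\<Prod>i\<in>UNIV. P.prob (digit_bump (s i) -` {a$i<..<b$i} \<inter> space (dyadic_prob n k)))"
      using \<open>inj s\<close> by (subst prod.reindex) auto
    also have "ennreal \<dots> = (\<Prod>i\<in>UNIV. emeasure bump_measure {a$i<..<b$i})"
    proof -
      have "emeasure bump_measure {a$i<..<b$i} = ennreal (P.prob (digit_bump (s i) -` {a$i<..<b$i} \<inter> space (dyadic_prob n k)))" for i
        by (subst distr_digit_bump[OF assms(2), of k i, symmetric], subst emeasure_distr)
          (auto simp: P.emeasure_eq_measure)
      then show ?thesis by (simp add: prod_ennreal)
    qed
    also have "\<dots> = (\<Prod>i\<in>UNIV. \<integral>\<^sup>+x. ennreal (bump x * indicator {a$i<..<b$i} x) \<partial>lborel)"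
      by (intro prod.cong refl) (auto simp: bump_measure_def emeasure_density ennreal_mult' bump_nonneg ennreal_indicator intro!: nn_integral_cong)
    also have "\<dots> = (\<Prod>c\<in>Basis. \<integral>\<^sup>+x. ennreal (bump x * indicator {a \<bullet> c<..<b \<bullet> c} x) \<partial>lborel)"
      unfolding Basis by (subst prod.reindex[OF inj_axis]) (simp add: inner_axis)
    also have "\<dots> = (\<integral>\<^sup>+x. (\<Prod>c\<in>Basis. ennreal (bump (x \<bullet> c) * indicator {a \<bullet> c<..<b \<bullet> c} (x \<bullet> c))) \<partial>lborel)"
      by (rule nn_integral_lborel_prod[symmetric]) auto
    also have "\<dots> = (\<integral>\<^sup>+x. ennreal (bump_prod x) * indicator X x \<partial>lborel)"
    proof (intro nn_integral_cong)
      fix x :: "real^'n"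
      have "(\<Prod>c\<in>Basis. ennreal (bump (x \<bullet> c) * indicator {a \<bullet> c<..<b \<bullet> c} (x \<bullet> c)))
        = (\<Prod>i\<in>UNIV. ennreal (bump (x$i) * indicator {a$i<..<b$i} (x$i)))"
        unfolding Basis by (subst prod.reindex[OF inj_axis]) (simp add: inner_axis)
      also have "\<dots> = ennreal (\<Prod>i\<in>UNIV. bump (x$i) * indicator {a$i<..<b$i} (x$i))"
        by (simp add: prod_ennreal bump_nonneg)
      also have "(\<Prod>i\<in>UNIV. bump (x$i) * indicator {a$i<..<b$i} (x$i)) = bump_prod x * indicator X x"
        by (auto simp: bump_prod_def X prod.distrib mem_box_cart indicator_def)
      finally show "(\<Prod>c\<in>Basis. ennreal (bump (x \<bullet> c) * indicator {a \<bullet> c<..<b \<bullet> c} (x \<bullet> c))) = ennreal (bump_prod x) * indicator X x"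
        by (simp add: ennreal_mult' bump_prod_nonneg ennreal_indicator)
    qed
    also have "\<dots> = emeasure ?N X" unfolding X by (subst emeasure_density) auto
    finally show "emeasure ?M X = emeasure ?N X" .
  qed
qed

section \<open>Linear change of variables from uniqueness of Haar measure\<close>

lemma translation_invariant_measure_eq:
  fixes M :: "'a::euclidean_space measure"
  assumes M: "sets M = sets borel" "sigma_finite_measure M"
    and inv: "\<And>c. distr M borel ((+) c) = M"
    and E [measurable]: "E \<in> sets borel" and F [measurable]: "F \<in> sets borel"
  shows "emeasure M E * emeasure lborel F = emeasure M F * emeasure lborel E"
proof -
  interpret M: sigma_finite_measure M by fact
  interpret pair_sigma_finite M lborel ..
  note M(1)[measurable_cong]
  have lb: "(\<integral>\<^sup>+y. f (c + y) \<partial>lborel) = (\<integral>\<^sup>+y. f y \<partial>lborel)"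
    if [measurable]: "f \<in> borel_measurable borel" for f :: "'a \<Rightarrow> ennreal" and c
    by (subst (2) lborel_distr_plus[of c, symmetric], subst nn_integral_distr) auto
  have lb_minus: "(\<integral>\<^sup>+y. f (c - y) \<partial>lborel) = (\<integral>\<^sup>+y. f y \<partial>lborel)"
    if [measurable]: "f \<in> borel_measurable borel" for f :: "'a \<Rightarrow> ennreal" and c
    by (subst (2) lborel_affine[of "-1" c], simp, subst nn_integral_density) (auto simp: nn_integral_distr)
  have Minv: "(\<integral>\<^sup>+x. f (c + x) \<partial>M) = (\<integral>\<^sup>+x. f x \<partial>M)"
    if [measurable]: "f \<in> borel_measurable borel" for f :: "'a \<Rightarrow> ennreal" and c
    by (subst (2) inv[of c, symmetric], subst nn_integral_distr) auto
  \<comment> \<open>Two evaluations of the double integral of 1_E(x) 1_F(x - y). Integrating over y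
    gives the left side by reflection invariance of Lebesgue measure; shifting x by y, which
    \<open>M\<close> permits, and exchanging the order gives the right side.\<close>
  have "emeasure M E * emeasure lborel F = (\<integral>\<^sup>+x. indicator E x * (\<integral>\<^sup>+y. indicator F (x - y) \<partial>lborel) \<partial>M)"
    by (simp add: lb_minus nn_integral_multc M(1))
  also have "\<dots> = (\<integral>\<^sup>+x. (\<integral>\<^sup>+y. indicator E x * indicator F (x - y) \<partial>lborel) \<partial>M)"
    by (simp add: nn_integral_cmult)
  also have "\<dots> = (\<integral>\<^sup>+y. (\<integral>\<^sup>+x. indicator E x * indicator F (x - y) \<partial>M) \<partial>lborel)"
    by (rule Fubini'[symmetric]) measurable
  also have "\<dots> = (\<integral>\<^sup>+y. (\<integral>\<^sup>+x. indicator E (y + x) * indicator F x \<partial>M) \<partial>lborel)"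
  proof (rule nn_integral_cong)
    fix y
    show "(\<integral>\<^sup>+x. indicator E x * indicator F (x - y) \<partial>M) = (\<integral>\<^sup>+x. indicator E (y + x) * indicator F x \<partial>M)"
      using Minv[of "\<lambda>x. indicator E x * indicator F (x - y)" y] by simp
  qed
  also have "\<dots> = (\<integral>\<^sup>+x. (\<integral>\<^sup>+y. indicator E (y + x) * indicator F x \<partial>lborel) \<partial>M)"
    by (rule Fubini') measurable
  also have "\<dots> = (\<integral>\<^sup>+x. (\<integral>\<^sup>+y. indicator E (x + y) \<partial>lborel) * indicator F x \<partial>M)"
    by (simp add: nn_integral_multc add.commute)
  also have "\<dots> = emeasure M F * emeasure lborel E"
    by (simp add: lb nn_integral_multc M(1) mult.commute)
  finally show ?thesis .
qed

lemma matrix_vec_component_bound: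
  fixes B :: "real^'n::finite^'n"
  assumes "\<And>i j. \<bar>B$i$j\<bar> \<le> \<beta>" "\<And>i. \<bar>x$i\<bar> \<le> 1"
  shows "\<bar>(B *v x)$i\<bar> \<le> real CARD('n) * \<beta>"
proof -
  have "\<beta> \<ge> 0" using assms(1)[of undefined undefined] by linarith
  have "\<bar>(B *v x)$i\<bar> \<le> (\<Sum>j\<in>(UNIV::'n set). \<beta> * 1)"
    unfolding matrix_vector_mult_def vec_lambda_beta
  proof (rule order.trans[OF sum_abs sum_mono])
    fix j show "\<bar>B$i$j * x$j\<bar> \<le> \<beta> * 1"
      unfolding abs_mult using assms \<open>\<beta> \<ge> 0\<close> by (intro mult_mono) auto
  qed
  then show ?thesis by simp
qed

lemma matrix_vector_mult_measurable [measurable]: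
  fixes A :: "real^'n::finite^'n"
  shows "(*v) A \<in> borel_measurable borel"
  by (intro borel_measurable_continuous_onI linear_continuous_on) simp

text \<open>The image of Lebesgue measure under \<open>A\<close> is translation invariant, hence a
  multiple \<open>m\<close> of it. This \<open>m\<close> is the volume of the image of the unit cube
  under \<open>B\<close>, which lies in a cube of side 2 CARD('n) \<beta>; so 1 / |det A| is bounded
  without determinants.\<close>

lemma nn_integral_matrix_image:
  fixes A B :: "real^'n::finite^'n"
  assumes AB: "A ** B = mat 1" "B ** A = mat 1" and \<beta>: "\<And>i j. \<bar>B$i$j\<bar> \<le> \<beta>"
  obtains m where "0 \<le> m" "m \<le> (2 * real CARD('n) * \<beta>) ^ CARD('n)"
    "\<And>h. h \<in> borel_measurable borel \<Longrightarrow>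
      (\<integral>\<^sup>+u. h (A *v u) \<partial>lborel) = ennreal m * (\<integral>\<^sup>+x. h x \<partial>lborel)"
proof -
  define M where "M = distr lborel borel ((*v) A)"
  have BA: "B *v (A *v x) = x" "A *v (B *v x) = x" for x
    using AB by (simp_all add: matrix_vector_mul_assoc)
  have vim: "(*v) A -` S = (*v) B ` S" for S
    using BA by (auto simp: image_iff) metis
  have fin: "emeasure M (cbox a b) < \<infinity>" for a b
  proof -
    have "bounded ((*v) B ` cbox a b)"
      by (intro bounded_linear_image bounded_cbox matrix_vector_mul_bounded_linear)
    from emeasure_bounded_finite[OF this] show ?thesis
      unfolding M_def by (subst emeasure_distr) (auto simp: vim)
  qed
  have "sigma_finite_measure M"
  proof
    let ?A = "\<lambda>n::nat. cbox (- (real n *\<^sub>R One)) (real n *\<^sub>R One) :: (real^'n) set"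
    have "(\<Union>n::nat. box (- (real n *\<^sub>R One)) (real n *\<^sub>R One) :: (real^'n) set) \<subseteq> (\<Union>i. ?A i)"
      by (intro UN_mono box_subset_cbox subset_refl)
    then have "(\<Union>i. ?A i) = UNIV" unfolding UN_box_eq_UNIV by (rule top.extremum_uniqueI)
    then show "\<exists>A. countable A \<and> A \<subseteq> sets M \<and> \<Union>A = space M \<and> (\<forall>a\<in>A. emeasure M a \<noteq> \<infinity>)"
      using fin by (intro exI[of _ "range ?A"]) (auto simp: M_def less_top)
  qed
  moreover have "distr M borel ((+) c) = M" for c
  proof -
    have "distr M borel ((+) c) = distr lborel borel (\<lambda>u. A *v (B *v c + u))"
      unfolding M_def by (subst distr_distr) (auto simp: comp_def matrix_vector_right_distrib BA)
    also have "\<dots> = distr (distr lborel borel ((+) (B *v c))) borel ((*v) A)"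
      by (subst distr_distr) (auto simp: comp_def)
    finally show ?thesis by (simp add: lborel_distr_plus M_def)
  qed
  moreover have "sets M = sets borel" by (simp add: M_def)
  ultimately have key: "emeasure M E * emeasure lborel F = emeasure M F * emeasure lborel E"
    if "E \<in> sets borel" "F \<in> sets borel" for E F
    using that by (intro translation_invariant_measure_eq)
  let ?F = "cbox 0 1 :: (real^'n) set"
  have box: "emeasure lborel (cbox (vec a) (vec b) :: (real^'n) set) = ennreal ((b - a) ^ CARD('n))" if "a \<le> b" for a b :: real
  proof -
    have "(vec b - vec a :: real^'n) \<bullet> i = b - a" if "i \<in> Basis" for i
      using that by (auto simp: Basis_vec_def inner_axis)
    moreover have "(vec a :: real^'n) \<bullet> i \<le> vec b \<bullet> i" if "i \<in> Basis" for i
      using that \<open>a \<le> b\<close> by (auto simp: Basis_vec_def inner_axis)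
    ultimately show ?thesis by (subst emeasure_lborel_cbox) auto
  qed
  have F1: "emeasure lborel ?F = 1"
    using box[of 0 1] by simp
  define m where "m = measure M ?F"
  have m: "emeasure M ?F = ennreal m"
    unfolding m_def using fin[of 0 1] by (intro emeasure_eq_ennreal_measure) auto
  have "M = density lborel (\<lambda>_. ennreal m)"
  proof (rule measure_eqI)
    fix E assume "E \<in> sets M"
    then have [measurable]: "E \<in> sets borel" by (simp add: M_def)
    show "emeasure M E = emeasure (density lborel (\<lambda>_. ennreal m)) E"
      using key[of E ?F] by (simp add: F1 m emeasure_density_const)
  qed (simp add: M_def)
  have h: "(\<integral>\<^sup>+u. h (A *v u) \<partial>lborel) = ennreal m * (\<integral>\<^sup>+x. h x \<partial>lborel)"
    if [measurable]: "h \<in> borel_measurable borel" for h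
  proof -
    have "(\<integral>\<^sup>+u. h (A *v u) \<partial>lborel) = (\<integral>\<^sup>+x. h x \<partial>M)"
      unfolding M_def by (subst nn_integral_distr) auto
    also have "\<dots> = ennreal m * (\<integral>\<^sup>+x. h x \<partial>lborel)"
      unfolding \<open>M = density lborel (\<lambda>_. ennreal m)\<close> by (subst nn_integral_density) (auto simp: nn_integral_cmult)
    finally show ?thesis .
  qed
  have "\<beta> \<ge> 0" using \<beta>[of undefined undefined] by linarith
  let ?c = "real CARD('n) * \<beta>"
  have "emeasure M ?F = emeasure lborel ((*v) B ` ?F)"
    unfolding M_def by (subst emeasure_distr) (auto simp: vim)
  also have "\<dots> \<le> emeasure lborel (cbox (vec (- ?c)) (vec ?c) :: (real^'n) set)"
  proof (rule emeasure_mono)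
    show "(*v) B ` ?F \<subseteq> cbox (vec (- ?c)) (vec ?c)"
    proof
      fix z assume "z \<in> (*v) B ` ?F"
      then obtain x where z: "z = B *v x" and x: "x \<in> ?F" by blast
      have "\<bar>z$i\<bar> \<le> ?c" for i
        unfolding z using x by (intro matrix_vec_component_bound[OF \<beta>]) (auto simp: mem_box_cart abs_le_iff intro: order.trans[of _ 0])
      then show "z \<in> cbox (vec (- ?c)) (vec ?c)"
        unfolding mem_box_cart vec_component by (auto simp: abs_le_iff minus_le_iff)
    qed
  qed simp
  also have "\<dots> = ennreal ((2 * ?c) ^ CARD('n))"
    using \<open>\<beta> \<ge> 0\<close> by (subst box) (auto simp: mult_ac)
  finally have "m \<le> (2 * ?c) ^ CARD('n)"
    using \<open>\<beta> \<ge> 0\<close> by (simp add: m)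
  then show ?thesis using h by (intro that[of m]) (auto simp: m_def mult_ac)
qed

section \<open>Local times of digit paths\<close>

text \<open>The cut-off is the Volterra condition: row \<open>j\<close> will carry the value of the
  driving process at time 1 / 2^(j^3), which is available only from that time on.\<close>

definition digit_path :: "(nat \<Rightarrow> 'b::real_normed_vector) \<Rightarrow> real \<Rightarrow> 'b" where
  "digit_path v r = (\<Sum>j. (if 1 / 2 ^ (j ^ 3) \<le> r then digit_bump j r else 0) *\<^sub>R v j)"

lemma digit_path_measurable [measurable]:
  fixes v :: "nat \<Rightarrow> 'b::euclidean_space"
  shows "digit_path v \<in> borel_measurable borel"
  unfolding digit_path_def[abs_def] by measurable

text \<open>What one sample path has to satisfy. \<open>block n\<close> selects rows that are free
  on dyadic intervals of level \<open>n\<close>, the matrix to be inverted has their vectors as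
  columns, and the last assumption is the growth 2^o(n).\<close>

locale digit_path_blocks =
  fixes v :: "nat \<Rightarrow> real^'n::finite" and block :: "nat \<Rightarrow> 'n \<Rightarrow> nat"
    and Bm :: "nat \<Rightarrow> real^'n^'n" and \<beta> :: "nat \<Rightarrow> real"
  assumes summable_v: "summable (\<lambda>j. norm (v j))"
    and inj_block: "inj (block n)" and block_ge: "n \<le> block n i ^ 3"
    and inverse1: "(\<chi> a i. v (block n i) $ a) ** Bm n = mat 1"
    and inverse2: "Bm n ** (\<chi> a i. v (block n i) $ a) = mat 1"
    and Bm_bound: "\<bar>Bm n $ i $ j\<bar> \<le> \<beta> n" and \<beta>_ge_1: "1 \<le> \<beta> n"
    and \<beta>_growth: "\<delta> > 0 \<Longrightarrow> \<exists>C. \<forall>n. \<beta> n \<le> C * 2 powr (\<delta> * real n)"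
begin

abbreviation Am :: "nat \<Rightarrow> real^'n^'n" where
  "Am n \<equiv> (\<chi> a i. v (block n i) $ a)"

definition rest :: "nat \<Rightarrow> real \<Rightarrow> real^'n" where
  "rest n = digit_path (\<lambda>j. if j \<in> range (block n) then 0 else v j)"

lemma rest_measurable [measurable]: "rest n \<in> borel_measurable borel"
  unfolding rest_def by measurable

lemma summable_weighted:
  assumes "\<And>j. \<bar>c j\<bar> \<le> 1"
  shows "summable (\<lambda>j. c j *\<^sub>R (if j \<in> J then 0 else v j))" "summable (\<lambda>j. norm (c j *\<^sub>R v j))"
proof -
  have "norm (c j *\<^sub>R v j) \<le> norm (v j)" for j
    using assms[of j] mult_right_mono[of "\<bar>c j\<bar>" 1 "norm (v j)"] by simp
  then show "summable (\<lambda>j. norm (c j *\<^sub>R v j))"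
    by (intro summable_comparison_test[OF _ summable_v]) auto
  then have "summable (\<lambda>j. norm (c j *\<^sub>R (if j \<in> J then 0 else v j)))"
    by (rule summable_comparison_test[rotated]) auto
  then show "summable (\<lambda>j. c j *\<^sub>R (if j \<in> J then 0 else v j))"
    by (rule summable_norm_cancel)
qed

lemma digit_weight_bound: "\<bar>if P then digit_bump j r else 0\<bar> \<le> 1"
  using digit_bump_bounds[of j r] by auto

lemma norm_digit_path_le: "norm (digit_path v r) \<le> (\<Sum>j. norm (v j))"
proof -
  let ?c = "\<lambda>j. if 1 / 2 ^ (j ^ 3) \<le> r then digit_bump j r else 0"
  have s: "summable (\<lambda>j. norm (?c j *\<^sub>R v j))"
    by (rule summable_weighted(2)) (rule digit_weight_bound)
  have "norm (digit_path v r) \<le> (\<Sum>j. norm (?c j *\<^sub>R v j))"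
    unfolding digit_path_def by (rule summable_norm[OF s])
  also have "\<dots> \<le> (\<Sum>j. norm (v j))"
  proof (rule suminf_le[OF _ s summable_v])
    fix j
    show "norm (?c j *\<^sub>R v j) \<le> norm (v j)"
      using digit_weight_bound[of "1 / 2 ^ (j ^ 3) \<le> r" j r] mult_right_mono[of "\<bar>?c j\<bar>" 1 "norm (v j)"]
      unfolding norm_scaleR by simp
  qed
  finally show ?thesis .
qed

lemma block_split:
  assumes c: "\<And>j. \<bar>c j\<bar> \<le> 1"
  shows "(\<Sum>j. c j *\<^sub>R v j) = (\<Sum>j. c j *\<^sub>R (if j \<in> range (block n) then 0 else v j)) + Am n *v (\<chi> i. c (block n i))"
proof -
  let ?R = "range (block n)"
  have 1: "summable (\<lambda>j. c j *\<^sub>R (if j \<in> ?R then 0 else v j))"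
    using c by (rule summable_weighted)
  have 2: "(\<lambda>j. if j \<in> ?R then c j *\<^sub>R v j else 0) sums (\<Sum>j\<in>?R. c j *\<^sub>R v j)"
    by (rule sums_If_finite_set) simp
  have "(\<Sum>j\<in>?R. c j *\<^sub>R v j) = (\<Sum>i\<in>UNIV. c (block n i) *\<^sub>R v (block n i))"
    by (subst sum.reindex[OF inj_block]) simp
  also have "\<dots> = Am n *v (\<chi> i. c (block n i))"
    by (simp add: vec_eq_iff matrix_vector_mult_def sum_component mult.commute)
  finally have eq: "(\<Sum>j\<in>?R. c j *\<^sub>R v j) = Am n *v (\<chi> i. c (block n i))" .
  have "(\<Sum>j. c j *\<^sub>R v j) = (\<Sum>j. c j *\<^sub>R (if j \<in> ?R then 0 else v j) + (if j \<in> ?R then c j *\<^sub>R v j else 0))"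
    by (intro arg_cong[where f=suminf]) auto
  also have "\<dots> = (\<Sum>j. c j *\<^sub>R (if j \<in> ?R then 0 else v j)) + (\<Sum>j. if j \<in> ?R then c j *\<^sub>R v j else 0)"
    by (rule suminf_add[symmetric, OF 1 sums_summable[OF 2]])
  finally show ?thesis using sums_unique[OF 2] eq by simp
qed

text \<open>The cut-offs are constant on a dyadic interval of level \<open>n\<close>: for
  \<open>J \<ge> n\<close> the threshold does not exceed the left end, for \<open>J < n\<close> it
  is itself an endpoint of level \<open>n\<close>. \<open>1 \<le> k\<close> excludes the interval
  starting at 0, where the thresholds accumulate.\<close>

lemma active_dyadic:
  assumes "r \<in> dyadic n k" "1 \<le> k"
  shows "1 / 2 ^ J \<le> r \<longleftrightarrow> n \<le> J \<or> 2 ^ (n - J) \<le> k"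
proof (cases "n \<le> J")
  case True
  have "(1::real) / 2 ^ J \<le> 1 / 2 ^ n" using True by (simp add: frac_le)
  also have "\<dots> \<le> real_of_int k / 2 ^ n" using assms by (simp add: divide_right_mono)
  also have "\<dots> \<le> r" using assms by (simp add: dyadic_eq)
  finally show ?thesis using True by simp
next
  case False
  then have "(2::real) ^ n = 2 ^ J * 2 ^ (n - J)" by (simp flip: power_add)
  then have "1 / 2 ^ J \<le> r \<longleftrightarrow> real_of_int (2 ^ (n - J)) \<le> 2 ^ n * r"
    by (simp add: field_simps)
  also have "\<dots> \<longleftrightarrow> 2 ^ (n - J) \<le> k"
    using assms(1) le_floor_iff[of "2 ^ (n - J)" "2 ^ n * r"] by (auto simp: dyadic_def)
  finally show ?thesis using False by simp
qed

text \<open>The value is 1 / |det (Am n)|; choosing it together with its bound keeps determinants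
  out.\<close>

definition scale :: "nat \<Rightarrow> real" where
  "scale n = (SOME m. 0 \<le> m \<and> m \<le> (2 * real CARD('n) * \<beta> n) ^ CARD('n) \<and>
    (\<forall>h \<in> borel_measurable borel. (\<integral>\<^sup>+u. h (Am n *v u) \<partial>lborel) = ennreal m * (\<integral>\<^sup>+x. h x \<partial>lborel)))"

lemma scale: "0 \<le> scale n" "scale n \<le> (2 * real CARD('n) * \<beta> n) ^ CARD('n)"
    "h \<in> borel_measurable borel \<Longrightarrow>
      (\<integral>\<^sup>+u. h (Am n *v u) \<partial>lborel) = ennreal (scale n) * (\<integral>\<^sup>+x. h x \<partial>lborel)"
proof -
  have "\<exists>m. 0 \<le> m \<and> m \<le> (2 * real CARD('n) * \<beta> n) ^ CARD('n) \<and>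
    (\<forall>h \<in> borel_measurable borel. (\<integral>\<^sup>+u. h (Am n *v u) \<partial>lborel) = ennreal m * (\<integral>\<^sup>+x. h x \<partial>lborel))"
    by (rule nn_integral_matrix_image[OF inverse1 inverse2 Bm_bound, of n]) blast
  from someI_ex[OF this, folded scale_def]
  show "0 \<le> scale n" "scale n \<le> (2 * real CARD('n) * \<beta> n) ^ CARD('n)"
    "h \<in> borel_measurable borel \<Longrightarrow>
      (\<integral>\<^sup>+u. h (Am n *v u) \<partial>lborel) = ennreal (scale n) * (\<integral>\<^sup>+x. h x \<partial>lborel)" by blast+
qed

definition dens :: "nat \<Rightarrow> real^'n \<Rightarrow> real" where
  "dens n x = scale n * bump_prod (Bm n *v x)"

lemma dens_nonneg: "0 \<le> dens n x"
  by (simp add: dens_def scale bump_prod_nonneg)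

lemma smooth_dens: "smooth (dens n)"
  unfolding dens_def[abs_def] using smooth_affine[OF smooth_bump_prod, of "Bm n" 0]
  by (intro smooth_cmult) simp

lemma dens_measurable [measurable]: "dens n \<in> borel_measurable borel"
  unfolding dens_def[abs_def] by measurable

text \<open>Under the uniform law on the interval the path is y + A U, with U made of the block rows
  and y of the others, independent of each other. Integrating out U, whose density is
  \<open>bump_prod\<close>, replaces the indicator by the smooth density \<open>dens n\<close>
  centred at \<open>rest n r\<close>; the average over \<open>r\<close> that remains only mixes
  translates of it.\<close>

lemma occupation_dyadic:
  assumes S [measurable]: "S \<in> sets borel" and k: "1 \<le> k"
  shows "(\<integral>\<^sup>+r\<in>dyadic n k. indicator S (digit_path v r) \<partial>lborel)
    = (\<integral>\<^sup>+r\<in>dyadic n k. (\<integral>\<^sup>+x. indicator S x * ennreal (dens n (x - rest n r)) \<partial>lborel) \<partial>lborel)"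
proof -
  interpret P: prob_space "dyadic_prob n k" by (rule prob_space_dyadic)
  let ?R = "range (block n)"
  let ?v' = "\<lambda>j. if j \<in> ?R then 0 else v j"
  define act where "act j = (n \<le> j ^ 3 \<or> 2 ^ (n - j ^ 3) \<le> k)" for j :: nat
  define U where "U r = (\<chi> i. digit_bump (block n i) r)" for r
  \<comment> \<open>Freezing the cut-offs at their value \<open>act\<close> makes this a function of
    the other rows alone; on the interval it agrees with \<open>rest n\<close>.\<close>
  define Y where "Y w = (\<Sum>j. (if act j \<and> j \<notin> ?R then w j else 0) *\<^sub>R v j)" for w :: "nat \<Rightarrow> real"
  define y where "y r = Y (restrict (\<lambda>j. digit_bump j r) (- ?R))" for r
  have Y_meas [measurable]: "Y \<in> borel_measurable (PiM (-?R) (\<lambda>_. borel))"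
    unfolding Y_def
  proof (intro borel_measurable_suminf borel_measurable_scaleR)
    fix j
    show "(\<lambda>w. if act j \<and> j \<notin> ?R then w j else 0) \<in> borel_measurable (PiM (-?R) (\<lambda>_. borel))"
      by (cases "act j \<and> j \<notin> ?R") auto
  qed simp
  have y: "y r = rest n r" "digit_path v r = y r + Am n *v U r" if r: "r \<in> dyadic n k" for r
  proof -
    have act: "1 / 2 ^ (j ^ 3) \<le> r \<longleftrightarrow> act j" for j
      unfolding act_def by (rule active_dyadic[OF r k])
    show y: "y r = rest n r"
      unfolding y_def Y_def rest_def digit_path_def act
      by (intro arg_cong[where f=suminf] ext) auto
    have "act (block n i)" for i using block_ge by (simp add: act_def)
    then have "U r = (\<chi> i. if act (block n i) then digit_bump (block n i) r else 0)"
      by (simp add: U_def)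
    then show "digit_path v r = y r + Am n *v U r"
      unfolding y rest_def digit_path_def act
      using block_split[of "\<lambda>j. if act j then digit_bump j r else 0" n, OF digit_weight_bound] by simp
  qed
  have [measurable]: "U \<in> borel_measurable borel"
    unfolding U_def[abs_def] by (intro borel_measurable_vec_lambda) auto
  have indep: "P.indep_var borel U borel y"
  proof -
    have 1: "P.indep_var (PiM ?R (\<lambda>_. borel)) (\<lambda>r. restrict (\<lambda>j. digit_bump j r) ?R)
       (PiM (-?R) (\<lambda>_. borel)) (\<lambda>r. restrict (\<lambda>j. digit_bump j r) (-?R))"
      by (rule P.indep_var_restrict[OF digit_bump_indep]) auto
    have [measurable]: "(\<lambda>w. (\<chi> i. w (block n i))) \<in> borel_measurable (PiM ?R (\<lambda>_. borel :: real measure))"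
      by (intro borel_measurable_vec_lambda measurable_component_singleton) auto
    have "P.indep_var borel ((\<lambda>w. (\<chi> i. w (block n i))) \<circ> (\<lambda>r. restrict (\<lambda>j. digit_bump j r) ?R))
       borel (Y \<circ> (\<lambda>r. restrict (\<lambda>j. digit_bump j r) (-?R)))"
      by (rule P.indep_var_compose[OF 1]) measurable
    moreover have "(\<lambda>w. (\<chi> i. w (block n i))) \<circ> (\<lambda>r. restrict (\<lambda>j. digit_bump j r) ?R) = U"
      by (auto simp: U_def fun_eq_iff)
    moreover have "Y \<circ> (\<lambda>r. restrict (\<lambda>j. digit_bump j r) (-?R)) = y"
      by (auto simp: y_def fun_eq_iff)
    ultimately show ?thesis by simp
  qed
  have U_distr: "distr (dyadic_prob n k) borel U = density lborel (\<lambda>x. ennreal (bump_prod x))"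
    unfolding U_def[abs_def] by (rule distr_digit_bump_vec[OF inj_block block_ge])
  have [measurable]: "y \<in> borel_measurable borel" using P.indep_var_rv2[OF indep] by simp
  have [measurable]: "U \<in> borel_measurable (dyadic_prob n k)" "y \<in> borel_measurable (dyadic_prob n k)" by simp_all
  interpret DU: prob_space "distr (dyadic_prob n k) borel U" by (rule P.prob_space_distr) simp
  interpret Dy: prob_space "distr (dyadic_prob n k) borel y" by (rule P.prob_space_distr) simp
  interpret pair_sigma_finite "distr (dyadic_prob n k) borel U" "distr (dyadic_prob n k) borel y" ..
  let ?f = "\<lambda>(u, w). indicator S (w + Am n *v u) :: ennreal"
  have [measurable]: "?f \<in> borel_measurable (borel \<Otimes>\<^sub>M borel)" by measurable
  \<comment> \<open>The substitution x = A u brings in \<open>scale n\<close> and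
    \<open>Bm n\<close>; translation by \<open>w\<close> recentres the density.\<close>
  have conv: "(\<integral>\<^sup>+u. indicator S (w + Am n *v u) \<partial>distr (dyadic_prob n k) borel U)
      = (\<integral>\<^sup>+x. indicator S x * ennreal (dens n (x - w)) \<partial>lborel)" for w
  proof -
    have "(\<integral>\<^sup>+u. indicator S (w + Am n *v u) \<partial>distr (dyadic_prob n k) borel U)
      = (\<integral>\<^sup>+u. ennreal (bump_prod u) * indicator S (w + Am n *v u) \<partial>lborel)"
      unfolding U_distr by (subst nn_integral_density) auto
    also have "\<dots> = (\<integral>\<^sup>+u. ennreal (bump_prod (Bm n *v (Am n *v u))) * indicator S (w + Am n *v u) \<partial>lborel)"
      using inverse2[of n] by (simp add: matrix_vector_mul_assoc)
    also have "\<dots> = ennreal (scale n) * (\<integral>\<^sup>+x. ennreal (bump_prod (Bm n *v x)) * indicator S (w + x) \<partial>lborel)"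
      by (subst scale(3)) auto
    also have "\<dots> = (\<integral>\<^sup>+x. ennreal (dens n x) * indicator S (w + x) \<partial>lborel)"
      by (subst nn_integral_cmult[symmetric])
        (auto simp: dens_def ennreal_mult' scale mult.assoc intro!: nn_integral_cong)
    also have "\<dots> = (\<integral>\<^sup>+x. ennreal (dens n (x - w)) * indicator S x \<partial>lborel)"
      by (subst (2) lborel_distr_plus[of w, symmetric], subst nn_integral_distr) auto
    finally show ?thesis by (simp add: mult.commute)
  qed
  have "(\<integral>\<^sup>+r. ?f (U r, y r) \<partial>dyadic_prob n k) = (\<integral>\<^sup>+p. ?f p \<partial>distr (dyadic_prob n k) (borel \<Otimes>\<^sub>M borel) (\<lambda>r. (U r, y r)))"
    by (subst nn_integral_distr) auto
  also have "\<dots> = (\<integral>\<^sup>+p. ?f p \<partial>(distr (dyadic_prob n k) borel U \<Otimes>\<^sub>M distr (dyadic_prob n k) borel y))"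
    using indep unfolding P.indep_var_distribution_eq by simp
  also have "\<dots> = (\<integral>\<^sup>+w. (\<integral>\<^sup>+u. ?f (u, w) \<partial>distr (dyadic_prob n k) borel U) \<partial>distr (dyadic_prob n k) borel y)"
    by (subst nn_integral_snd[symmetric]) (auto simp: split_beta')
  also have "\<dots> = (\<integral>\<^sup>+w. (\<integral>\<^sup>+x. indicator S x * ennreal (dens n (x - w)) \<partial>lborel) \<partial>distr (dyadic_prob n k) borel y)"
    by (simp add: conv)
  also have "\<dots> = (\<integral>\<^sup>+r. (\<integral>\<^sup>+x. indicator S x * ennreal (dens n (x - y r)) \<partial>lborel) \<partial>dyadic_prob n k)"
    by (subst nn_integral_distr) auto
  finally have *: "(\<integral>\<^sup>+r. ?f (U r, y r) \<partial>dyadic_prob n k) = \<dots>" .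
  have uni: "(\<integral>\<^sup>+r\<in>dyadic n k. h r \<partial>lborel) = ennreal (1 / 2 ^ n) * (\<integral>\<^sup>+r. h r \<partial>dyadic_prob n k)"
    if [measurable]: "h \<in> borel_measurable borel" for h
  proof -
    have "ennreal (1 / 2 ^ n) * ((\<integral>\<^sup>+r\<in>dyadic n k. h r \<partial>lborel) / ennreal (1 / 2 ^ n)) = (\<integral>\<^sup>+r\<in>dyadic n k. h r \<partial>lborel)"
      by (subst ennreal_times_divide, subst mult.commute, rule ennreal_mult_divide_eq) auto
    then show ?thesis
      by (subst nn_integral_uniform_measure) (auto simp: emeasure_dyadic)
  qed
  have "(\<integral>\<^sup>+r\<in>dyadic n k. indicator S (digit_path v r) \<partial>lborel) = (\<integral>\<^sup>+r\<in>dyadic n k. ?f (U r, y r) \<partial>lborel)"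
    using y by (intro nn_integral_cong) (auto simp: indicator_def)
  also have "\<dots> = (\<integral>\<^sup>+r\<in>dyadic n k. (\<integral>\<^sup>+x. indicator S x * ennreal (dens n (x - y r)) \<partial>lborel) \<partial>lborel)"
    using * by (subst (1 2) uni) auto
  also have "\<dots> = (\<integral>\<^sup>+r\<in>dyadic n k. (\<integral>\<^sup>+x. indicator S x * ennreal (dens n (x - rest n r)) \<partial>lborel) \<partial>lborel)"
    using y by (intro nn_integral_cong) (auto simp: indicator_def)
  finally show ?thesis .
qed

end

section \<open>Maximal dyadic intervals inside a time interval\<close>

definition fits :: "real \<Rightarrow> real \<Rightarrow> nat \<Rightarrow> real \<Rightarrow> bool" where
  "fits s t n r \<longleftrightarrow> s < real_of_int \<lfloor>2 ^ n * r\<rfloor> / 2 ^ n \<and> (real_of_int \<lfloor>2 ^ n * r\<rfloor> + 1) / 2 ^ n \<le> t"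

text \<open>The level of the largest dyadic interval around \<open>r\<close> inside (s,t). The
  strict inequality at \<open>s\<close> in \<open>fits\<close> forces a positive left end when s
  \<ge> 0, as \<open>occupation_dyadic\<close> requires.\<close>

definition lev :: "real \<Rightarrow> real \<Rightarrow> real \<Rightarrow> nat" where
  "lev s t r = (LEAST n. fits s t n r)"

lemma fits_measurable [measurable]: "Measurable.pred borel (fits s t n)"
  unfolding fits_def[abs_def] by measurable

lemma lev_measurable [measurable]: "lev s t \<in> measurable borel (count_space UNIV)"
  unfolding lev_def[abs_def] by measurable

lemma floor_dyadic_bounds:
  "r - 1 / 2 ^ n < real_of_int \<lfloor>2 ^ n * r\<rfloor> / 2 ^ n" "real_of_int \<lfloor>2 ^ n * r\<rfloor> / 2 ^ n \<le> (r::real)"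
proof -
  have "r \<in> dyadic n \<lfloor>2 ^ n * r\<rfloor>" by (simp add: dyadic_def)
  then show "r - 1 / 2 ^ n < real_of_int \<lfloor>2 ^ n * r\<rfloor> / 2 ^ n" "real_of_int \<lfloor>2 ^ n * r\<rfloor> / 2 ^ n \<le> (r::real)"
    unfolding dyadic_eq by (auto simp: add_divide_distrib)
qed

lemma fits_imp: "fits s t n r \<Longrightarrow> s < r" "fits s t n r \<Longrightarrow> r < t"
  using floor_dyadic_bounds[where r=r and n=n] by (auto simp: fits_def add_divide_distrib)

lemma not_fits: "\<not> fits s t n r \<Longrightarrow> r - s \<le> 1 / 2 ^ n \<or> t - r \<le> 1 / 2 ^ n"
  using floor_dyadic_bounds[where r=r and n=n] by (auto simp: fits_def add_divide_distrib)

lemma fits_lev: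
  assumes "s < r" "r < t"
  shows "fits s t (lev s t r) r"
proof -
  have "0 < min (r - s) (t - r)" using assms by simp
  then obtain n where "(1 / 2 :: real) ^ n < min (r - s) (t - r)"
    using real_arch_pow_inv[OF \<open>0 < min (r - s) (t - r)\<close>, of "1/2"] by auto
  then have "fits s t n r" using not_fits[of s t n r] by (auto simp: power_one_over)
  then show ?thesis unfolding lev_def by (rule LeastI)
qed

text \<open>One level below \<open>lev\<close> the interval around \<open>r\<close> does not fit, so
  the distance of \<open>r\<close> to one end of (s,t) is at most 2 / 2^lev. The summand 1 covers
  level 0.\<close>

lemma lev_powr_bound:
  assumes r: "s < r" "r < t" and "0 < \<delta>"
  shows "2 powr (\<delta> * real (lev s t r)) \<le> 1 + (2 / (r - s)) powr \<delta> + (2 / (t - r)) powr \<delta>"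
proof (cases "lev s t r")
  case (Suc m)
  then have "\<not> fits s t m r" unfolding lev_def by (intro not_less_Least) simp
  then have "r - s \<le> 1 / 2 ^ m \<or> t - r \<le> 1 / 2 ^ m" by (rule not_fits)
  then have "2 ^ lev s t r \<le> 2 / (r - s) \<or> 2 ^ lev s t r \<le> 2 / (t - r)"
  proof -
    have "2 ^ Suc m \<le> 2 / a" if "0 < a" "a \<le> 1 / 2 ^ m" for a :: real
      using that by (simp add: field_simps)
    with \<open>r - s \<le> 1 / 2 ^ m \<or> t - r \<le> 1 / 2 ^ m\<close> r show ?thesis unfolding Suc by (meson diff_gt_0_iff_gt)
  qed
  moreover have "2 powr (\<delta> * real (lev s t r)) = (2 ^ lev s t r) powr \<delta>"
    by (simp add: powr_powr mult.commute flip: powr_realpow)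
  ultimately have "2 powr (\<delta> * real (lev s t r)) \<le> (2 / (r - s)) powr \<delta> \<or>
      2 powr (\<delta> * real (lev s t r)) \<le> (2 / (t - r)) powr \<delta>"
    using \<open>0 < \<delta>\<close> by (auto intro: powr_mono2)
  moreover have "0 \<le> (2 / (r - s)) powr \<delta>" "0 \<le> (2 / (t - r)) powr \<delta>" by simp_all
  ultimately show ?thesis by linarith
qed simp

text \<open>Points of one dyadic interval of level \<open>n\<close> have equal floors at all coarser
  levels, hence agree on \<open>fits\<close> up to \<open>n\<close>. So the points of level
  \<open>n\<close> form whole dyadic intervals, and over all \<open>n\<close> these partition
  (s,t).\<close>

lemma lev_dyadic:
  assumes "r \<in> dyadic n k" "r' \<in> dyadic n k" "s < r" "r < t" "lev s t r = n"
  shows "s < r'" "r' < t" "lev s t r' = n"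
proof -
  have eq: "fits s t m r' = fits s t m r" if "m \<le> n" for m
    using assms(1,2) floor_scale_div[OF that, of r] floor_scale_div[OF that, of r']
    by (simp add: fits_def dyadic_def)
  have "fits s t n r" using fits_lev[OF assms(3,4)] assms(5) by simp
  then have f: "fits s t n r'" using eq by simp
  then show "s < r'" "r' < t" by (rule fits_imp)+
  show "lev s t r' = n"
    unfolding lev_def
  proof (rule Least_equality)
    show "fits s t n r'" by (rule f)
    fix m assume "fits s t m r'"
    show "n \<le> m"
    proof (rule ccontr)
      assume "\<not> n \<le> m"
      then have "fits s t m r" using eq \<open>fits s t m r'\<close> by simp
      then have "lev s t r \<le> m" unfolding lev_def by (rule Least_le)
      then show False using \<open>\<not> n \<le> m\<close> assms(5) by simp
    qed
  qed
qed

lemma nn_integral_powr_singular: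
  assumes "0 < \<delta>" "\<delta> < 1" "s \<le> t"
  shows "(\<integral>\<^sup>+r\<in>{s<..<t}. ennreal ((2 / (r - s)) powr \<delta>) \<partial>lborel) \<le> ennreal (2 powr \<delta> / (1 - \<delta>) * (t - s) powr (1 - \<delta>))"
    and "(\<integral>\<^sup>+r\<in>{s<..<t}. ennreal ((2 / (t - r)) powr \<delta>) \<partial>lborel) \<le> ennreal (2 powr \<delta> / (1 - \<delta>) * (t - s) powr (1 - \<delta>))"
proof -
  let ?c = "t - s"
  have "((\<lambda>x. 2 powr \<delta> * x powr (- \<delta>)) has_integral (2 powr \<delta> * (?c powr (- \<delta> + 1) / (- \<delta> + 1)))) {0..?c}"
    by (rule has_integral_mult_right[OF has_integral_powr_from_0]) (use assms in auto)
  from nn_integral_has_integral_lebesgue'[OF _ this]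
  have I: "(\<integral>\<^sup>+x. ennreal (2 powr \<delta> * x powr (- \<delta>)) * indicator {0..?c} x \<partial>lborel) = ennreal (2 powr \<delta> / (1 - \<delta>) * ?c powr (1 - \<delta>))"
    by simp
  have pw: "(2 / x) powr \<delta> = 2 powr \<delta> * x powr (- \<delta>)" if "x > 0" for x
    using that by (simp add: powr_divide powr_minus_divide)
  have "(\<integral>\<^sup>+r\<in>{s<..<t}. ennreal ((2 / (r - s)) powr \<delta>) \<partial>lborel) = (\<integral>\<^sup>+x. ennreal ((2 / x) powr \<delta>) * indicator {0<..<?c} x \<partial>lborel)"
    by (subst nn_integral_real_affine[where c=1 and t=s]) (auto simp: indicator_def intro!: nn_integral_cong)
  also have "\<dots> \<le> (\<integral>\<^sup>+x. ennreal (2 powr \<delta> * x powr (- \<delta>)) * indicator {0..?c} x \<partial>lborel)"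
    by (intro nn_integral_mono) (auto simp: indicator_def pw)
  finally show "(\<integral>\<^sup>+r\<in>{s<..<t}. ennreal ((2 / (r - s)) powr \<delta>) \<partial>lborel) \<le> ennreal (2 powr \<delta> / (1 - \<delta>) * (t - s) powr (1 - \<delta>))"
    unfolding I .
  have "(\<integral>\<^sup>+r\<in>{s<..<t}. ennreal ((2 / (t - r)) powr \<delta>) \<partial>lborel) = (\<integral>\<^sup>+x. ennreal ((2 / x) powr \<delta>) * indicator {0<..<?c} x \<partial>lborel)"
    by (subst nn_integral_real_affine[where c="-1" and t=t]) (auto simp: indicator_def intro!: nn_integral_cong)
  also have "\<dots> \<le> (\<integral>\<^sup>+x. ennreal (2 powr \<delta> * x powr (- \<delta>)) * indicator {0..?c} x \<partial>lborel)"
    by (intro nn_integral_mono) (auto simp: indicator_def pw)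
  finally show "(\<integral>\<^sup>+r\<in>{s<..<t}. ennreal ((2 / (t - r)) powr \<delta>) \<partial>lborel) \<le> ennreal (2 powr \<delta> / (1 - \<delta>) * (t - s) powr (1 - \<delta>))"
    unfolding I .
qed

lemma continuous_density_unique:
  fixes f g :: "real^'n::finite \<Rightarrow> real"
  assumes cont: "continuous_on UNIV f" "continuous_on UNIV g"
    and nn: "\<And>x. 0 \<le> f x" "\<And>x. 0 \<le> g x"
    and eq: "\<And>S. S \<in> sets borel \<Longrightarrow>
      (\<integral>\<^sup>+x\<in>S. ennreal (f x) \<partial>lborel) = (\<integral>\<^sup>+x\<in>S. ennreal (g x) \<partial>lborel)"
  shows "f = g"
proof -
  have [measurable]: "f \<in> borel_measurable borel" "g \<in> borel_measurable borel"
    using cont by (auto intro: borel_measurable_continuous_onI)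
  have "density lborel (\<lambda>x. ennreal (f x)) = density lborel (\<lambda>x. ennreal (g x))"
    by (rule measure_eqI) (auto simp: emeasure_density eq)
  then have "AE x in lborel. ennreal (f x) = ennreal (g x)"
    by (subst (asm) sigma_finite_measure.density_unique_iff[OF sigma_finite_lborel]) auto
  then have "AE x in lborel. x \<in> {x. f x = g x}"
    using nn by (auto elim!: eventually_mono)
  then have "AE x in lebesgue. x \<in> {x. f x = g x}"
    by (rule AE_completion)
  moreover have "closed {x. f x = g x}"
    using cont by (intro closed_Collect_eq)
  ultimately show ?thesis
    using mem_closed_if_AE_lebesgue by blast
qed

section \<open>The local time as a time integral of smooth densities\<close>

context digit_path_blocks
begin

text \<open>\<open>N\<close> derivatives cost \<beta>^N and the factor \<open>scale n\<close> costs
  \<beta>^d with d = CARD('n), so the growth condition is applied with \<delta> / (N + d).\<close>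

lemma dens_derivative_bound:
  assumes "0 < \<delta>"
  obtains C where "C > 0" "\<And>n js x. length js = N \<Longrightarrow> \<bar>iter_partial js (dens n) x\<bar> \<le> C * 2 powr (\<delta> * real n)"
proof -
  let ?d = "CARD('n)"
  obtain C0 where C0: "C0 > 0" "\<And>x js. length js = N \<Longrightarrow> \<bar>iter_partial js bump_prod (x::real^'n)\<bar> \<le> C0"
    using iter_partial_bounded[where N=N and f="bump_prod :: real^'n \<Rightarrow> real", OF smooth_bump_prod compact_cbox bump_prod_eq_0]
    by blast
  have p: "0 < N + ?d" by simp
  then have "0 < \<delta> / real (N + ?d)" by (intro divide_pos_pos assms) (use p in \<open>simp only: of_nat_0_less_iff\<close>)
  from \<beta>_growth[OF this] obtain C1 where C1: "\<And>n. \<beta> n \<le> C1 * 2 powr (\<delta> / real (N + ?d) * real n)" by blast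
  let ?C = "(2 * real ?d) ^ ?d * (real ?d ^ N * C0) * C1 ^ (N + ?d)"
  have "C1 \<ge> 1" using C1[of 0] \<beta>_ge_1[of 0] by simp
  show ?thesis
  proof (rule that[of ?C])
    show "?C > 0" using C0 \<open>C1 \<ge> 1\<close> by simp
    fix n and js :: "'n list" and x :: "real^'n" assume len: "length js = N"
    have B: "\<bar>iter_partial js (\<lambda>x. bump_prod (Bm n *v x + 0)) x\<bar> \<le> (real ?d * \<beta> n) ^ N * C0"
      by (rule iter_partial_affine_bound[OF smooth_bump_prod C0(2) Bm_bound len])
    have "\<bar>iter_partial js (dens n) x\<bar> = scale n * \<bar>iter_partial js (\<lambda>x. bump_prod (Bm n *v x + 0)) x\<bar>"
      unfolding dens_def[abs_def] using smooth_cmult_aux[OF smooth_affine[OF smooth_bump_prod, of "Bm n" 0], of js "scale n"] scale(1)[of n]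
      by (simp add: abs_mult)
    also have "\<dots> \<le> (2 * real ?d * \<beta> n) ^ ?d * ((real ?d * \<beta> n) ^ N * C0)"
      using scale(1)[of n] scale(2)[of n] B \<beta>_ge_1[of n] C0 by (intro mult_mono) auto
    also have "\<dots> = (2 * real ?d) ^ ?d * (real ?d ^ N * C0) * \<beta> n ^ (N + ?d)"
      by (simp add: power_mult_distrib power_add)
    also have "\<dots> \<le> (2 * real ?d) ^ ?d * (real ?d ^ N * C0) * (C1 * 2 powr (\<delta> / real (N + ?d) * real n)) ^ (N + ?d)"
      using C1[of n] \<beta>_ge_1[of n] C0 by (intro mult_left_mono power_mono) auto
    also have "(C1 * 2 powr (\<delta> / real (N + ?d) * real n)) ^ (N + ?d) = C1 ^ (N + ?d) * 2 powr (\<delta> * real n)"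
    proof -
      have cancel: "\<delta> / m * real n * m = \<delta> * real n" if "m \<noteq> 0" for m :: real
        using that by simp
      have "real (N + ?d) \<noteq> 0" using p by (simp only: of_nat_eq_0_iff)
      note cancel = cancel[OF this]
      have "(2 powr (\<delta> / real (N + ?d) * real n)) ^ (N + ?d) = 2 powr (\<delta> / real (N + ?d) * real n * real (N + ?d))"
        by (simp add: powr_powr flip: powr_realpow)
      also note cancel
      finally show ?thesis by (simp add: power_mult_distrib)
    qed
    finally show "\<bar>iter_partial js (dens n) x\<bar> \<le> ?C * 2 powr (\<delta> * real n)" by (simp add: mult.assoc)
  qed
qed

text \<open>The share of time \<open>r\<close> in the occupation density of (s,t), taken from the
  maximal dyadic interval around \<open>r\<close>. Since that interval depends on \<open>s\<close>
  and \<open>t\<close>, cutting (s,t) changes the kernel; additivity in time is recovered only in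
  \<open>lam_additive\<close>.\<close>

definition kern :: "real \<Rightarrow> real \<Rightarrow> real \<Rightarrow> real^'n \<Rightarrow> real" where
  "kern s t r x = dens (lev s t r) (x - rest (lev s t r) r)"

definition lam :: "real \<Rightarrow> real \<Rightarrow> real^'n \<Rightarrow> real" where
  "lam s t x = (\<integral>r. kern s t r x \<partial>restrict_space lborel {s<..<t})"

lemma iter_partial_dens_measurable [measurable]:
  "iter_partial js (dens n) \<in> borel_measurable borel"
  by (intro borel_measurable_continuous_onI continuous_iter_partial smooth_dens)

lemma rest_lev_measurable [measurable]: "(\<lambda>r. rest (lev s t r) r) \<in> borel_measurable borel"
  by (rule measurable_compose_countable[where f="\<lambda>n r. rest n r"]) measurable

lemma kern_measurable [measurable]:
  "(\<lambda>(r, x). kern s t r x) \<in> borel_measurable (borel \<Otimes>\<^sub>M borel)"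
proof -
  have "(\<lambda>p. (\<lambda>n p. dens n (snd p - rest (lev s t (fst p)) (fst p))) (lev s t (fst p)) p) \<in> borel_measurable (borel \<Otimes>\<^sub>M borel)"
    by (rule measurable_compose_countable) measurable
  then show ?thesis by (simp add: kern_def split_beta')
qed

text \<open>Each set \<open>D n k\<close> is empty or a full dyadic interval by
  \<open>lev_dyadic\<close>; these countably many pieces exhaust (s,t), and
  \<open>occupation_dyadic\<close> applies to each.\<close>

lemma occupation_interval:
  assumes S [measurable]: "S \<in> sets borel" and s: "0 \<le> s"
  shows "(\<integral>\<^sup>+r\<in>{s<..<t}. indicator S (digit_path v r) \<partial>lborel)
    = (\<integral>\<^sup>+r\<in>{s<..<t}. (\<integral>\<^sup>+x. indicator S x * ennreal (kern s t r x) \<partial>lborel) \<partial>lborel)"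
proof -
  define D where "D n k = {r \<in> dyadic n k. s < r \<and> r < t \<and> lev s t r = n}" for n k
  have [measurable]: "D n k \<in> sets borel" for n k unfolding D_def by measurable
  \<comment> \<open>Natural numbers suffice for the position of the interval, because s \<ge> 0
    makes all floors nonnegative.\<close>
  define E where "E j = D (fst (prod_decode j)) (int (snd (prod_decode j)))" for j
  have "disjoint_family E"
    unfolding disjoint_family_on_def
  proof (intro ballI impI)
    fix i j :: nat assume "i \<noteq> j"
    then have "prod_decode i \<noteq> prod_decode j" using inj_prod_decode by (meson injD)
    then show "E i \<inter> E j = {}"
      by (auto simp: E_def D_def dyadic_def prod_eq_iff)
  qed
  have Un: "(\<Union>j. E j) = {s<..<t}"
  proof
    show "{s<..<t} \<subseteq> (\<Union>j. E j)"
    proof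
      fix r assume r: "r \<in> {s<..<t}"
      let ?n = "lev s t r" and ?k = "nat \<lfloor>2 ^ lev s t r * r\<rfloor>"
      have "r \<in> E (prod_encode (?n, ?k))"
        using r s by (auto simp: E_def D_def dyadic_def)
      then show "r \<in> (\<Union>j. E j)" by blast
    qed
  qed (auto simp: E_def D_def)
  have D: "(\<integral>\<^sup>+r\<in>D n k. indicator S (digit_path v r) \<partial>lborel)
    = (\<integral>\<^sup>+r\<in>D n k. (\<integral>\<^sup>+x. indicator S x * ennreal (kern s t r x) \<partial>lborel) \<partial>lborel)" for n k
  proof (cases "D n k = {}")
    case False
    then obtain r where r: "r \<in> dyadic n k" "s < r" "r < t" "lev s t r = n" unfolding D_def by blast
    have D: "D n k = dyadic n k"
      using lev_dyadic[OF r(1) _ r(2-4)] by (auto simp: D_def)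
    have "fits s t n r" using fits_lev[of s r t] r by simp
    then have "0 < real_of_int k / 2 ^ n" using r s by (auto simp: fits_def dyadic_def)
    then have k: "1 \<le> k" by (simp add: zero_less_divide_iff)
    have "(\<integral>\<^sup>+r\<in>dyadic n k. (\<integral>\<^sup>+x. indicator S x * ennreal (dens n (x - rest n r)) \<partial>lborel) \<partial>lborel)
      = (\<integral>\<^sup>+r\<in>dyadic n k. (\<integral>\<^sup>+x. indicator S x * ennreal (kern s t r x) \<partial>lborel) \<partial>lborel)"
      using lev_dyadic(3)[OF r(1) _ r(2-4)] by (intro nn_integral_cong) (auto simp: indicator_def kern_def)
    with occupation_dyadic[OF S k, of n] show ?thesis by (simp add: D)
  qed simp
  have meas: "(\<lambda>r. \<integral>\<^sup>+x. indicator S x * ennreal (kern s t r x) \<partial>lborel) \<in> borel_measurable lborel"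
    by measurable
  show ?thesis
    unfolding Un[symmetric]
    by (subst (1 2) nn_integral_disjoint_family) (use meas \<open>disjoint_family E\<close> D in \<open>auto simp: E_def\<close>)
qed

lemma kern_nonneg: "0 \<le> kern s t r x"
  by (simp add: kern_def dens_nonneg)

lemma smooth_kern: "smooth (kern s t r)"
  unfolding kern_def[abs_def] by (rule smooth_translate[OF smooth_dens])

lemma iter_partial_kern: "iter_partial js (kern s t r) x = iter_partial js (dens (lev s t r)) (x - rest (lev s t r) r)"
  unfolding kern_def[abs_def] by (simp add: iter_partial_translate[OF smooth_dens])

lemma iter_partial_kern_measurable [measurable]: "(\<lambda>r. iter_partial js (kern s t r) x) \<in> borel_measurable borel"
  unfolding iter_partial_kern
  by (rule measurable_compose_countable[where f="\<lambda>n r. iter_partial js (dens n) (x - rest (lev s t r) r)"]) measurable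

text \<open>The bound of 2^(\<delta> lev) from \<open>lev_powr_bound\<close>: derivatives blow up
  only towards the two ends of (s,t), and integrably so for \<delta> < 1.\<close>

definition majorant :: "real \<Rightarrow> real \<Rightarrow> real \<Rightarrow> real \<Rightarrow> real" where
  "majorant \<delta> s t r = 1 + (2 / (r - s)) powr \<delta> + (2 / (t - r)) powr \<delta>"

lemma majorant_integral:
  assumes "0 < \<delta>" "\<delta> < 1" "s \<le> t"
  shows "integrable (restrict_space lborel {s<..<t}) (majorant \<delta> s t)"
    and "(\<integral>r. majorant \<delta> s t r \<partial>restrict_space lborel {s<..<t}) \<le> (t - s) + 2 * (2 powr \<delta> / (1 - \<delta>)) * (t - s) powr (1 - \<delta>)"
proof -
  let ?I = "2 powr \<delta> / (1 - \<delta>) * (t - s) powr (1 - \<delta>)"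
  let ?R = "restrict_space lborel {s<..<t}"
  have [measurable]: "majorant \<delta> s t \<in> borel_measurable borel" unfolding majorant_def[abs_def] by measurable
  have nn: "0 \<le> majorant \<delta> s t r" for r by (simp add: majorant_def)
  have "(\<integral>\<^sup>+r. ennreal (majorant \<delta> s t r) \<partial>?R) = (\<integral>\<^sup>+r\<in>{s<..<t}. ennreal (majorant \<delta> s t r) \<partial>lborel)"
    by (subst nn_integral_restrict_space) auto
  also have "\<dots> = (\<integral>\<^sup>+r. indicator {s<..<t} r + ennreal ((2 / (r - s)) powr \<delta>) * indicator {s<..<t} r + ennreal ((2 / (t - r)) powr \<delta>) * indicator {s<..<t} r \<partial>lborel)"
    by (intro nn_integral_cong) (auto simp: majorant_def indicator_def ennreal_plus)
  also have "\<dots> = ennreal (t - s) + (\<integral>\<^sup>+r\<in>{s<..<t}. ennreal ((2 / (r - s)) powr \<delta>) \<partial>lborel) + (\<integral>\<^sup>+r\<in>{s<..<t}. ennreal ((2 / (t - r)) powr \<delta>) \<partial>lborel)"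
    using assms by (simp add: nn_integral_add)
  also have "\<dots> \<le> ennreal (t - s) + ennreal ?I + ennreal ?I"
    by (intro add_mono order_refl nn_integral_powr_singular assms)
  also have "\<dots> = ennreal ((t - s) + 2 * (2 powr \<delta> / (1 - \<delta>)) * (t - s) powr (1 - \<delta>))"
  proof -
    have "0 \<le> ?I" "0 \<le> t - s" using assms by auto
    then have "ennreal (t - s) + ennreal ?I + ennreal ?I = ennreal ((t - s) + ?I + ?I)"
      by (simp only: ennreal_plus add_nonneg_nonneg)
    also have "(t - s) + ?I + ?I = (t - s) + 2 * (2 powr \<delta> / (1 - \<delta>)) * (t - s) powr (1 - \<delta>)" by simp
    finally show ?thesis .
  qed
  finally have le: "(\<integral>\<^sup>+r. ennreal (majorant \<delta> s t r) \<partial>?R) \<le> \<dots>" .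
  show int: "integrable ?R (majorant \<delta> s t)"
    by (rule integrableI_nonneg) (use nn le in \<open>auto simp: measurable_restrict_space1 intro: le_less_trans\<close>)
  show "(\<integral>r. majorant \<delta> s t r \<partial>?R) \<le> (t - s) + 2 * (2 powr \<delta> / (1 - \<delta>)) * (t - s) powr (1 - \<delta>)"
    using le assms nn_integral_eq_integral[OF int] nn
    by (subst ennreal_le_iff[symmetric]) auto
qed

lemma kern_derivative_bound:
  assumes "0 < \<delta>"
  obtains C where "C > 0" "\<And>s t r js x. s < r \<Longrightarrow> r < t \<Longrightarrow> length js = N \<Longrightarrow> \<bar>iter_partial js (kern s t r) x\<bar> \<le> C * majorant \<delta> s t r"
proof -
  obtain C where C: "C > 0" "\<And>n js x. length js = N \<Longrightarrow> \<bar>iter_partial js (dens n) x\<bar> \<le> C * 2 powr (\<delta> * real n)"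
    using dens_derivative_bound[OF assms] by metis
  show ?thesis
  proof (rule that[OF C(1)])
    fix s t r :: real and js :: "'n list" and x :: "real^'n"
    assume "s < r" "r < t" "length js = N"
    then have "\<bar>iter_partial js (kern s t r) x\<bar> \<le> C * 2 powr (\<delta> * real (lev s t r))"
      unfolding iter_partial_kern by (intro C(2))
    also have "\<dots> \<le> C * majorant \<delta> s t r"
      unfolding majorant_def using C(1) lev_powr_bound[OF \<open>s < r\<close> \<open>r < t\<close> assms] by (intro mult_left_mono) auto
    finally show "\<bar>iter_partial js (kern s t r) x\<bar> \<le> C * majorant \<delta> s t r" .
  qed
qed

text \<open>Differentiation under the integral; the exponent 1/2 is one choice in (0,1) that makes
  the majorant integrable.\<close>

lemma lam_smooth:
  assumes "s \<le> t"
  shows "smooth (lam s t)"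
    and "iter_partial js (lam s t) x = (\<integral>r. iter_partial js (kern s t r) x \<partial>restrict_space lborel {s<..<t})"
proof -
  have "\<exists>C. \<forall>s t r js x. s < r \<longrightarrow> r < t \<longrightarrow> length js = N \<longrightarrow> \<bar>iter_partial js (kern s t r) x\<bar> \<le> C * majorant (1/2) s t r" for N
  proof (rule kern_derivative_bound[of "1/2" N])
    fix C assume "\<And>s t r js x. s < r \<Longrightarrow> r < t \<Longrightarrow> length js = N \<Longrightarrow> \<bar>iter_partial js (kern s t r) x\<bar> \<le> C * majorant (1/2) s t r"
    then show ?thesis by blast
  qed simp
  then obtain C where C: "\<And>s t r js x. s < r \<Longrightarrow> r < t \<Longrightarrow> \<bar>iter_partial js (kern s t r) x\<bar> \<le> C (length js) * majorant (1/2) s t r"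
    by metis
  have 1: "integrable (restrict_space lborel {s<..<t}) (\<lambda>r. C N * majorant (1/2) s t r)" for N
    by (rule integrable_mult_right[OF majorant_integral(1)]) (use assms in auto)
  have 2: "(\<lambda>r. iter_partial js (kern s t r) x) \<in> borel_measurable (restrict_space lborel {s<..<t})" for js x
    by (rule measurable_restrict_space1) measurable
  note R = smooth_integral[where \<nu>="restrict_space lborel {s<..<t}" and G="kern s t" and M="\<lambda>N r. C N * majorant (1/2) s t r", OF smooth_kern 2 1]
  show "smooth (lam s t)"
    unfolding lam_def[abs_def] by (rule R(1)) (use C in \<open>auto simp: space_restrict_space\<close>)
  show "iter_partial js (lam s t) x = (\<integral>r. iter_partial js (kern s t r) x \<partial>restrict_space lborel {s<..<t})"
    unfolding lam_def[abs_def] by (subst R(2)) (use C in \<open>auto simp: space_restrict_space\<close>)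
qed

lemma lam_nonneg: "0 \<le> lam s t x"
  unfolding lam_def by (intro Bochner_Integration.integral_nonneg kern_nonneg)

text \<open>The choice \<delta> = 1 - \<gamma> turns the integral of the singular terms into a
  multiple of (t - s)^\<gamma>. As the growth 2^o(n) permits every \<delta> > 0, every \<gamma> < 1
  is reached.\<close>

lemma lam_derivative_bound:
  assumes "0 < \<gamma>" "\<gamma> < 1"
  obtains C where "C > 0" "\<And>s t js x. s \<le> t \<Longrightarrow> length js = N \<Longrightarrow> \<bar>iter_partial js (lam s t) x\<bar> \<le> C * ((t - s) + (t - s) powr \<gamma>)"
proof -
  let ?\<delta> = "1 - \<gamma>"
  have \<delta>: "0 < ?\<delta>" "?\<delta> < 1" using assms by auto
  obtain C where C: "C > 0" "\<And>s t r js x. s < r \<Longrightarrow> r < t \<Longrightarrow> length js = N \<Longrightarrow> \<bar>iter_partial js (kern s t r) x\<bar> \<le> C * majorant ?\<delta> s t r"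
    using kern_derivative_bound[OF \<delta>(1)] by metis
  let ?c = "2 * (2 powr ?\<delta> / \<gamma>)"
  show ?thesis
  proof (rule that[of "C * (1 + ?c)"])
    show "0 < C * (1 + ?c)" using C assms by (intro mult_pos_pos add_pos_nonneg) auto
    fix s t :: real and js :: "'n list" and x assume st: "s \<le> t" and len: "length js = N"
    let ?R = "restrict_space lborel {s<..<t}"
    have int: "integrable ?R (\<lambda>r. C * majorant ?\<delta> s t r)"
      by (rule integrable_mult_right[OF majorant_integral(1)]) (use \<delta> st in auto)
    have "\<bar>iter_partial js (lam s t) x\<bar> = norm (\<integral>r. iter_partial js (kern s t r) x \<partial>?R)"
      by (simp add: lam_smooth(2)[OF st])
    also have "\<dots> \<le> (\<integral>r. C * majorant ?\<delta> s t r \<partial>?R)"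
    proof (rule order.trans[OF Bochner_Integration.integral_norm_bound Bochner_Integration.integral_mono])
      have "integrable ?R (\<lambda>r. iter_partial js (kern s t r) x)"
        by (rule Bochner_Integration.integrable_bound[OF int])
          (auto simp: space_restrict_space measurable_restrict_space1 intro!: AE_I2 order.trans[OF C(2)] len)
      then show "integrable ?R (\<lambda>r. norm (iter_partial js (kern s t r) x))" by (rule integrable_norm)
    qed (use C(2) len int in \<open>auto simp: space_restrict_space\<close>)
    also have "\<dots> = C * (\<integral>r. majorant ?\<delta> s t r \<partial>?R)" by simp
    also have "\<dots> \<le> C * ((t - s) + ?c * (t - s) powr \<gamma>)"
      using majorant_integral(2)[OF \<delta> st] C(1) by (intro mult_left_mono) auto
    also have "\<dots> \<le> C * ((1 + ?c) * ((t - s) + (t - s) powr \<gamma>))"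
    proof (intro mult_left_mono)
      have "0 \<le> ?c * (t - s)" "0 \<le> (t - s) powr \<gamma>" using assms st by auto
      then show "(t - s) + ?c * (t - s) powr \<gamma> \<le> (1 + ?c) * ((t - s) + (t - s) powr \<gamma>)"
        by (simp only: distrib_left distrib_right) simp
    qed (use C in auto)
    finally show "\<bar>iter_partial js (lam s t) x\<bar> \<le> C * (1 + ?c) * ((t - s) + (t - s) powr \<gamma>)" by (simp only: mult.assoc)
  qed
qed

lemma occupation_lam:
  assumes S [measurable]: "S \<in> sets borel" and s: "0 \<le> s" "s \<le> t"
  shows "(\<integral>\<^sup>+r\<in>{s<..<t}. indicator S (digit_path v r) \<partial>lborel) = (\<integral>\<^sup>+x\<in>S. ennreal (lam s t x) \<partial>lborel)"
proof -
  have "(\<integral>\<^sup>+r\<in>{s<..<t}. indicator S (digit_path v r) \<partial>lborel)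
    = (\<integral>\<^sup>+r. (\<integral>\<^sup>+x. indicator S x * ennreal (kern s t r x) * indicator {s<..<t} r \<partial>lborel) \<partial>lborel)"
    unfolding occupation_interval[OF S s(1)] by (simp add: nn_integral_multc)
  also have "\<dots> = (\<integral>\<^sup>+x. (\<integral>\<^sup>+r. indicator S x * ennreal (kern s t r x) * indicator {s<..<t} r \<partial>lborel) \<partial>lborel)"
    by (rule lborel_pair.Fubini') measurable
  also have "\<dots> = (\<integral>\<^sup>+x. indicator S x * (\<integral>\<^sup>+r\<in>{s<..<t}. ennreal (kern s t r x) \<partial>lborel) \<partial>lborel)"
    by (simp add: nn_integral_cmult mult.assoc)
  also have "\<dots> = (\<integral>\<^sup>+x\<in>S. ennreal (lam s t x) \<partial>lborel)"
  proof (rule nn_integral_cong)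
    fix x
    obtain C where C: "\<And>s t r x. s < r \<Longrightarrow> r < t \<Longrightarrow> \<bar>kern s t r x\<bar> \<le> C * majorant (1/2) s t r"
      using kern_derivative_bound[of "1/2" 0] by (metis half_gt_zero_iff iter_partial.simps(1) list.size(3) zero_less_one)
    have int: "integrable (restrict_space lborel {s<..<t}) (\<lambda>r. C * majorant (1/2) s t r)"
      by (rule integrable_mult_right[OF majorant_integral(1)]) (use s in auto)
    have "integrable (restrict_space lborel {s<..<t}) (\<lambda>r. kern s t r x)"
      by (rule Bochner_Integration.integrable_bound[OF int])
        (auto simp: space_restrict_space measurable_restrict_space1 intro!: AE_I2 order.trans[OF C])
    from nn_integral_eq_integral[OF this] have "(\<integral>\<^sup>+r\<in>{s<..<t}. ennreal (kern s t r x) \<partial>lborel) = ennreal (lam s t x)"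
      by (simp add: nn_integral_restrict_space lam_def kern_nonneg)
    then show "indicator S x * (\<integral>\<^sup>+r\<in>{s<..<t}. ennreal (kern s t r x) \<partial>lborel) = ennreal (lam s t x) * indicator S x"
      by (simp add: mult.commute)
  qed
  finally show ?thesis .
qed

end

section \<open>Support, additivity and Hoelder continuity of the local time\<close>

context digit_path_blocks
begin

lemma continuous_lam: "s \<le> t \<Longrightarrow> continuous_on UNIV (lam s t)"
  using continuous_iter_partial[OF lam_smooth(1), of s t "[]"] by simp

lemma lam_measurable [measurable]: "s \<le> t \<Longrightarrow> lam s t \<in> borel_measurable borel"
  by (intro borel_measurable_continuous_onI continuous_lam)

text \<open>The path stays in the ball, so the density vanishes almost everywhere outside it, and by
  continuity everywhere on the open complement. One ball serves all times, which places the whole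
  local time in a single Frechet space.\<close>

lemma lam_support:
  assumes s: "0 \<le> s" "s \<le> t" and x: "x \<notin> cball 0 (\<Sum>j. norm (v j))"
  shows "lam s t x = 0"
proof -
  let ?S = "- cball 0 (\<Sum>j. norm (v j)) :: (real^'n) set"
  have [measurable]: "lam s t \<in> borel_measurable borel" using s by simp
  have "(\<integral>\<^sup>+x\<in>?S. ennreal (lam s t x) \<partial>lborel) = (\<integral>\<^sup>+r\<in>{s<..<t}. indicator ?S (digit_path v r) \<partial>lborel)"
    by (rule occupation_lam[symmetric]) (use s in auto)
  also have "\<dots> = (\<integral>\<^sup>+(r::real). 0 \<partial>lborel)"
    by (intro nn_integral_cong) (auto simp: indicator_def norm_digit_path_le)
  finally have "(\<integral>\<^sup>+x\<in>?S. ennreal (lam s t x) \<partial>lborel) = 0" by simp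
  then have "AE x in lborel. ennreal (lam s t x) * indicator ?S x = 0"
    by (subst (asm) nn_integral_0_iff_AE) auto
  then have "AE x in lborel. x \<in> ?S \<longrightarrow> x \<in> {x. lam s t x = 0}"
  proof eventually_elim
    case (elim x)
    then show ?case using lam_nonneg[of s t x] by (cases "x \<in> ?S") (auto simp: antisym)
  qed
  then have "AE x \<in> ?S in lebesgue. x \<in> {x. lam s t x = 0}"
    by (rule AE_completion)
  moreover have "closed {x. lam s t x = 0}"
    using continuous_lam[OF s(2)] by (intro closed_Collect_eq) auto
  moreover have "open ?S" by (simp add: open_Compl)
  ultimately show ?thesis
    using mem_closed_if_AE_lebesgue_open[of ?S "{x. lam s t x = 0}" x] x by simp
qed

lemma lam_test_function:
  assumes "0 \<le> s" "s \<le> t"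
  shows "lam s t \<in> test_functions_on (cball 0 (\<Sum>j. norm (v j)))"
  by (rule test_functions_onI) (use assms lam_support in \<open>auto intro: lam_smooth\<close>)

text \<open>The kernels of the three intervals differ, as their maximal dyadic intervals do. Both
  sides are nevertheless continuous densities of the same occupation measure, hence equal.\<close>

lemma lam_additive:
  assumes "0 \<le> s" "s \<le> t"
  shows "lam 0 t = (\<lambda>x. lam 0 s x + lam s t x)"
proof (rule continuous_density_unique)
  note [measurable] = lam_measurable[OF assms(1)] lam_measurable[OF assms(2)]
  show "continuous_on UNIV (lam 0 t)" "continuous_on UNIV (\<lambda>x. lam 0 s x + lam s t x)"
    using assms by (auto intro!: continuous_intros continuous_lam)
  show "0 \<le> lam 0 t x" "0 \<le> lam 0 s x + lam s t x" for x
    by (simp_all add: lam_nonneg)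
  fix S :: "(real^'n) set" assume [measurable]: "S \<in> sets borel"
  have "(\<integral>\<^sup>+x\<in>S. ennreal (lam 0 t x) \<partial>lborel) = (\<integral>\<^sup>+r\<in>{0<..<t}. indicator S (digit_path v r) \<partial>lborel)"
    using assms by (intro occupation_lam[symmetric]) auto
  also have "\<dots> = (\<integral>\<^sup>+r. indicator S (digit_path v r) * indicator {0<..<s} r + indicator S (digit_path v r) * indicator {s<..<t} r \<partial>lborel)"
    using AE_lborel_singleton[of s] assms
    by (intro nn_integral_cong_AE) (auto elim!: eventually_mono simp: indicator_def)
  also have "\<dots> = (\<integral>\<^sup>+r\<in>{0<..<s}. indicator S (digit_path v r) \<partial>lborel) + (\<integral>\<^sup>+r\<in>{s<..<t}. indicator S (digit_path v r) \<partial>lborel)"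
    by (intro nn_integral_add) auto
  also have "\<dots> = (\<integral>\<^sup>+x\<in>S. ennreal (lam 0 s x) \<partial>lborel) + (\<integral>\<^sup>+x\<in>S. ennreal (lam s t x) \<partial>lborel)"
    using assms by (simp add: occupation_lam)
  also have "\<dots> = (\<integral>\<^sup>+x. ennreal (lam 0 s x) * indicator S x + ennreal (lam s t x) * indicator S x \<partial>lborel)"
    by (intro nn_integral_add[symmetric]) auto
  also have "\<dots> = (\<integral>\<^sup>+x\<in>S. ennreal (lam 0 s x + lam s t x) \<partial>lborel)"
    by (intro nn_integral_cong) (auto simp: indicator_def lam_nonneg ennreal_plus)
  finally show "(\<integral>\<^sup>+x\<in>S. ennreal (lam 0 t x) \<partial>lborel) = (\<integral>\<^sup>+x\<in>S. ennreal (lam 0 s x + lam s t x) \<partial>lborel)" .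
qed

lemma is_local_time_lam:
  "is_local_time T (digit_path v) (lam 0)"
  unfolding is_local_time_def
proof (intro conjI ballI allI)
  show "digit_path v \<in> borel_measurable (restrict_space borel {0..T})"
    by (rule measurable_restrict_space1) measurable
  fix t assume t: "t \<in> {0..T}"
  then show "lam 0 t \<in> borel_measurable borel" by auto
  show "0 \<le> lam 0 t x" for x by (rule lam_nonneg)
  fix A :: "(real^'n) set" assume [measurable]: "A \<in> sets borel"
  have "occupation_measure (digit_path v) t A = emeasure lborel {r \<in> {0<..<t}. digit_path v r \<in> A}"
    unfolding occupation_measure_def
  proof (rule emeasure_eq_AE)
    show "AE r in lborel. r \<in> {r \<in> {0..t}. digit_path v r \<in> A} \<longleftrightarrow> r \<in> {r \<in> {0<..<t}. digit_path v r \<in> A}"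
      using AE_lborel_singleton[of 0] AE_lborel_singleton[of t] by eventually_elim auto
  qed measurable
  also have "\<dots> = (\<integral>\<^sup>+r. indicator {r \<in> {0<..<t}. digit_path v r \<in> A} r \<partial>lborel)"
    by (rule nn_integral_indicator[symmetric]) measurable
  also have "\<dots> = (\<integral>\<^sup>+r\<in>{0<..<t}. indicator A (digit_path v r) \<partial>lborel)"
    by (intro nn_integral_cong) (auto simp: indicator_def)
  also have "\<dots> = (\<integral>\<^sup>+x\<in>A. ennreal (lam 0 t x) \<partial>lborel)"
    using t by (intro occupation_lam) auto
  finally show "occupation_measure (digit_path v) t A = (\<integral>\<^sup>+x\<in>A. ennreal (lam 0 t x) \<partial>lborel)" .
qed

text \<open>Increments are the functions \<open>lam s t\<close>, all supported in one ball, so a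
  seminorm sees only derivatives up to a fixed order. \<open>lam_derivative_bound\<close> controls
  these, and t - s \<le> T^(1-\<gamma>) (t - s)^\<gamma> absorbs the linear term.\<close>

lemma lam_holder:
  assumes \<gamma>: "0 < \<gamma>" "\<gamma> < 1" and "0 < T"
  shows "lam 0 \<in> holder_test \<gamma> T"
proof -
  let ?K = "cball 0 (\<Sum>j. norm (v j)) :: (real^'n) set"
  have test: "lam 0 t \<in> test_functions" if "t \<in> {0..T}" for t
    using lam_test_function[of 0 t] that test_functions_subset by auto
  have "\<exists>C. \<forall>s\<in>{0..T}. \<forall>t\<in>{0..T}. q (\<lambda>x. lam 0 t x - lam 0 s x) \<le> C * \<bar>t - s\<bar> powr \<gamma>"
    if q: "continuous_test_seminorm q" for q
  proof -
    have hom: "q (\<lambda>x. c * f x) = \<bar>c\<bar> * q f" if "f \<in> test_functions" for f c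
      using q that by (auto simp: continuous_test_seminorm_def)
    obtain N C where C: "C \<ge> 0" "\<And>f B. f \<in> test_functions_on ?K \<Longrightarrow> B > 0 \<Longrightarrow>
        (\<And>js x. length js \<le> N \<Longrightarrow> \<bar>iter_partial js f x\<bar> \<le> B) \<Longrightarrow> q f \<le> C * B"
      using continuous_test_seminorm_bound[OF q compact_cball] by metis
    have "\<exists>c>0. \<forall>s t js x. s \<le> t \<longrightarrow> length js = n \<longrightarrow> \<bar>iter_partial js (lam s t) x\<bar> \<le> c * ((t - s) + (t - s) powr \<gamma>)" for n
    proof (rule lam_derivative_bound[OF \<gamma>, of n])
      fix c assume "c > 0" "\<And>s t js x. s \<le> t \<Longrightarrow> length js = n \<Longrightarrow> \<bar>iter_partial js (lam s t) x\<bar> \<le> c * ((t - s) + (t - s) powr \<gamma>)"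
      then show ?thesis by blast
    qed
    then obtain c where c: "\<And>n. c n > 0"
        "\<And>s t js x. s \<le> t \<Longrightarrow> \<bar>iter_partial js (lam s t) x\<bar> \<le> c (length js) * ((t - s) + (t - s) powr \<gamma>)"
      by metis
    define c' where "c' = (\<Sum>n\<le>N. c n)"
    have c': "c n \<le> c'" if "n \<le> N" for n
      unfolding c'_def using that c(1) by (intro member_le_sum) (auto intro: less_imp_le)
    have "c' > 0" using c(1)[of 0] c'[of 0] by simp
    define D where "D = C * (c' * (T powr (1 - \<gamma>) + 1))"
    have main: "q (\<lambda>x. lam 0 t x - lam 0 s x) \<le> D * (t - s) powr \<gamma>" if st: "0 \<le> s" "s < t" "t \<le> T" for s t
    proof -
      let ?B = "c' * ((T powr (1 - \<gamma>) + 1) * (t - s) powr \<gamma>)"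
      have "t - s = (t - s) powr (1 - \<gamma>) * (t - s) powr \<gamma>"
        using st by (simp flip: powr_add)
      also have "\<dots> \<le> T powr (1 - \<gamma>) * (t - s) powr \<gamma>"
        using st \<gamma> by (intro mult_right_mono powr_mono2) auto
      finally have le: "(t - s) + (t - s) powr \<gamma> \<le> (T powr (1 - \<gamma>) + 1) * (t - s) powr \<gamma>"
        by (simp add: distrib_right)
      have "q (lam s t) \<le> C * ?B"
      proof (rule C(2))
        show "lam s t \<in> test_functions_on ?K" using st by (intro lam_test_function) auto
        show "0 < ?B" using st \<open>c' > 0\<close> by (intro mult_pos_pos add_nonneg_pos) auto
        fix js :: "'n list" and x assume "length js \<le> N"
        have "\<bar>iter_partial js (lam s t) x\<bar> \<le> c (length js) * ((t - s) + (t - s) powr \<gamma>)"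
          using st by (intro c(2)) auto
        also have "\<dots> \<le> ?B"
          using c'[OF \<open>length js \<le> N\<close>] le st \<open>c' > 0\<close> c(1)[of "length js"] by (intro mult_mono) auto
        finally show "\<bar>iter_partial js (lam s t) x\<bar> \<le> ?B" .
      qed
      moreover have "(\<lambda>x. lam 0 t x - lam 0 s x) = lam s t"
        using lam_additive[of s t] st by (simp add: fun_eq_iff)
      ultimately show ?thesis by (simp add: D_def mult.assoc)
    qed
    show ?thesis
    proof (intro exI ballI)
      fix s t assume s: "s \<in> {0..T}" and t: "t \<in> {0..T}"
      consider "s < t" | "t < s" | "s = t" by linarith
      then show "q (\<lambda>x. lam 0 t x - lam 0 s x) \<le> D * \<bar>t - s\<bar> powr \<gamma>"
      proof cases
        case 1
        then show ?thesis using main[of s t] s t by simp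
      next
        case 2
        have "(\<lambda>x. lam 0 s x - lam 0 t x) \<in> test_functions"
          using test_functions_lincomb[OF test[OF s] test[OF t], of 1 "-1"] by simp
        from hom[OF this, of "-1"] have "q (\<lambda>x. lam 0 t x - lam 0 s x) = q (\<lambda>x. lam 0 s x - lam 0 t x)"
          by simp
        with 2 show ?thesis using main[of t s] s t by simp
      next
        case 3
        with hom[OF test[OF s], of 0] show ?thesis using \<gamma> by simp
      qed
    qed
  qed
  with test show ?thesis by (simp add: holder_test_def)
qed

lemma digit_path_local_time:
  assumes "0 < T"
  shows "\<exists>L. is_local_time T (digit_path v) L \<and> (\<forall>t\<in>{0..T}. L t \<in> test_functions) \<and>
    (\<forall>\<gamma>\<in>{0<..<1}. L \<in> holder_test \<gamma> T)"
proof (intro exI conjI ballI)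
  show "is_local_time T (digit_path v) (lam 0)" by (rule is_local_time_lam)
  show "lam 0 t \<in> test_functions" if "t \<in> {0..T}" for t
    using lam_test_function[of 0 t] that test_functions_subset by auto
  show "lam 0 \<in> holder_test \<gamma> T" if "\<gamma> \<in> {0<..<1}" for \<gamma>
    using lam_holder[of \<gamma> T] that assms by auto
qed

end

section \<open>Superposition of Poisson processes\<close>

text \<open>For variables with countably many values, factorisation of the joint point masses gives
  independence, and the normalisation of \<open>g i\<close> identifies the factors as the
  marginals.\<close>

lemma (in prob_space) indep_vars_natI:
  fixes Z :: "'i \<Rightarrow> 'a \<Rightarrow> nat"
  assumes I: "finite I" and Z: "\<And>i. i \<in> I \<Longrightarrow> Z i \<in> measurable M (count_space UNIV)"
    and g: "\<And>i. i \<in> I \<Longrightarrow> g i sums (1::real)"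
    and joint: "\<And>z. prob {\<omega>\<in>space M. \<forall>i\<in>I. Z i \<omega> = z i} = (\<Prod>i\<in>I. g i (z i))"
  shows "indep_vars (\<lambda>_. count_space UNIV) Z I"
    and "\<And>i k. i \<in> I \<Longrightarrow> prob {\<omega>\<in>space M. Z i \<omega> = k} = g i k"
proof -
  have ev: "{\<omega>\<in>space M. \<forall>i\<in>D. Z i \<omega> \<in> B i} \<in> events" if "D \<subseteq> I" for D and B :: "'i \<Rightarrow> nat set"
  proof -
    have "finite D" using that I finite_subset by blast
    moreover have "{\<omega>\<in>space M. Z i \<omega> \<in> B i} \<in> events" if "i \<in> D" for i
      using measurable_sets[OF Z, of i "B i"] that \<open>D \<subseteq> I\<close> by (auto simp: vimage_def Int_def conj_commute)
    ultimately show ?thesis by (intro sets.sets_Collect_finite_All) auto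
  qed
  define G where "G i B = (\<Sum>k. g i k * indicator B k)" for i and B :: "nat set"
  \<comment> \<open>Interpolates between points and sets: coordinates in \<open>D\<close> are
    constrained to sets, the others to single values. Each induction step sums over the values of
    one more coordinate.\<close>
  have part: "prob {\<omega>\<in>space M. \<forall>i\<in>I. Z i \<omega> \<in> (if i \<in> D then B i else {z i})}
      = (\<Prod>i\<in>I. if i \<in> D then G i (B i) else g i (z i))" if "finite D" "D \<subseteq> I" for D B z
    using that
  proof (induction D arbitrary: z rule: finite_induct)
    case empty
    then show ?case using joint by simp
  next
    case (insert j D)
    let ?E = "\<lambda>k. {\<omega>\<in>space M. \<forall>i\<in>I. Z i \<omega> \<in> (if i \<in> D then B i else {(z(j := k)) i})}"
    let ?E' = "\<lambda>k. if k \<in> B j then ?E k else {}"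
    have "(\<lambda>k. prob (?E' k)) sums prob (\<Union>k. ?E' k)"
    proof (rule finite_measure_UNION)
      have "?E k \<in> events" for k by (rule ev[OF subset_refl])
      then have "?E' k \<in> events" for k by (cases "k \<in> B j") (simp_all only: if_True if_False sets.empty_sets)
      then show "range ?E' \<subseteq> events" by blast
      show "disjoint_family ?E'"
        using insert by (force simp: disjoint_family_on_def split: if_splits)
    qed
    also have "(\<Union>k. ?E' k) = {\<omega>\<in>space M. \<forall>i\<in>I. Z i \<omega> \<in> (if i \<in> insert j D then B i else {z i})}"
    proof -
      have "\<omega> \<in> (\<Union>k. ?E' k) \<longleftrightarrow> \<omega> \<in> ?E' (Z j \<omega>)" for \<omega>
        using insert by (force split: if_splits)
      then show ?thesis using insert by (auto split: if_splits)
    qed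
    also have "(\<lambda>k. prob (?E' k)) = (\<lambda>k. (\<Prod>i\<in>I-{j}. if i \<in> D then G i (B i) else g i (z i)) * (g j k * indicator (B j) k))"
    proof
      fix k
      have "prob (?E k) = (\<Prod>i\<in>I. if i \<in> D then G i (B i) else g i ((z(j:=k)) i))"
        using insert by (intro insert.IH) auto
      also have "\<dots> = g j k * (\<Prod>i\<in>I-{j}. if i \<in> D then G i (B i) else g i (z i))"
      proof -
        have "(\<Prod>i\<in>I-{j}. if i \<in> D then G i (B i) else g i ((z(j:=k)) i))
            = (\<Prod>i\<in>I-{j}. if i \<in> D then G i (B i) else g i (z i))"
          by (rule prod.cong) auto
        then show ?thesis using insert I by (subst prod.remove[of I j]) auto
      qed
      finally show "prob (?E' k) = (\<Prod>i\<in>I-{j}. if i \<in> D then G i (B i) else g i (z i)) * (g j k * indicator (B j) k)"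
        by (auto simp: indicator_def)
    qed
    finally have "prob {\<omega>\<in>space M. \<forall>i\<in>I. Z i \<omega> \<in> (if i \<in> insert j D then B i else {z i})}
      = (\<Sum>k. (\<Prod>i\<in>I-{j}. if i \<in> D then G i (B i) else g i (z i)) * (g j k * indicator (B j) k))"
      by (rule sums_unique)
    also have "\<dots> = (\<Prod>i\<in>I-{j}. if i \<in> D then G i (B i) else g i (z i)) * G j (B j)"
    \<comment> \<open>Summability of the new factor comes from cancelling a nonzero constant; if the
      constant is 0, both sides vanish.\<close>
    proof (cases "(\<Prod>i\<in>I-{j}. if i \<in> D then G i (B i) else g i (z i)) = 0")
      case False
      have "summable (\<lambda>k. g j k * indicator (B j) k)"
        using \<open>(\<lambda>k. prob (?E' k)) sums _\<close>[THEN sums_summable] False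
        unfolding \<open>(\<lambda>k. prob (?E' k)) = _\<close> by (simp add: summable_cmult_iff)
      then show ?thesis unfolding G_def by (rule suminf_mult)
    qed simp
    also have "\<dots> = (\<Prod>i\<in>I. if i \<in> insert j D then G i (B i) else g i (z i))"
    proof -
      have "(\<Prod>i\<in>I-{j}. if i \<in> insert j D then G i (B i) else g i (z i))
          = (\<Prod>i\<in>I-{j}. if i \<in> D then G i (B i) else g i (z i))"
        by (rule prod.cong) auto
      moreover have "(\<Prod>i\<in>I. if i \<in> insert j D then G i (B i) else g i (z i))
          = G j (B j) * (\<Prod>i\<in>I-{j}. if i \<in> insert j D then G i (B i) else g i (z i))"
        using insert I by (subst prod.remove[of I j]) auto
      ultimately show ?thesis by (simp only: mult.commute)
    qed
    finally show ?case .
  qed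
  have full: "prob {\<omega>\<in>space M. \<forall>i\<in>I. Z i \<omega> \<in> B i} = (\<Prod>i\<in>I. G i (B i))" for B
    using part[of I B] I by simp
  have G1: "G i UNIV = 1" if "i \<in> I" for i
    using sums_unique[OF g[OF that]] by (simp add: G_def)
  have sub: "prob {\<omega>\<in>space M. \<forall>i\<in>J. Z i \<omega> \<in> B i} = (\<Prod>i\<in>J. G i (B i))" if "J \<subseteq> I" for J B
  proof -
    have "{\<omega>\<in>space M. \<forall>i\<in>J. Z i \<omega> \<in> B i} = {\<omega>\<in>space M. \<forall>i\<in>I. Z i \<omega> \<in> (if i \<in> J then B i else UNIV)}"
      using that by auto
    also have "prob \<dots> = (\<Prod>i\<in>I. G i (if i \<in> J then B i else UNIV))" by (rule full)
    also have "\<dots> = (\<Prod>i\<in>J. G i (B i))"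
      using that I G1 by (intro prod.mono_neutral_cong_right) auto
    finally show ?thesis .
  qed
  have single: "prob {\<omega>\<in>space M. Z i \<omega> \<in> B} = G i B" if "i \<in> I" for i B
    using sub[of "{i}" "\<lambda>_. B"] that by simp
  show "prob {\<omega>\<in>space M. Z i \<omega> = k} = g i k" if "i \<in> I" for i k
  proof -
    have "(\<lambda>l. g i l * indicator {k} l) = (\<lambda>l. if l \<in> {k} then g i l else 0)"
      by (auto simp: indicator_def)
    then have "(\<lambda>l. g i l * indicator {k} l) sums g i k"
      using sums_If_finite_set[of "{k}" "g i"] by simp
    then have "G i {k} = g i k" unfolding G_def by (rule sums_unique[symmetric])
    then show ?thesis using single[OF that, of "{k}"] by simp
  qed
  show "indep_vars (\<lambda>_. count_space UNIV) Z I"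
    unfolding indep_vars_def2
  proof (intro conjI ballI indep_setsI)
    show "Z i \<in> measurable M (count_space UNIV)" if "i \<in> I" for i by (rule Z[OF that])
    show "{Z i -` A \<inter> space M |A. A \<in> sets (count_space UNIV)} \<subseteq> events" if "i \<in> I" for i
      using measurable_sets[OF Z[OF that]] by auto
    fix A :: "'i \<Rightarrow> 'a set" and J assume J: "J \<noteq> {}" "J \<subseteq> I" "finite J"
      and A: "\<forall>j\<in>J. A j \<in> {Z j -` A \<inter> space M |A. A \<in> sets (count_space UNIV)}"
    from A have "\<forall>j\<in>J. \<exists>B. A j = {\<omega>\<in>space M. Z j \<omega> \<in> B}" by (auto simp: vimage_def Int_def conj_commute)
    then obtain B where B: "\<And>j. j \<in> J \<Longrightarrow> A j = {\<omega>\<in>space M. Z j \<omega> \<in> B j}" by metis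
    have "(\<Inter>j\<in>J. A j) = {\<omega>\<in>space M. \<forall>j\<in>J. Z j \<omega> \<in> B j}" using B J by auto
    moreover have "(\<Prod>j\<in>J. prob (A j)) = (\<Prod>j\<in>J. G j (B j))"
      using B J single by (intro prod.cong) auto
    ultimately show "prob (\<Inter>j\<in>J. A j) = (\<Prod>j\<in>J. prob (A j))" using sub[OF J(2)] by simp
  qed
qed

section \<open>Poisson patterns on finitely many cells\<close>

definition poisson_mass :: "real \<Rightarrow> nat \<Rightarrow> real" where
  "poisson_mass \<mu> k = \<mu> ^ k / fact k * exp (- \<mu>)"

lemma poisson_mass_sums: "poisson_mass \<mu> sums 1"
proof -
  have "(\<lambda>k. \<mu> ^ k / fact k) sums exp \<mu>"
    using exp_converges[of \<mu>] by (simp add: scaleR_conv_of_real field_simps)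
  from sums_mult2[OF this, of "exp (- \<mu>)"] show ?thesis
    by (simp add: poisson_mass_def[abs_def] exp_minus)
qed

text \<open>The expected total jump length per unit of time is finite, although the total jump
  intensity may be infinite; this makes the superposition a pathwise absolutely convergent series
  almost surely.\<close>

locale jump_process =
  fixes T :: real and rate :: "nat \<Rightarrow> real" and w :: "nat \<Rightarrow> 'b::euclidean_space"
  assumes T_pos: "0 < T" and rate_pos: "0 < rate m"
    and summable_rate: "summable (\<lambda>m. rate m * norm (w m))"
begin

text \<open>Coordinate \<open>prod_encode (m, 0)\<close> is the number of jumps of the \<open>m\<close>-th Poisson process on \<open>{0..T}\<close>,
  coordinate \<open>prod_encode (m, Suc i)\<close> the time of its \<open>i\<close>-th candidate jump (unordered).\<close>

definition comp :: "nat \<Rightarrow> real measure" where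
  "comp c = (if snd (prod_decode c) = 0
     then distr (measure_pmf (poisson_pmf (rate (fst (prod_decode c)) * T))) borel real
     else uniform_measure lborel {0..T})"

lemma sets_comp [simp, measurable_cong]: "sets (comp c) = sets borel"
  by (simp add: comp_def)

lemma space_comp [simp]: "space (comp c) = UNIV"
  by (simp add: comp_def)

lemma prob_space_comp: "prob_space (comp c)"
proof (cases "snd (prod_decode c) = 0")
  case True
  have "real \<in> measurable (measure_pmf p) borel" for p by simp
  then show ?thesis unfolding comp_def using True by (simp add: measure_pmf.prob_space_distr)
next
  case False
  have "prob_space (uniform_measure lborel {0..T})"
    by (rule prob_space_uniform_measure) (use T_pos in auto)
  with False show ?thesis by (simp add: comp_def)
qed

definition P :: "(nat \<Rightarrow> real) measure" where
  "P = PiM UNIV comp"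

sublocale P: prob_space P
  unfolding P_def by (rule prob_space_PiM) (rule prob_space_comp)

lemma space_P [simp]: "space P = UNIV"
  by (simp add: P_def space_PiM)

lemma coordinate_measurable [measurable]: "(\<lambda>\<omega>. \<omega> c) \<in> borel_measurable P"
proof -
  have "(\<lambda>\<omega>. \<omega> c) \<in> measurable (PiM UNIV comp) (comp c)" by measurable
  then show ?thesis by (simp add: P_def cong: measurable_cong_sets)
qed

lemma distr_coordinate: "distr P borel (\<lambda>\<omega>. \<omega> c) = comp c"
proof -
  have "distr P (comp c) (\<lambda>\<omega>. \<omega> c) = comp c"
    unfolding P_def by (rule distr_PiM_component) (auto intro: prob_space_comp)
  then show ?thesis by (metis distr_cong sets_comp)
qed

lemma coordinates_indep: "P.indep_vars (\<lambda>_. borel) (\<lambda>c \<omega>. \<omega> c) UNIV"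
proof -
  have "distr P (PiM UNIV (\<lambda>_. borel)) (\<lambda>\<omega>. restrict (\<lambda>c. \<omega> c) UNIV) = distr P P (\<lambda>\<omega>. \<omega>)"
    by (intro distr_cong) (auto simp: P_def restrict_UNIV intro!: sets_PiM_cong)
  also have "\<dots> = PiM UNIV (\<lambda>c. distr P borel (\<lambda>\<omega>. \<omega> c))"
    by (simp add: distr_coordinate) (simp add: P_def)
  finally show ?thesis
    by (subst P.indep_vars_iff_distr_eq_PiM) auto
qed

definition cnt :: "nat \<Rightarrow> (nat \<Rightarrow> real) \<Rightarrow> nat" where
  "cnt m \<omega> = nat \<lfloor>\<omega> (prod_encode (m, 0))\<rfloor>"

definition pt :: "nat \<Rightarrow> nat \<Rightarrow> (nat \<Rightarrow> real) \<Rightarrow> real" where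
  "pt m i \<omega> = \<omega> (prod_encode (m, Suc i))"

lemma cnt_measurable [measurable]: "cnt m \<in> measurable P (count_space UNIV)"
  unfolding cnt_def[abs_def] by measurable

lemma pt_measurable [measurable]: "pt m i \<in> borel_measurable P"
  unfolding pt_def[abs_def] by measurable

lemma rate_T_pos: "0 < rate m * T"
  using rate_pos T_pos by simp

lemma prob_cnt: "P.prob {\<omega>. cnt m \<omega> = k} = poisson_mass (rate m * T) k"
proof -
  have "P.prob {\<omega>. cnt m \<omega> = k} = measure (distr P borel (\<lambda>\<omega>. \<omega> (prod_encode (m, 0)))) {x. nat \<lfloor>x\<rfloor> = k}"
    by (subst measure_distr) (auto simp: cnt_def vimage_def)
  also have "\<dots> = measure (measure_pmf (poisson_pmf (rate m * T))) (real -` {x. nat \<lfloor>x\<rfloor> = k})"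
    unfolding distr_coordinate comp_def by (simp, subst measure_distr) auto
  also have "real -` {x. nat \<lfloor>x\<rfloor> = k} = {k}" by auto
  finally show ?thesis
    using rate_T_pos by (simp add: measure_pmf_single poisson_mass_def)
qed

abbreviation unif :: "real measure" where
  "unif \<equiv> uniform_measure lborel {0..T}"

lemma distr_pt: "distr P borel (pt m i) = unif"
  unfolding pt_def[abs_def] distr_coordinate by (simp add: comp_def)

lemma prob_pt: "B \<in> sets borel \<Longrightarrow> P.prob {\<omega>. pt m i \<omega> \<in> B} = measure unif B"
  unfolding distr_pt[symmetric, of m i] by (subst measure_distr) (auto simp: vimage_def)

lemma prob_points:
  assumes "\<And>i. i < k \<Longrightarrow> B i \<in> sets borel"
  shows "P.prob {\<omega>. cnt m \<omega> = k \<and> (\<forall>i<k. pt m i \<omega> \<in> B i)} = poisson_mass (rate m * T) k * (\<Prod>i<k. measure unif (B i))"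
proof -
  define A where "A c = (case snd (prod_decode c) of 0 \<Rightarrow> {x. nat \<lfloor>x\<rfloor> = k} | Suc i \<Rightarrow> B i)" for c
  let ?I = "(\<lambda>i. prod_encode (m, i)) ` {..k}"
  have inj: "inj_on (\<lambda>i. prod_encode (m, i)) S" for S by (auto simp: inj_on_def)
  have meas: "A c \<in> sets borel" if "c \<in> ?I" for c
    using that assms by (auto simp: A_def split: nat.splits)
  have "{\<omega>. cnt m \<omega> = k \<and> (\<forall>i<k. pt m i \<omega> \<in> B i)} = (\<Inter>c\<in>?I. (\<lambda>\<omega>. \<omega> c) -` A c \<inter> space P)"
  proof -
    have split: "(\<forall>i\<le>k. Q i) \<longleftrightarrow> Q 0 \<and> (\<forall>i<k. Q (Suc i))" for Q
      using All_less_Suc2[of k Q] by (simp add: less_Suc_eq_le)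
    have "\<omega> \<in> (\<Inter>c\<in>?I. (\<lambda>\<omega>. \<omega> c) -` A c \<inter> space P) \<longleftrightarrow>
        (\<forall>i\<le>k. \<omega> (prod_encode (m, i)) \<in> A (prod_encode (m, i)))" for \<omega>
      by auto
    then show ?thesis unfolding split by (auto simp: A_def cnt_def pt_def)
  qed
  also have "P.prob \<dots> = (\<Prod>c\<in>?I. P.prob ((\<lambda>\<omega>. \<omega> c) -` A c \<inter> space P))"
    by (rule P.indep_varsD_finite[OF P.indep_vars_subset[OF coordinates_indep]]) (use meas in auto)
  also have "\<dots> = (\<Prod>i\<le>k. P.prob {\<omega>. \<omega> (prod_encode (m, i)) \<in> A (prod_encode (m, i))})"
    by (subst prod.reindex[OF inj]) (auto simp: vimage_def)
  also have "\<dots> = P.prob {\<omega>. \<omega> (prod_encode (m, 0)) \<in> A (prod_encode (m, 0))} *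
      (\<Prod>i<k. P.prob {\<omega>. \<omega> (prod_encode (m, Suc i)) \<in> A (prod_encode (m, Suc i))})"
    by (simp add: prod.atMost_shift)
  also have "P.prob {\<omega>. \<omega> (prod_encode (m, 0)) \<in> A (prod_encode (m, 0))} = poisson_mass (rate m * T) k"
    using prob_cnt[of m k] by (simp add: A_def cnt_def)
  also have "(\<Prod>i<k. P.prob {\<omega>. \<omega> (prod_encode (m, Suc i)) \<in> A (prod_encode (m, Suc i))}) = (\<Prod>i<k. measure unif (B i))"
    using prob_pt[of _ m] assms by (intro prod.cong) (auto simp: A_def pt_def)
  finally show ?thesis .
qed

text \<open>A finite set \<open>R\<close> of times cuts the time axis into cells, encoded by the set of those elements of
  \<open>R\<close> that a point \<open>x\<close> does not exceed; a jump at time 0, a null event, is treated as if it never happened.\<close>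

definition sig :: "real set \<Rightarrow> real \<Rightarrow> real set" where
  "sig R x = {r \<in> R. 0 < x \<and> x \<le> r}"

text \<open>A multiset, since only the number of jumps in each cell matters and not the order of the
  candidates.\<close>

definition Ms :: "real set \<Rightarrow> nat \<Rightarrow> (nat \<Rightarrow> real) \<Rightarrow> real set multiset" where
  "Ms R m \<omega> = mset (map (\<lambda>i. sig R (pt m i \<omega>)) [0..<cnt m \<omega>])"

definition cell :: "real set \<Rightarrow> real set \<Rightarrow> real set" where
  "cell R \<sigma> = {x. sig R x = \<sigma>}"

lemma cell_measurable [measurable]:
  assumes "finite R"
  shows "cell R \<sigma> \<in> sets borel"
proof (cases "\<sigma> \<subseteq> R")
  case True
  then have "cell R \<sigma> = {x. \<forall>r\<in>R. (0 < x \<and> x \<le> r) \<longleftrightarrow> r \<in> \<sigma>}"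
    by (auto simp: cell_def sig_def)
  also have "\<dots> \<in> sets borel"
    using assms by measurable
  finally show ?thesis .
next
  case False
  then have "cell R \<sigma> = {}" by (auto simp: cell_def sig_def)
  then show ?thesis by simp
qed

lemma set_Ms: "set_mset (Ms R m \<omega>) \<subseteq> Pow R"
  by (auto simp: Ms_def sig_def)

text \<open>Splits the event along the orderings of the multiset; each ordering gives a product
  event for the independent coordinates.\<close>

lemma Ms_eq_iff:
  "Ms R m \<omega> = A \<longleftrightarrow> (\<exists>xs\<in>permutations_of_multiset A. cnt m \<omega> = size A \<and> (\<forall>i<size A. pt m i \<omega> \<in> cell R (xs ! i)))"
proof
  assume A: "Ms R m \<omega> = A"
  let ?xs = "map (\<lambda>i. sig R (pt m i \<omega>)) [0..<cnt m \<omega>]"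
  have "size A = cnt m \<omega>" unfolding A[symmetric] Ms_def by simp
  moreover have "?xs \<in> permutations_of_multiset A"
    using A by (simp add: Ms_def permutations_of_multiset_def)
  ultimately show "\<exists>xs\<in>permutations_of_multiset A. cnt m \<omega> = size A \<and> (\<forall>i<size A. pt m i \<omega> \<in> cell R (xs ! i))"
    by (intro bexI[of _ ?xs]) (auto simp: cell_def)
next
  assume "\<exists>xs\<in>permutations_of_multiset A. cnt m \<omega> = size A \<and> (\<forall>i<size A. pt m i \<omega> \<in> cell R (xs ! i))"
  then obtain xs where xs: "mset xs = A" "cnt m \<omega> = size A" "\<forall>i<size A. sig R (pt m i \<omega>) = xs ! i"
    by (auto simp: permutations_of_multiset_def cell_def)
  have "map (\<lambda>i. sig R (pt m i \<omega>)) [0..<cnt m \<omega>] = xs"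
    using xs by (auto intro!: nth_equalityI)
  then show "Ms R m \<omega> = A" using xs(1) by (simp add: Ms_def)
qed

text \<open>Thinning of a Poisson number of points: all orderings have the same probability, their
  number is the multinomial coefficient, and its leading factorial cancels that of the Poisson mass,
  leaving one Poisson mass per cell.\<close>

lemma prob_Ms:
  assumes R: "finite R" and A: "set_mset A \<subseteq> Pow R"
  shows "P.prob {\<omega>. Ms R m \<omega> = A} = (\<Prod>\<sigma>\<in>Pow R. poisson_mass (rate m * T * measure unif (cell R \<sigma>)) (count A \<sigma>))"
proof -
  let ?\<mu> = "rate m * T" and ?q = "\<lambda>\<sigma>. measure unif (cell R \<sigma>)" and ?n = "size A"
  note [measurable] = cell_measurable[OF R]
  let ?E = "\<lambda>xs. {\<omega>. cnt m \<omega> = ?n \<and> (\<forall>i<?n. pt m i \<omega> \<in> cell R (xs ! i))}"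
  have finP: "finite (Pow R)" using R by simp
  have "{\<omega>. Ms R m \<omega> = A} = (\<Union>xs\<in>permutations_of_multiset A. ?E xs)"
    using Ms_eq_iff by auto
  also have "P.prob \<dots> = (\<Sum>xs\<in>permutations_of_multiset A. P.prob (?E xs))"
  proof (rule P.finite_measure_finite_Union)
    show "?E ` permutations_of_multiset A \<subseteq> P.events"
    proof
      fix X assume "X \<in> ?E ` permutations_of_multiset A"
      then obtain xs where X: "X = {\<omega>\<in>space P. cnt m \<omega> = ?n \<and> (\<forall>i<?n. pt m i \<omega> \<in> cell R (xs ! i))}" by auto
      show "X \<in> P.events" unfolding X by measurable
    qed
    show "disjoint_family_on ?E (permutations_of_multiset A)"
      unfolding disjoint_family_on_def
    proof (intro ballI impI)
      fix xs ys assume xs: "xs \<in> permutations_of_multiset A" "ys \<in> permutations_of_multiset A" "xs \<noteq> ys"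
      then have "length xs = ?n" "length ys = ?n"
        by (auto simp: permutations_of_multiset_def simp flip: size_mset)
      with \<open>xs \<noteq> ys\<close> obtain i where "i < ?n" "xs ! i \<noteq> ys ! i" by (metis nth_equalityI)
      then show "?E xs \<inter> ?E ys = {}" by (auto simp: cell_def)
    qed
  qed simp
  also have "\<dots> = (\<Sum>xs\<in>permutations_of_multiset A. poisson_mass ?\<mu> ?n * (\<Prod>\<sigma>\<in>Pow R. ?q \<sigma> ^ count A \<sigma>))"
  proof (rule sum.cong[OF refl])
    fix xs assume "xs \<in> permutations_of_multiset A"
    then have xs: "mset xs = A" by (simp add: permutations_of_multiset_def)
    then have len: "length xs = ?n" by auto
    have "(\<Prod>i<?n. ?q (xs ! i)) = prod_list (map ?q xs)"
      by (simp add: prod.list_conv_set_nth len atLeast0LessThan)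
    also have "\<dots> = prod_mset (image_mset ?q A)"
      by (simp add: prod_mset_prod_list flip: xs mset_map)
    also have "\<dots> = (\<Prod>\<sigma>\<in>set_mset A. ?q \<sigma> ^ count A \<sigma>)"
      by (rule image_prod_mset_multiplicity)
    also have "\<dots> = (\<Prod>\<sigma>\<in>Pow R. ?q \<sigma> ^ count A \<sigma>)"
      by (rule prod.mono_neutral_left[OF finP A]) (auto simp: not_in_iff)
    finally show "P.prob (?E xs) = poisson_mass ?\<mu> ?n * (\<Prod>\<sigma>\<in>Pow R. ?q \<sigma> ^ count A \<sigma>)"
      by (simp add: prob_points)
  qed
  also have "\<dots> = real (card (permutations_of_multiset A)) * poisson_mass ?\<mu> ?n * (\<Prod>\<sigma>\<in>Pow R. ?q \<sigma> ^ count A \<sigma>)"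
    by simp
  also have "real (card (permutations_of_multiset A)) = fact ?n / (\<Prod>\<sigma>\<in>Pow R. fact (count A \<sigma>))"
  proof -
    have "real (card (permutations_of_multiset A)) * (\<Prod>\<sigma>\<in>set_mset A. fact (count A \<sigma>)) = fact ?n"
      using card_permutations_of_multiset_aux[of A] by (metis (mono_tags, lifting) of_nat_fact of_nat_mult of_nat_prod prod.cong)
    moreover have "(\<Prod>\<sigma>\<in>set_mset A. fact (count A \<sigma>)) = (\<Prod>\<sigma>\<in>Pow R. fact (count A \<sigma>) :: real)"
      by (rule prod.mono_neutral_left[OF finP A]) (auto simp: not_in_iff)
    moreover have "(\<Prod>\<sigma>\<in>Pow R. fact (count A \<sigma>) :: real) \<noteq> 0" using finP by simp
    ultimately show ?thesis by (simp only: eq_divide_eq if_False if_True simp_thms)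
  qed
  also have "fact ?n / (\<Prod>\<sigma>\<in>Pow R. fact (count A \<sigma>)) * poisson_mass ?\<mu> ?n * (\<Prod>\<sigma>\<in>Pow R. ?q \<sigma> ^ count A \<sigma>)
    = (\<Prod>\<sigma>\<in>Pow R. ?\<mu> ^ count A \<sigma> * ?q \<sigma> ^ count A \<sigma> / fact (count A \<sigma>)) * exp (- ?\<mu>)"
  proof -
    have "?n = (\<Sum>\<sigma>\<in>Pow R. count A \<sigma>)"
      unfolding size_multiset_overloaded_eq by (rule sum.mono_neutral_left[OF finP A]) (auto simp: not_in_iff)
    then have "?\<mu> ^ ?n = (\<Prod>\<sigma>\<in>Pow R. ?\<mu> ^ count A \<sigma>)" by (simp only: power_sum)
    then show ?thesis by (simp add: poisson_mass_def prod.distrib prod_dividef del: power_mult_distrib)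
  qed
  \<comment> \<open>The cells partition the line, so their probabilities sum to 1 and the
    exponential factorises over them.\<close>
  also have "exp (- ?\<mu>) = (\<Prod>\<sigma>\<in>Pow R. exp (- (?\<mu> * ?q \<sigma>)))"
  proof -
    interpret U: prob_space unif by (rule prob_space_uniform_measure) (use T_pos in auto)
    have "U.prob (\<Union>\<sigma>\<in>Pow R. cell R \<sigma>) = (\<Sum>\<sigma>\<in>Pow R. ?q \<sigma>)"
    proof (rule U.finite_measure_finite_Union)
      show "cell R ` Pow R \<subseteq> U.events" using cell_measurable[OF R] by auto
      show "disjoint_family_on (cell R) (Pow R)" by (auto simp: disjoint_family_on_def cell_def)
    qed (rule finP)
    moreover have "(\<Union>\<sigma>\<in>Pow R. cell R \<sigma>) = UNIV"
    proof -
      have "x \<in> cell R (sig R x)" "sig R x \<in> Pow R" for x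
        by (simp add: cell_def) (auto simp: sig_def)
      then show ?thesis by blast
    qed
    ultimately have "(\<Sum>\<sigma>\<in>Pow R. ?q \<sigma>) = 1" using U.prob_space by simp
    moreover have "(\<Sum>\<sigma>\<in>Pow R. - (?\<mu> * ?q \<sigma>)) = - (?\<mu> * (\<Sum>\<sigma>\<in>Pow R. ?q \<sigma>))"
      by (simp only: sum_negf sum_distrib_left)
    ultimately have "- ?\<mu> = (\<Sum>\<sigma>\<in>Pow R. - (?\<mu> * ?q \<sigma>))" by simp
    then show ?thesis by (simp only: exp_sum[OF finP])
  qed
  finally show ?thesis unfolding prod.distrib[symmetric] by (simp add: poisson_mass_def power_mult_distrib)
qed

definition block :: "nat \<Rightarrow> nat set" where
  "block m = range (\<lambda>i. prod_encode (m, i))"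

lemma Ms_indep: "finite R \<Longrightarrow> P.indep_vars (\<lambda>_. count_space UNIV) (\<lambda>m \<omega>. Ms R m \<omega> = A m) UNIV"
proof -
  assume R: "finite R"
  note [measurable] = cell_measurable[OF R]
  have "P.indep_vars (\<lambda>m. PiM (block m) (\<lambda>_. borel)) (\<lambda>m \<omega>. restrict (\<lambda>c. \<omega> c) (block m)) UNIV"
    by (rule P.indep_vars_restrict[OF coordinates_indep]) (auto simp: disjoint_family_on_def block_def)
  then have "P.indep_vars (\<lambda>_. count_space UNIV) (\<lambda>m \<omega>. Ms R m (restrict (\<lambda>c. \<omega> c) (block m)) = A m) UNIV"
  proof (rule P.indep_vars_compose2)
    fix m
    have [measurable]: "(\<lambda>f. f (prod_encode (m, i))) \<in> borel_measurable (PiM (block m) (\<lambda>_. borel))" for i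
      by (rule measurable_component_singleton) (auto simp: block_def)
    show "(\<lambda>f. Ms R m f = A m) \<in> measurable (PiM (block m) (\<lambda>_. borel)) (count_space UNIV)"
      unfolding Ms_eq_iff cnt_def pt_def by measurable
  qed
  moreover have "Ms R m (restrict (\<lambda>c. \<omega> c) (block m)) = Ms R m \<omega>" for m \<omega>
    by (simp add: Ms_def cnt_def pt_def block_def)
  ultimately show ?thesis by simp
qed

lemma count_Ms_measurable:
  assumes R: "finite R"
  shows "(\<lambda>\<omega>. count (Ms R m \<omega>) \<sigma>) \<in> measurable P (count_space UNIV)"
proof -
  have eq: "count (Ms R m \<omega>) \<sigma> = card {i. i < cnt m \<omega> \<and> pt m i \<omega> \<in> cell R \<sigma>}" for \<omega>
    unfolding Ms_def count_mset count_list_eq_length_filter length_filter_conv_card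
    by (rule arg_cong[where f=card]) (auto simp: cell_def)
  show ?thesis
    unfolding eq
  proof (rule measurable_card)
    note [measurable] = cell_measurable[OF R]
    show "{\<omega>\<in>space P. i \<in> {i. i < cnt m \<omega> \<and> pt m i \<omega> \<in> cell R \<sigma>}} \<in> sets P" for i
      by measurable
  qed
qed

text \<open>The counts in all cells determine the multiset, so the joint point masses are products
  over \<open>m\<close> of \<open>prob_Ms\<close>; \<open>indep_vars_natI\<close> yields
  independence over processes and cells at once.\<close>

lemma cell_counts:
  assumes R: "finite R" and J: "finite J"
  shows "P.indep_vars (\<lambda>_. count_space UNIV) (\<lambda>(m, \<sigma>) \<omega>. count (Ms R m \<omega>) \<sigma>) (J \<times> Pow R)"
    and "m \<in> J \<Longrightarrow> \<sigma> \<subseteq> R \<Longrightarrow> P.prob {\<omega>. count (Ms R m \<omega>) \<sigma> = k} = poisson_mass (rate m * T * measure unif (cell R \<sigma>)) k"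
proof -
  let ?Z = "\<lambda>(m, \<sigma>) \<omega>. count (Ms R m \<omega>) \<sigma>"
  let ?g = "\<lambda>(m, \<sigma>). poisson_mass (rate m * T * measure unif (cell R \<sigma>))"
  have joint: "P.prob {\<omega>\<in>space P. \<forall>p\<in>J \<times> Pow R. ?Z p \<omega> = z p} = (\<Prod>p\<in>J \<times> Pow R. ?g p (z p))" for z
  proof (cases "J = {}")
    case True
    then show ?thesis using P.prob_space by simp
  next
    case False
    \<comment> \<open>The only multiset of cells with the prescribed counts.\<close>
    define A where "A m = (\<Sum>\<sigma>\<in>Pow R. replicate_mset (z (m, \<sigma>)) \<sigma>)" for m
    have count_A: "count (A m) \<sigma> = (if \<sigma> \<in> Pow R then z (m, \<sigma>) else 0)" for m \<sigma>
      unfolding A_def using R by (simp add: count_sum if_distrib cong: if_cong)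
    have "(\<forall>p\<in>J \<times> Pow R. ?Z p \<omega> = z p) \<longleftrightarrow> (\<forall>m\<in>J. Ms R m \<omega> = A m)" for \<omega>
    proof
      assume *: "\<forall>p\<in>J \<times> Pow R. ?Z p \<omega> = z p"
      show "\<forall>m\<in>J. Ms R m \<omega> = A m"
      proof
        fix m assume "m \<in> J"
        show "Ms R m \<omega> = A m"
        proof (rule multiset_eqI)
          fix \<sigma>
          show "count (Ms R m \<omega>) \<sigma> = count (A m) \<sigma>"
            using * \<open>m \<in> J\<close> set_Ms[of R m \<omega>] by (cases "\<sigma> \<in> Pow R") (auto simp: count_A not_in_iff[symmetric])
        qed
      qed
    qed (auto simp: count_A)
    then have "{\<omega>\<in>space P. \<forall>p\<in>J \<times> Pow R. ?Z p \<omega> = z p} = (\<Inter>m\<in>J. (\<lambda>\<omega>. Ms R m \<omega> = A m) -` {True} \<inter> space P)"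
      using False by auto
    also have "P.prob \<dots> = (\<Prod>m\<in>J. P.prob ((\<lambda>\<omega>. Ms R m \<omega> = A m) -` {True} \<inter> space P))"
      by (rule P.indep_varsD_finite[OF P.indep_vars_subset[OF Ms_indep[OF R]]]) (use J False in auto)
    also have "\<dots> = (\<Prod>m\<in>J. \<Prod>\<sigma>\<in>Pow R. ?g (m, \<sigma>) (z (m, \<sigma>)))"
    proof (rule prod.cong[OF refl])
      fix m
      have "set_mset (A m) \<subseteq> Pow R"
        using count_A[of m] by (auto simp: set_mset_def split: if_splits)
      from prob_Ms[OF R this, of m]
      show "P.prob ((\<lambda>\<omega>. Ms R m \<omega> = A m) -` {True} \<inter> space P) = (\<Prod>\<sigma>\<in>Pow R. ?g (m, \<sigma>) (z (m, \<sigma>)))"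
        by (simp add: vimage_def count_A)
    qed
    also have "\<dots> = (\<Prod>p\<in>J \<times> Pow R. ?g p (z p))"
      by (simp add: prod.cartesian_product split_beta')
    finally show ?thesis .
  qed
  have fin: "finite (J \<times> Pow R)" using R J by simp
  have meas: "?Z p \<in> measurable P (count_space UNIV)" for p
    using count_Ms_measurable[OF R] by (cases p) simp
  have g: "?g p sums 1" for p by (cases p) (simp add: poisson_mass_sums)
  note * = P.indep_vars_natI[of "J \<times> Pow R" ?Z ?g, OF fin meas g joint]
  show "P.indep_vars (\<lambda>_. count_space UNIV) ?Z (J \<times> Pow R)" by (rule *(1))
  show "m \<in> J \<Longrightarrow> \<sigma> \<subseteq> R \<Longrightarrow> P.prob {\<omega>. count (Ms R m \<omega>) \<sigma> = k} = poisson_mass (rate m * T * measure unif (cell R \<sigma>)) k"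
    using *(2)[of "(m, \<sigma>)" k] by simp
qed

end

lemma (in prob_space) prob_tendsto:
  assumes A: "\<And>k. A k \<in> events" "B \<in> events"
    and ev: "\<And>\<omega>. \<omega> \<in> space M \<Longrightarrow> \<forall>\<^sub>F k in sequentially. \<omega> \<in> A k \<longleftrightarrow> \<omega> \<in> B"
  shows "(\<lambda>k. prob (A k)) \<longlonglongrightarrow> prob B"
proof -
  have "(\<lambda>k. \<integral>\<omega>. indicator (A k) \<omega> \<partial>M) \<longlonglongrightarrow> (\<integral>\<omega>. indicator B \<omega> \<partial>M :: real)"
  proof (rule integral_dominated_convergence[where w="\<lambda>_. 1"])
    show "AE \<omega> in M. (\<lambda>k. indicat_real (A k) \<omega>) \<longlonglongrightarrow> indicat_real B \<omega>"
    proof (rule AE_I2)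
      fix \<omega> assume "\<omega> \<in> space M"
      from ev[OF this] have "\<forall>\<^sub>F k in sequentially. indicat_real (A k) \<omega> = indicat_real B \<omega>"
        by eventually_elim (simp add: indicator_def)
      then show "(\<lambda>k. indicat_real (A k) \<omega>) \<longlonglongrightarrow> indicat_real B \<omega>" by (rule tendsto_eventually)
    qed
  qed (use A in auto)
  then show ?thesis using A by simp
qed

section \<open>Independence of past and future jump counts\<close>

context jump_process
begin

text \<open>Jumps at nonpositive times are excluded as in \<open>sig\<close>, so that the count can
  be read off the cells for every \<open>u\<close>.\<close>

definition Nc :: "nat \<Rightarrow> real \<Rightarrow> real \<Rightarrow> (nat \<Rightarrow> real) \<Rightarrow> nat" where
  "Nc m u t \<omega> = card {i. i < cnt m \<omega> \<and> 0 < pt m i \<omega> \<and> u < pt m i \<omega> \<and> pt m i \<omega> \<le> t}"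

lemma Nc_measurable [measurable]: "Nc m u t \<in> measurable P (count_space UNIV)"
  unfolding Nc_def[abs_def] by (rule measurable_card) measurable

lemma card_sig_Ms:
  assumes R: "finite R"
  shows "card {i. i < cnt m \<omega> \<and> Q (sig R (pt m i \<omega>))} = (\<Sum>\<sigma>\<in>{\<sigma>\<in>Pow R. Q \<sigma>}. count (Ms R m \<omega>) \<sigma>)"
proof -
  let ?xs = "map (\<lambda>i. sig R (pt m i \<omega>)) [0..<cnt m \<omega>]"
  have "card {i. i < cnt m \<omega> \<and> Q (sig R (pt m i \<omega>))} = length (filter Q ?xs)"
    unfolding length_filter_conv_card by (rule arg_cong[where f=card]) auto
  also have "\<dots> = size (filter_mset Q (Ms R m \<omega>))"
    unfolding Ms_def by (metis mset_filter size_mset)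
  also have "\<dots> = (\<Sum>\<sigma>\<in>Pow R. count (filter_mset Q (Ms R m \<omega>)) \<sigma>)"
    unfolding size_multiset_overloaded_eq
    by (rule sum.mono_neutral_left) (use R set_Ms[of R m \<omega>] in \<open>auto simp: not_in_iff\<close>)
  also have "\<dots> = (\<Sum>\<sigma>\<in>{\<sigma>\<in>Pow R. Q \<sigma>}. count (Ms R m \<omega>) \<sigma>)"
    using R by (subst sum.inter_filter) auto
  finally show ?thesis .
qed

lemma Nc_Ms:
  assumes R: "finite R" "u \<in> R" "t \<in> R"
  shows "Nc m u t \<omega> = (\<Sum>\<sigma>\<in>{\<sigma>\<in>Pow R. t \<in> \<sigma> \<and> u \<notin> \<sigma>}. count (Ms R m \<omega>) \<sigma>)"
proof -
  have "Nc m u t \<omega> = card {i. i < cnt m \<omega> \<and> (t \<in> sig R (pt m i \<omega>) \<and> u \<notin> sig R (pt m i \<omega>))}"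
    unfolding Nc_def using R by (intro arg_cong[where f=card]) (auto simp: sig_def)
  then show ?thesis by (simp only: card_sig_Ms[OF R(1), where Q="\<lambda>\<sigma>. t \<in> \<sigma> \<and> u \<notin> \<sigma>"])
qed

lemma Nc_past_Ms:
  assumes R: "finite R" "u \<in> R" "r \<in> R" and "r \<le> u"
  shows "Nc m 0 r \<omega> = (\<Sum>\<sigma>\<in>{\<sigma>\<in>Pow R. r \<in> \<sigma> \<and> u \<in> \<sigma>}. count (Ms R m \<omega>) \<sigma>)"
proof -
  have "Nc m 0 r \<omega> = card {i. i < cnt m \<omega> \<and> (r \<in> sig R (pt m i \<omega>) \<and> u \<in> sig R (pt m i \<omega>))}"
    unfolding Nc_def using R \<open>r \<le> u\<close> by (intro arg_cong[where f=card]) (auto simp: sig_def)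
  then show ?thesis by (simp only: card_sig_Ms[OF R(1), where Q="\<lambda>\<sigma>. r \<in> \<sigma> \<and> u \<in> \<sigma>"])
qed

text \<open>A pair \<open>p\<close> stands for process \<open>fst p\<close> observed at time
  \<open>snd p\<close>. Such finite-dimensional events are stable under intersection, so
  independence passes to the generated \<sigma>-algebra.\<close>

definition past :: "real \<Rightarrow> (nat \<Rightarrow> real) set set" where
  "past u = {{\<omega>. \<forall>p\<in>S. Nc (fst p) 0 (snd p) \<omega> \<in> B p} | S B. finite S \<and> (\<forall>p\<in>S. snd p \<le> u)}"

definition fut :: "real \<Rightarrow> real \<Rightarrow> (nat \<Rightarrow> real) set set" where
  "fut u t = {{\<omega>. \<forall>m\<in>J. Nc m u t \<omega> \<in> B m} | J B. finite J}"

lemma Nc_event [measurable]: "{\<omega>. Nc m u t \<omega> \<in> B} \<in> P.events"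
proof -
  have "{\<omega>\<in>space P. Nc m u t \<omega> \<in> B} \<in> P.events" by measurable
  then show ?thesis by simp
qed

lemma past_events: "past u \<subseteq> P.events"
proof
  fix a assume "a \<in> past u"
  then obtain S B where a: "a = {\<omega>\<in>space P. \<forall>p\<in>S. Nc (fst p) 0 (snd p) \<omega> \<in> B p}" and "finite S"
    unfolding past_def by auto
  then show "a \<in> P.events"
    unfolding a by (intro sets.sets_Collect_finite_All) (auto intro: Nc_event)
qed

lemma fut_events: "fut u t \<subseteq> P.events"
proof
  fix a assume "a \<in> fut u t"
  then obtain J B where a: "a = {\<omega>\<in>space P. \<forall>m\<in>J. Nc m u t \<omega> \<in> B m}" and "finite J"
    unfolding fut_def by auto
  then show "a \<in> P.events"
    unfolding a by (intro sets.sets_Collect_finite_All) (auto intro: Nc_event)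
qed

lemma Int_stable_past: "Int_stable (past u)"
proof (rule Int_stableI)
  fix a b assume "a \<in> past u" "b \<in> past u"
  then obtain S B S' B' where a: "a = {\<omega>. \<forall>p\<in>S. Nc (fst p) 0 (snd p) \<omega> \<in> B p}" "finite S" "\<forall>p\<in>S. snd p \<le> u"
    and b: "b = {\<omega>. \<forall>p\<in>S'. Nc (fst p) 0 (snd p) \<omega> \<in> B' p}" "finite S'" "\<forall>p\<in>S'. snd p \<le> u"
    unfolding past_def by blast
  have eq: "a \<inter> b = {\<omega>. \<forall>p\<in>S \<union> S'. Nc (fst p) 0 (snd p) \<omega> \<in> (if p \<in> S then B p else UNIV) \<inter> (if p \<in> S' then B' p else UNIV)}"
    unfolding a b by auto
  show "a \<inter> b \<in> past u" unfolding past_def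
    by (intro CollectI exI conjI, rule eq) (use a(2,3) b(2,3) in auto)
qed

lemma Int_stable_fut: "Int_stable (fut u t)"
proof (rule Int_stableI)
  fix a b assume "a \<in> fut u t" "b \<in> fut u t"
  then obtain S B S' B' where a: "a = {\<omega>. \<forall>m\<in>S. Nc m u t \<omega> \<in> B m}" "finite S"
    and b: "b = {\<omega>. \<forall>m\<in>S'. Nc m u t \<omega> \<in> B' m}" "finite S'"
    unfolding fut_def by blast
  have eq: "a \<inter> b = {\<omega>. \<forall>m\<in>S \<union> S'. Nc m u t \<omega> \<in> (if m \<in> S then B m else UNIV) \<inter> (if m \<in> S' then B' m else UNIV)}"
    unfolding a b by auto
  show "a \<inter> b \<in> fut u t" unfolding fut_def
    by (intro CollectI exI conjI, rule eq) (use a(2) b(2) in auto)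
qed

text \<open>Cut the axis at \<open>u\<close>, \<open>t\<close> and all times observed. Past counts
  are then sums over cells whose signature contains \<open>u\<close>, future counts over cells whose
  signature does not, and disjoint groups of independent cell counts are independent.\<close>

lemma past_fut_prob:
  assumes "a \<in> past u" "b \<in> fut u t"
  shows "P.prob (a \<inter> b) = P.prob a * P.prob b"
proof -
  obtain S B where a: "a = {\<omega>. \<forall>p\<in>S. Nc (fst p) 0 (snd p) \<omega> \<in> B p}" and S: "finite S" "\<forall>p\<in>S. snd p \<le> u"
    using assms(1) unfolding past_def by blast
  obtain J B' where b: "b = {\<omega>. \<forall>m\<in>J. Nc m u t \<omega> \<in> B' m}" and J: "finite J"
    using assms(2) unfolding fut_def by blast
  define R where "R = snd ` S \<union> {u, t}"
  define K where "K = J \<union> fst ` S"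
  have R: "finite R" "u \<in> R" "t \<in> R" and K: "finite K" using S J by (auto simp: R_def K_def)
  define Z where "Z = (\<lambda>(m, \<sigma>) \<omega>. count (Ms R m \<omega>) \<sigma>)"
  define A1 where "A1 = {(m, \<sigma>). m \<in> K \<and> \<sigma> \<in> Pow R \<and> u \<in> \<sigma>}"
  define A2 where "A2 = {(m, \<sigma>). m \<in> K \<and> \<sigma> \<in> Pow R \<and> u \<notin> \<sigma>}"
  let ?M = "\<lambda>A. PiM A (\<lambda>_. count_space (UNIV :: nat set))"
  have ind: "P.indep_var (?M A1) (\<lambda>\<omega>. restrict (\<lambda>p. Z p \<omega>) A1) (?M A2) (\<lambda>\<omega>. restrict (\<lambda>p. Z p \<omega>) A2)"
    unfolding Z_def by (rule P.indep_var_restrict[OF cell_counts(1)[OF R(1) K]]) (auto simp: A1_def A2_def)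
  define E1 where "E1 = {f\<in>space (?M A1). \<forall>p\<in>S. (\<Sum>\<sigma>\<in>{\<sigma>\<in>Pow R. snd p \<in> \<sigma> \<and> u \<in> \<sigma>}. f (fst p, \<sigma>)) \<in> B p}"
  define E2 where "E2 = {f\<in>space (?M A2). \<forall>m\<in>J. (\<Sum>\<sigma>\<in>{\<sigma>\<in>Pow R. t \<in> \<sigma> \<and> u \<notin> \<sigma>}. f (m, \<sigma>)) \<in> B' m}"
  have E1: "E1 \<in> sets (?M A1)"
    unfolding E1_def
  proof (rule sets.sets_Collect_finite_All[OF _ S(1)])
    fix p assume "p \<in> S"
    then have [measurable]: "(\<lambda>f. f (fst p, \<sigma>)) \<in> measurable (?M A1) (count_space UNIV)"
      if "\<sigma> \<in> {\<sigma>\<in>Pow R. snd p \<in> \<sigma> \<and> u \<in> \<sigma>}" for \<sigma>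
      using that by (intro measurable_component_singleton) (auto simp: A1_def K_def)
    have [measurable]: "(\<lambda>f. \<Sum>\<sigma>\<in>{\<sigma>\<in>Pow R. snd p \<in> \<sigma> \<and> u \<in> \<sigma>}. f (fst p, \<sigma>)) \<in> measurable (?M A1) (count_space UNIV)"
      by (rule measurable_sum_nat) measurable
    show "{f\<in>space (?M A1). (\<Sum>\<sigma>\<in>{\<sigma>\<in>Pow R. snd p \<in> \<sigma> \<and> u \<in> \<sigma>}. f (fst p, \<sigma>)) \<in> B p} \<in> sets (?M A1)"
      by measurable
  qed
  have E2: "E2 \<in> sets (?M A2)"
    unfolding E2_def
  proof (rule sets.sets_Collect_finite_All[OF _ J])
    fix m assume "m \<in> J"
    then have [measurable]: "(\<lambda>f. f (m, \<sigma>)) \<in> measurable (?M A2) (count_space UNIV)"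
      if "\<sigma> \<in> {\<sigma>\<in>Pow R. t \<in> \<sigma> \<and> u \<notin> \<sigma>}" for \<sigma>
      using that by (intro measurable_component_singleton) (auto simp: A2_def K_def)
    have [measurable]: "(\<lambda>f. \<Sum>\<sigma>\<in>{\<sigma>\<in>Pow R. t \<in> \<sigma> \<and> u \<notin> \<sigma>}. f (m, \<sigma>)) \<in> measurable (?M A2) (count_space UNIV)"
      by (rule measurable_sum_nat) measurable
    show "{f\<in>space (?M A2). (\<Sum>\<sigma>\<in>{\<sigma>\<in>Pow R. t \<in> \<sigma> \<and> u \<notin> \<sigma>}. f (m, \<sigma>)) \<in> B' m} \<in> sets (?M A2)"
      by measurable
  qed
  have a': "(\<lambda>\<omega>. restrict (\<lambda>p. Z p \<omega>) A1) -` E1 \<inter> space P = a"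
  proof -
    have "(\<Sum>\<sigma>\<in>{\<sigma>\<in>Pow R. snd p \<in> \<sigma> \<and> u \<in> \<sigma>}. restrict (\<lambda>p. Z p \<omega>) A1 (fst p, \<sigma>)) = Nc (fst p) 0 (snd p) \<omega>" if "p \<in> S" for p \<omega>
      using that S by (subst Nc_past_Ms[OF R(1,2)]) (auto simp: R_def A1_def K_def Z_def intro!: sum.cong)
    then show ?thesis unfolding a E1_def by (auto simp: space_PiM)
  qed
  have b': "(\<lambda>\<omega>. restrict (\<lambda>p. Z p \<omega>) A2) -` E2 \<inter> space P = b"
  proof -
    have "(\<Sum>\<sigma>\<in>{\<sigma>\<in>Pow R. t \<in> \<sigma> \<and> u \<notin> \<sigma>}. restrict (\<lambda>p. Z p \<omega>) A2 (m, \<sigma>)) = Nc m u t \<omega>" if "m \<in> J" for m \<omega>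
      using that by (subst Nc_Ms[OF R]) (auto simp: A2_def K_def Z_def intro!: sum.cong)
    then show ?thesis unfolding b E2_def by (auto simp: space_PiM)
  qed
  have "(\<lambda>\<omega>. (restrict (\<lambda>p. Z p \<omega>) A1, restrict (\<lambda>p. Z p \<omega>) A2)) -` (E1 \<times> E2) \<inter> space P = a \<inter> b"
    using a' b' by blast
  with P.indep_varD[OF ind E1 E2] a' b' show ?thesis by simp
qed

lemma Nc_prob:
  assumes "0 \<le> s" "s \<le> t" "t \<le> T"
  shows "P.prob {\<omega>. Nc m s t \<omega> = k} = poisson_mass (rate m * (t - s)) k"
proof (cases "s = t")
  case True
  have "Nc m s t \<omega> = 0" for \<omega> unfolding Nc_def True by (auto simp: card_eq_0_iff)
  then show ?thesis using True P.prob_space by (cases k) (auto simp: poisson_mass_def)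
next
  case False
  then have "s < t" using assms by simp
  have "{\<sigma> \<in> Pow {s, t}. t \<in> \<sigma> \<and> s \<notin> \<sigma>} = {{t}}" using \<open>s < t\<close> by auto
  then have Nc: "Nc m s t \<omega> = count (Ms {s, t} m \<omega>) {t}" for \<omega>
    by (subst Nc_Ms[of "{s, t}"]) auto
  have "sig {s, t} x = {t} \<longleftrightarrow> s < x \<and> x \<le> t" for x
  proof -
    have "sig {s, t} x = (if 0 < x \<and> x \<le> s then {s} else {}) \<union> (if 0 < x \<and> x \<le> t then {t} else {})"
      by (auto simp: sig_def)
    then show ?thesis using \<open>s < t\<close> assms by auto
  qed
  then have cell: "cell {s, t} {t} = {s<..t}" by (auto simp: cell_def)
  have "{0..T} \<inter> {s<..t} = {s<..t}" using assms by auto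
  then have "measure unif (cell {s, t} {t}) = (t - s) / T"
    unfolding cell using assms T_pos \<open>s < t\<close> by (subst measure_uniform_measure) auto
  with cell_counts(2)[of "{s, t}" "{m}" m "{t}" k] show ?thesis
    using T_pos by (simp add: Nc)
qed

lemma Nc_indep: "P.indep_vars (\<lambda>_. count_space UNIV) (\<lambda>m. Nc m u t) UNIV"
proof -
  have "P.indep_vars (\<lambda>m. PiM (block m) (\<lambda>_. borel)) (\<lambda>m \<omega>. restrict (\<lambda>c. \<omega> c) (block m)) UNIV"
    by (rule P.indep_vars_restrict[OF coordinates_indep]) (auto simp: disjoint_family_on_def block_def)
  then have "P.indep_vars (\<lambda>_. count_space UNIV) (\<lambda>m \<omega>. Nc m u t (restrict (\<lambda>c. \<omega> c) (block m))) UNIV"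
  proof (rule P.indep_vars_compose2)
    fix m
    have [measurable]: "(\<lambda>f. f (prod_encode (m, i))) \<in> borel_measurable (PiM (block m) (\<lambda>_. borel))" for i
      by (rule measurable_component_singleton) (auto simp: block_def)
    show "Nc m u t \<in> measurable (PiM (block m) (\<lambda>_. borel)) (count_space UNIV)"
      unfolding Nc_def[abs_def] cnt_def pt_def by (rule measurable_card) measurable
  qed
  moreover have "Nc m u t (restrict (\<lambda>c. \<omega> c) (block m)) = Nc m u t \<omega>" for m \<omega>
    by (simp add: Nc_def cnt_def pt_def block_def)
  ultimately show ?thesis by simp
qed

lemma Nc_seq_measurable [measurable]: "(\<lambda>\<omega> m. Nc m u t \<omega>) \<in> measurable P (PiM UNIV (\<lambda>_. count_space UNIV))"
  by (intro measurable_PiM_single') auto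

text \<open>The counts of different processes are independent, so their joint law is the product of
  Poisson laws that depend only on the length of the interval.\<close>

lemma Nc_stationary:
  assumes "0 \<le> s" "0 \<le> h" "s + h \<le> T"
  shows "distr P (PiM UNIV (\<lambda>_. count_space UNIV)) (\<lambda>\<omega> m. Nc m s (s + h) \<omega>)
    = distr P (PiM UNIV (\<lambda>_. count_space UNIV)) (\<lambda>\<omega> m. Nc m 0 h \<omega>)"
proof -
  have "distr P (count_space UNIV) (Nc m s (s + h)) = distr P (count_space UNIV) (Nc m 0 h)" for m
  proof (rule measure_eqI_countable[of _ UNIV])
    fix k
    have "emeasure (distr P (count_space UNIV) (Nc m s t)) {k} = ennreal (poisson_mass (rate m * (t - s)) k)"
      if "0 \<le> s" "s \<le> t" "t \<le> T" for s t
      using Nc_prob[OF that, of m k] by (subst emeasure_distr) (auto simp: P.emeasure_eq_measure vimage_def)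
    from this[of s "s + h"] this[of 0 h]
    show "emeasure (distr P (count_space UNIV) (Nc m s (s + h))) {k} = emeasure (distr P (count_space UNIV) (Nc m 0 h)) {k}"
      using assms by simp
  qed auto
  moreover have "distr P (PiM UNIV (\<lambda>_. count_space UNIV)) (\<lambda>\<omega> m. Nc m u t \<omega>) = PiM UNIV (\<lambda>m. distr P (count_space UNIV) (Nc m u t))" for u t
    using P.indep_vars_iff_distr_eq_PiM[of UNIV "\<lambda>m. Nc m u t" "\<lambda>_. count_space UNIV"] Nc_indep[of u t]
    by (simp add: restrict_UNIV)
  ultimately show ?thesis by simp
qed

section \<open>Mean values and Campbell's formula\<close>

lemma nn_integral_cnt: "(\<integral>\<^sup>+\<omega>. of_nat (cnt m \<omega>) \<partial>P) = ennreal (rate m * T)"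
proof -
  let ?\<mu> = "rate m * T"
  have "(\<lambda>k. real (Suc k) * poisson_mass ?\<mu> (Suc k)) sums (?\<mu> * 1)"
  proof -
    have "real (Suc k) * poisson_mass ?\<mu> (Suc k) = ?\<mu> * poisson_mass ?\<mu> k" for k
      by (simp add: poisson_mass_def field_simps del: of_nat_Suc)
    then show ?thesis using sums_mult[OF poisson_mass_sums, of ?\<mu> ?\<mu>] by simp
  qed
  then have sums: "(\<lambda>k. real k * poisson_mass ?\<mu> k) sums ?\<mu>"
    by (subst (asm) sums_Suc_iff) simp
  have nn: "0 \<le> poisson_mass ?\<mu> k" for k using rate_T_pos[of m] by (simp add: poisson_mass_def)
  have "(\<integral>\<^sup>+\<omega>. of_nat (cnt m \<omega>) \<partial>P) = (\<integral>\<^sup>+k. of_nat k \<partial>distr P (count_space UNIV) (cnt m))"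
    by (subst nn_integral_distr) auto
  also have "distr P (count_space UNIV) (cnt m) = density (count_space UNIV) (\<lambda>k. ennreal (poisson_mass ?\<mu> k))"
  proof (rule measure_eqI_countable[of _ UNIV])
    fix k
    show "emeasure (distr P (count_space UNIV) (cnt m)) {k} = emeasure (density (count_space UNIV) (\<lambda>k. ennreal (poisson_mass ?\<mu> k))) {k}"
      using prob_cnt[of m k] by (subst emeasure_distr) (auto simp: P.emeasure_eq_measure vimage_def emeasure_density)
  qed auto
  also have "(\<integral>\<^sup>+k. of_nat k \<partial>density (count_space UNIV) (\<lambda>k. ennreal (poisson_mass ?\<mu> k))) = (\<integral>\<^sup>+k. ennreal (real k * poisson_mass ?\<mu> k) \<partial>count_space UNIV)"
  proof (subst nn_integral_density)
    show "(\<integral>\<^sup>+k. ennreal (poisson_mass ?\<mu> k) * of_nat k \<partial>count_space UNIV) = (\<integral>\<^sup>+k. ennreal (real k * poisson_mass ?\<mu> k) \<partial>count_space UNIV)"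
      by (intro nn_integral_cong) (simp add: ennreal_of_nat_eq_real_of_nat ennreal_mult' mult.commute[of "ennreal (poisson_mass _ _)"])
  qed auto
  also have "\<dots> = (\<Sum>k. ennreal (real k * poisson_mass ?\<mu> k))"
    by (rule nn_integral_count_space_nat)
  also have "\<dots> = ennreal ?\<mu>"
    using sums nn by (subst suminf_ennreal2) (auto simp: sums_iff)
  finally show ?thesis .
qed

definition Sf :: "nat \<Rightarrow> (real \<Rightarrow> real) \<Rightarrow> (nat \<Rightarrow> real) \<Rightarrow> real" where
  "Sf m f \<omega> = (\<Sum>i<cnt m \<omega>. f (pt m i \<omega>))"

lemma Sf_measurable [measurable]: "f \<in> borel_measurable borel \<Longrightarrow> Sf m f \<in> borel_measurable P"
proof -
  assume [measurable]: "f \<in> borel_measurable borel"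
  have "(\<lambda>\<omega>. (\<lambda>k \<omega>. \<Sum>i<k. f (pt m i \<omega>)) (cnt m \<omega>) \<omega>) \<in> borel_measurable P"
    by (rule measurable_compose_countable) measurable
  then show ?thesis by (simp add: Sf_def[abs_def])
qed

text \<open>The sum over the jumps is a series over all candidates, the \<open>i\<close>-th weighted
  by the indicator of i < cnt. Number and position are independent, so each term factorises; the
  weights have total mean rate * T, whose T cancels against the uniform density 1 / T.\<close>

lemma campbell:
  assumes [measurable]: "f \<in> borel_measurable borel" and nn: "\<And>x. 0 \<le> f x"
  shows "(\<integral>\<^sup>+\<omega>. ennreal (Sf m f \<omega>) \<partial>P) = ennreal (rate m) * (\<integral>\<^sup>+x\<in>{0..T}. ennreal (f x) \<partial>lborel)"
proof -
  let ?I = "\<integral>\<^sup>+x\<in>{0..T}. ennreal (f x) \<partial>lborel"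
  have unif: "(\<integral>\<^sup>+x. ennreal (f x) \<partial>unif) = ?I / ennreal T"
    using T_pos by (subst nn_integral_uniform_measure) auto
  have prod: "(\<integral>\<^sup>+\<omega>. indicator {..<cnt m \<omega>} i * ennreal (f (pt m i \<omega>)) \<partial>P)
      = (\<integral>\<^sup>+\<omega>. indicator {..<cnt m \<omega>} i \<partial>P) * (?I / ennreal T)" for i
  proof -
    let ?c = "prod_encode (m, 0)" and ?d = "prod_encode (m, Suc i)"
    define Y where "Y c x = (if c = ?c then indicator {..<nat \<lfloor>x\<rfloor>} i else ennreal (f x))" for c and x :: real
    have ind: "P.indep_vars (\<lambda>_. borel) (\<lambda>c \<omega>. Y c (\<omega> c)) {?c, ?d}"
    proof (rule P.indep_vars_compose2[OF P.indep_vars_subset[OF coordinates_indep]])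
      show "Y c \<in> borel_measurable borel" for c
        unfolding Y_def[abs_def] by (cases "c = ?c") (auto simp: indicator_def)
    qed simp
    have "(\<integral>\<^sup>+\<omega>. (\<Prod>c\<in>{?c, ?d}. Y c (\<omega> c)) \<partial>P) = (\<Prod>c\<in>{?c, ?d}. \<integral>\<^sup>+\<omega>. Y c (\<omega> c) \<partial>P)"
      by (rule P.indep_vars_nn_integral[OF _ ind]) auto
    then have "(\<integral>\<^sup>+\<omega>. indicator {..<cnt m \<omega>} i * ennreal (f (pt m i \<omega>)) \<partial>P)
      = (\<integral>\<^sup>+\<omega>. indicator {..<cnt m \<omega>} i \<partial>P) * (\<integral>\<^sup>+\<omega>. ennreal (f (pt m i \<omega>)) \<partial>P)"
      by (simp add: Y_def cnt_def pt_def)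
    also have "(\<integral>\<^sup>+\<omega>. ennreal (f (pt m i \<omega>)) \<partial>P) = (\<integral>\<^sup>+x. ennreal (f x) \<partial>unif)"
      unfolding distr_pt[of m i, symmetric] by (subst nn_integral_distr) auto
    finally show ?thesis by (simp only: unif)
  qed
  have fin_sum: "(\<Sum>i. indicator {..<n} i * g i) = (\<Sum>i<n. g i)" for n and g :: "nat \<Rightarrow> ennreal"
    by (subst suminf_finite[of "{..<n}"]) auto
  have ind_meas [measurable]: "(\<lambda>\<omega>. indicator {..<cnt m \<omega>} i :: ennreal) \<in> borel_measurable P" for i
    unfolding indicator_def by measurable
  have "(\<integral>\<^sup>+\<omega>. ennreal (Sf m f \<omega>) \<partial>P) = (\<integral>\<^sup>+\<omega>. (\<Sum>i. indicator {..<cnt m \<omega>} i * ennreal (f (pt m i \<omega>))) \<partial>P)"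
    unfolding fin_sum by (intro nn_integral_cong) (simp add: Sf_def sum_ennreal nn)
  also have "\<dots> = (\<Sum>i. (\<integral>\<^sup>+\<omega>. indicator {..<cnt m \<omega>} i * ennreal (f (pt m i \<omega>)) \<partial>P))"
    by (rule nn_integral_suminf) measurable
  also have "\<dots> = (\<Sum>i. (\<integral>\<^sup>+\<omega>. indicator {..<cnt m \<omega>} i \<partial>P)) * (?I / ennreal T)"
    unfolding prod by (rule ennreal_suminf_multc)
  also have "(\<Sum>i. (\<integral>\<^sup>+\<omega>. indicator {..<cnt m \<omega>} i \<partial>P)) = (\<integral>\<^sup>+\<omega>. (\<Sum>i. indicator {..<cnt m \<omega>} i) \<partial>P)"
    by (rule nn_integral_suminf[symmetric]) measurable
  also have "\<dots> = (\<integral>\<^sup>+\<omega>. of_nat (cnt m \<omega>) \<partial>P)"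
    using fin_sum[of _ "\<lambda>_. 1"] by simp
  also have "\<dots> * (?I / ennreal T) = ennreal (rate m) * ?I"
  proof -
    have "ennreal T * (?I / ennreal T) = ?I"
      unfolding ennreal_times_divide by (subst mult.commute, rule ennreal_mult_divide_eq) (use T_pos in auto)
    then show ?thesis
      unfolding nn_integral_cnt using T_pos rate_pos[of m] by (simp add: ennreal_mult mult.assoc)
  qed
  finally show ?thesis .
qed

end

text \<open>Dominated convergence for series whose terms become equal to their limits, as jump
  counts do. Beyond \<open>N\<close> both series are controlled by the tail of
  \<open>M\<close>.\<close>

lemma suminf_tendsto_of_eventually_const:
  fixes a :: "nat \<Rightarrow> 'x \<Rightarrow> 'b::banach"
  assumes ev: "\<And>m. \<forall>\<^sub>F x in F. a m x = b m"
    and bound: "\<And>m x. norm (a m x) \<le> M m" and M: "summable M" and F: "F \<noteq> bot"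
  shows "((\<lambda>x. \<Sum>m. a m x) \<longlongrightarrow> (\<Sum>m. b m)) F"
proof (rule tendstoI)
  fix e :: real assume "e > 0"
  have b: "norm (b m) \<le> M m" for m
    using eventually_happens'[OF F ev[of m]] bound[of m] by metis
  have sa: "summable (\<lambda>m. a m x)" for x
    by (rule summable_comparison_test[OF _ M]) (use bound in auto)
  have sb: "summable b"
    by (rule summable_comparison_test[OF _ M]) (use b in auto)
  obtain N where N: "\<And>n. n \<ge> N \<Longrightarrow> norm (\<Sum>i. M (i + n)) < e / 2"
    using suminf_exist_split[OF half_gt_zero[OF \<open>e > 0\<close>] M] by blast
  have "\<forall>\<^sub>F x in F. \<forall>m\<in>{..<N}. a m x = b m"
    using ev by (intro eventually_ball_finite) auto
  then show "\<forall>\<^sub>F x in F. dist (\<Sum>m. a m x) (\<Sum>m. b m) < e"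
  proof eventually_elim
    case (elim x)
    let ?d = "\<lambda>m. a m x - b m"
    have M2: "summable (\<lambda>m. 2 * M (m + N))"
      using M by (intro summable_mult) (simp add: summable_iff_shift)
    have le: "norm (?d m) \<le> 2 * M m" for m
      using norm_triangle_ineq4[of "a m x" "b m"] bound[of m x] b[of m] by simp
    have sd: "summable (\<lambda>m. norm (?d (m + N)))"
      by (rule summable_comparison_test[OF _ M2]) (use le in auto)
    have "(\<Sum>m. a m x) - (\<Sum>m. b m) = (\<Sum>m. ?d m)"
      by (rule suminf_diff[OF sa sb])
    also have "\<dots> = (\<Sum>m. ?d (m + N)) + (\<Sum>m<N. ?d m)"
      by (rule suminf_split_initial_segment[OF summable_diff[OF sa sb]])
    also have "(\<Sum>m<N. ?d m) = 0" using elim by simp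
    finally have "dist (\<Sum>m. a m x) (\<Sum>m. b m) = norm (\<Sum>m. ?d (m + N))" by (simp add: dist_norm)
    also have "\<dots> \<le> (\<Sum>m. norm (?d (m + N)))" by (rule summable_norm[OF sd])
    also have "\<dots> \<le> (\<Sum>m. 2 * M (m + N))" by (rule suminf_le[OF le sd M2])
    also have "\<dots> = 2 * (\<Sum>m. M (m + N))" using M by (intro suminf_mult) (simp add: summable_iff_shift)
    also have "\<dots> < e" using N[of N] by (simp add: abs_if split: if_splits)
    finally show ?case .
  qed
qed

section \<open>Pathwise integrals against the jumps\<close>

context jump_process
begin

text \<open>Finite total length of all candidate jumps. Off this event, on a null set, the process
  is put to 0, so that every path is cadlag.\<close>

definition good :: "(nat \<Rightarrow> real) \<Rightarrow> bool" where
  "good \<omega> \<longleftrightarrow> (\<Sum>m. ennreal (real (cnt m \<omega>) * norm (w m))) \<noteq> top"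

lemma good_measurable [measurable]: "Measurable.pred P good"
  unfolding good_def[abs_def] by measurable

definition total_rate :: real where
  "total_rate = (\<Sum>m. rate m * norm (w m))"

lemma rate_norm_nonneg: "0 \<le> rate m * norm (w m)"
  using rate_pos[of m] by simp

lemma total_rate_nonneg: "0 \<le> total_rate"
  unfolding total_rate_def by (intro suminf_nonneg summable_rate rate_norm_nonneg)

lemma suminf_rate: "(\<Sum>m. ennreal (rate m * norm (w m))) = ennreal total_rate"
  unfolding total_rate_def
  by (rule suminf_ennreal2[OF rate_norm_nonneg summable_rate])

lemma AE_good: "AE \<omega> in P. good \<omega>"
proof -
  have "(\<integral>\<^sup>+\<omega>. (\<Sum>m. ennreal (real (cnt m \<omega>) * norm (w m))) \<partial>P) = (\<Sum>m. (\<integral>\<^sup>+\<omega>. ennreal (real (cnt m \<omega>) * norm (w m)) \<partial>P))"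
    by (rule nn_integral_suminf) measurable
  also have "\<dots> = (\<Sum>m. ennreal T * ennreal (rate m * norm (w m)))"
  proof (rule arg_cong[where f=suminf], rule ext)
    fix m
    have "(\<integral>\<^sup>+\<omega>. ennreal (real (cnt m \<omega>) * norm (w m)) \<partial>P) = (\<integral>\<^sup>+\<omega>. of_nat (cnt m \<omega>) * ennreal (norm (w m)) \<partial>P)"
      by (intro nn_integral_cong) (simp add: ennreal_mult' ennreal_of_nat_eq_real_of_nat)
    also have "\<dots> = ennreal (rate m * T) * ennreal (norm (w m))"
      by (subst nn_integral_multc) (auto simp: nn_integral_cnt)
    also have "\<dots> = ennreal T * ennreal (rate m * norm (w m))"
      using T_pos rate_pos[of m] by (simp add: ennreal_mult[symmetric] mult_ac)
    finally show "(\<integral>\<^sup>+\<omega>. ennreal (real (cnt m \<omega>) * norm (w m)) \<partial>P) = ennreal T * ennreal (rate m * norm (w m))" .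
  qed
  also have "\<dots> = ennreal T * ennreal total_rate"
    by (simp add: suminf_rate)
  also have "\<dots> \<noteq> \<infinity>" by (simp add: ennreal_mult_eq_top_iff)
  finally show ?thesis
    unfolding good_def by (intro nn_integral_PInf_AE[unfolded infinity_ennreal_def]) auto
qed

lemma good_summable: "good \<omega> \<Longrightarrow> summable (\<lambda>m. real (cnt m \<omega>) * norm (w m))"
  unfolding good_def by (intro summable_suminf_not_top) auto

text \<open>The pathwise integral of \<open>f\<close>: the sum over all jumps of the value of
  \<open>f\<close> at the jump time times the jump vector. Linear on bounded functions, it covers
  \<open>X\<close>, step integrals and truncated kernels alike.\<close>

definition JX :: "(real \<Rightarrow> real) \<Rightarrow> (nat \<Rightarrow> real) \<Rightarrow> 'b" where
  "JX f \<omega> = (if good \<omega> then \<Sum>m. Sf m f \<omega> *\<^sub>R w m else 0)"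

lemma JX_measurable [measurable]:
  assumes [measurable]: "f \<in> borel_measurable borel"
  shows "JX f \<in> borel_measurable P"
  unfolding JX_def[abs_def] by measurable

lemma Sf_bound:
  assumes "\<And>x. \<bar>f x\<bar> \<le> b"
  shows "\<bar>Sf m f \<omega>\<bar> \<le> b * real (cnt m \<omega>)"
proof -
  have "\<bar>Sf m f \<omega>\<bar> \<le> (\<Sum>i<cnt m \<omega>. b)"
    unfolding Sf_def using assms by (intro order.trans[OF sum_abs] sum_mono) auto
  then show ?thesis by (simp add: mult.commute)
qed

lemma JX_summable:
  assumes "\<And>x. \<bar>f x\<bar> \<le> b" "good \<omega>"
  shows "summable (\<lambda>m. norm (Sf m f \<omega> *\<^sub>R w m))"
proof (rule summable_comparison_test)
  show "summable (\<lambda>m. b * (real (cnt m \<omega>) * norm (w m)))"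
    by (rule summable_mult[OF good_summable[OF assms(2)]])
  show "\<exists>N. \<forall>n\<ge>N. norm (norm (Sf n f \<omega> *\<^sub>R w n)) \<le> b * (real (cnt n \<omega>) * norm (w n))"
    using mult_right_mono[OF Sf_bound[OF assms(1)]] by (auto simp: mult.assoc)
qed

lemma JX_add:
  assumes "\<And>x. \<bar>f x\<bar> \<le> b" "\<And>x. \<bar>g x\<bar> \<le> c"
  shows "JX (\<lambda>x. f x + g x) \<omega> = JX f \<omega> + JX g \<omega>"
proof (cases "good \<omega>")
  case True
  have "Sf m (\<lambda>x. f x + g x) \<omega> *\<^sub>R w m = Sf m f \<omega> *\<^sub>R w m + Sf m g \<omega> *\<^sub>R w m" for m
    by (simp add: Sf_def sum.distrib scaleR_left_distrib)
  with True show ?thesis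
    using suminf_add[OF summable_norm_cancel[OF JX_summable[where f=f and b=b, OF assms(1) True]]
        summable_norm_cancel[OF JX_summable[where f=g and b=c, OF assms(2) True]]]
    by (simp add: JX_def)
qed (simp add: JX_def)

lemma JX_cmult:
  assumes "\<And>x. \<bar>f x\<bar> \<le> b"
  shows "JX (\<lambda>x. c * f x) \<omega> = c *\<^sub>R JX f \<omega>"
proof (cases "good \<omega>")
  case True
  have eq: "Sf m (\<lambda>x. c * f x) \<omega> = c * Sf m f \<omega>" for m
    by (simp add: Sf_def sum_distrib_left)
  with True show ?thesis
    using suminf_scaleR_right[OF summable_norm_cancel[OF JX_summable[where f=f and b=b, OF assms True]], of c]
    by (simp add: JX_def eq)
qed (simp add: JX_def)

lemma JX_diff:
  assumes "\<And>x. \<bar>f x\<bar> \<le> b" "\<And>x. \<bar>g x\<bar> \<le> c"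
  shows "JX (\<lambda>x. f x - g x) \<omega> = JX f \<omega> - JX g \<omega>"
  using JX_add[of f b "\<lambda>x. (-1) * g x" c \<omega>] JX_cmult[of g c "-1" \<omega>] assms by simp

lemma JX_sum:
  fixes n :: nat
  assumes "\<And>j x. \<bar>f j x\<bar> \<le> 1"
  shows "JX (\<lambda>x. \<Sum>j<n. a j * f j x) \<omega> = (\<Sum>j<n. a j *\<^sub>R JX (f j) \<omega>)"
proof (induction n)
  case 0
  then show ?case by (simp add: JX_def Sf_def)
next
  case (Suc n)
  have bd: "\<bar>a j * f j x\<bar> \<le> \<bar>a j\<bar>" for j x
    using assms[of j x] by (simp add: abs_mult mult_left_le)
  have "\<bar>\<Sum>j<n. a j * f j x\<bar> \<le> (\<Sum>j<n. \<bar>a j\<bar>)" for x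
    by (intro order.trans[OF sum_abs] sum_mono bd)
  from JX_add[of "\<lambda>x. \<Sum>j<n. a j * f j x", OF this bd[of n]] Suc show ?case
    by (simp add: JX_cmult[OF assms])
qed

text \<open>Triangle inequality and Campbell's formula. This bound by the L^1 norm of
  \<open>f\<close> is what makes the exponents \<beta> = p = 1 work.\<close>

lemma JX_norm:
  assumes [measurable]: "f \<in> borel_measurable borel" and b: "\<And>x. \<bar>f x\<bar> \<le> b"
  shows "(\<integral>\<^sup>+\<omega>. ennreal (norm (JX f \<omega>)) \<partial>P) \<le> ennreal total_rate * (\<integral>\<^sup>+x\<in>{0..T}. ennreal \<bar>f x\<bar> \<partial>lborel)"
proof -
  let ?I = "\<integral>\<^sup>+x\<in>{0..T}. ennreal \<bar>f x\<bar> \<partial>lborel"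
  have [measurable]: "Sf m (\<lambda>x. \<bar>f x\<bar>) \<in> borel_measurable P" for m by (rule Sf_measurable) measurable
  have "ennreal (norm (JX f \<omega>)) \<le> (\<Sum>m. ennreal (Sf m (\<lambda>x. \<bar>f x\<bar>) \<omega>) * ennreal (norm (w m)))" for \<omega>
  proof (cases "good \<omega>")
    case True
    note s = JX_summable[where f=f and b=b, OF b True]
    have "ennreal (norm (JX f \<omega>)) \<le> ennreal (\<Sum>m. norm (Sf m f \<omega> *\<^sub>R w m))"
      using True summable_norm[OF s] by (simp add: JX_def ennreal_leI)
    also have "\<dots> = (\<Sum>m. ennreal (norm (Sf m f \<omega> *\<^sub>R w m)))"
      by (rule suminf_ennreal2[symmetric, OF _ s]) simp
    also have "\<dots> \<le> (\<Sum>m. ennreal (Sf m (\<lambda>x. \<bar>f x\<bar>) \<omega>) * ennreal (norm (w m)))"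
    proof (intro suminf_le)
      fix m
      have "\<bar>Sf m f \<omega>\<bar> \<le> Sf m (\<lambda>x. \<bar>f x\<bar>) \<omega>" unfolding Sf_def by (rule sum_abs)
      then show "ennreal (norm (Sf m f \<omega> *\<^sub>R w m)) \<le> ennreal (Sf m (\<lambda>x. \<bar>f x\<bar>) \<omega>) * ennreal (norm (w m))"
        by (subst ennreal_mult'[symmetric]) (auto intro!: ennreal_leI mult_right_mono sum_nonneg simp: Sf_def)
    qed auto
    finally show ?thesis .
  qed (simp add: JX_def)
  then have "(\<integral>\<^sup>+\<omega>. ennreal (norm (JX f \<omega>)) \<partial>P) \<le> (\<integral>\<^sup>+\<omega>. (\<Sum>m. ennreal (Sf m (\<lambda>x. \<bar>f x\<bar>) \<omega>) * ennreal (norm (w m))) \<partial>P)"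
    by (rule nn_integral_mono)
  also have "\<dots> = (\<Sum>m. (\<integral>\<^sup>+\<omega>. ennreal (Sf m (\<lambda>x. \<bar>f x\<bar>) \<omega>) * ennreal (norm (w m)) \<partial>P))"
    by (rule nn_integral_suminf) measurable
  also have "\<dots> = (\<Sum>m. ennreal (rate m * norm (w m)) * ?I)"
  proof (rule arg_cong[where f=suminf], rule ext)
    fix m
    have "(\<integral>\<^sup>+\<omega>. ennreal (Sf m (\<lambda>x. \<bar>f x\<bar>) \<omega>) * ennreal (norm (w m)) \<partial>P) = ennreal (rate m) * ?I * ennreal (norm (w m))"
      by (subst nn_integral_multc) (auto simp: campbell)
    then show "(\<integral>\<^sup>+\<omega>. ennreal (Sf m (\<lambda>x. \<bar>f x\<bar>) \<omega>) * ennreal (norm (w m)) \<partial>P) = ennreal (rate m * norm (w m)) * ?I"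
      using rate_pos[of m] by (simp add: ennreal_mult mult_ac)
  qed
  also have "\<dots> = ennreal total_rate * ?I"
    by (simp add: suminf_rate)
  finally show ?thesis .
qed

definition X :: "real \<Rightarrow> (nat \<Rightarrow> real) \<Rightarrow> 'b" where
  "X t = JX (indicator {0<..t})"

lemma X_measurable [measurable]: "X t \<in> borel_measurable P"
  unfolding X_def by measurable

lemma X_diff:
  assumes "0 \<le> s" "s \<le> t"
  shows "X t \<omega> - X s \<omega> = JX (indicator {s<..t}) \<omega>"
proof -
  have "(\<lambda>x. indicat_real {0<..t} x - indicat_real {0<..s} x) = indicat_real {s<..t}"
    using assms by (auto simp: indicator_def fun_eq_iff)
  then show ?thesis
    using JX_diff[of "indicat_real {0<..t}" 1 "indicat_real {0<..s}" 1 \<omega>] by (simp add: X_def indicator_def)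
qed

text \<open>Writes increments of \<open>X\<close> as one fixed measurable function of the jump
  counts, so that laws and independence pass from the counts to \<open>X\<close>.\<close>

definition \<Phi> :: "(nat \<Rightarrow> nat) \<Rightarrow> 'b" where
  "\<Phi> n = (\<Sum>m. real (n m) *\<^sub>R w m)"

lemma \<Phi>_measurable [measurable]: "\<Phi> \<in> borel_measurable (PiM UNIV (\<lambda>_. count_space UNIV))"
  unfolding \<Phi>_def[abs_def] by measurable

lemma Sf_indicator:
  assumes "0 \<le> s"
  shows "Sf m (indicator {s<..t}) \<omega> = real (Nc m s t \<omega>)"
proof -
  have "Sf m (indicator {s<..t}) \<omega> = real (card ({..<cnt m \<omega>} \<inter> {i. pt m i \<omega> \<in> {s<..t}}))"
    unfolding Sf_def by (simp add: indicator_def sum.If_cases of_bool_def)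
  also have "{..<cnt m \<omega>} \<inter> {i. pt m i \<omega> \<in> {s<..t}} = {i. i < cnt m \<omega> \<and> 0 < pt m i \<omega> \<and> s < pt m i \<omega> \<and> pt m i \<omega> \<le> t}"
    using assms by auto
  finally show ?thesis by (simp add: Nc_def)
qed

lemma JX_indicator:
  assumes "0 \<le> s" "good \<omega>"
  shows "JX (indicator {s<..t}) \<omega> = \<Phi> (\<lambda>m. Nc m s t \<omega>)"
  using assms by (simp add: JX_def \<Phi>_def Sf_indicator)

lemma Nc_le_cnt: "Nc m u t \<omega> \<le> cnt m \<omega>"
proof -
  have "Nc m u t \<omega> \<le> card {..<cnt m \<omega>}" unfolding Nc_def by (rule card_mono) auto
  then show ?thesis by simp
qed

lemma eventually_Nc_right: "\<forall>\<^sub>F s' in at_right s. Nc m s' t \<omega> = Nc m s t \<omega> \<and> Nc m 0 s' \<omega> = Nc m 0 s \<omega>"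
proof -
  have "\<forall>\<^sub>F s' in at_right s. \<forall>i\<in>{..<cnt m \<omega>}. (s' < pt m i \<omega> \<longleftrightarrow> s < pt m i \<omega>)"
  proof (rule eventually_ball_finite, simp, rule ballI)
    fix i
    show "\<forall>\<^sub>F s' in at_right s. (s' < pt m i \<omega> \<longleftrightarrow> s < pt m i \<omega>)"
    proof (cases "s < pt m i \<omega>")
      case True
      then show ?thesis by (auto simp: eventually_at_right intro!: exI[of _ "pt m i \<omega>"])
    next
      case False
      then show ?thesis by (auto simp: eventually_at_filter)
    qed
  qed
  then show ?thesis
  proof eventually_elim
    case (elim s')
    then have "i < cnt m \<omega> \<Longrightarrow> s' < pt m i \<omega> \<longleftrightarrow> s < pt m i \<omega>" "i < cnt m \<omega> \<Longrightarrow> pt m i \<omega> \<le> s' \<longleftrightarrow> pt m i \<omega> \<le> s" for i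
      by (auto simp flip: not_less)
    then show ?case unfolding Nc_def by (auto intro!: arg_cong[where f=card] Collect_cong)
  qed
qed

lemma eventually_Nc_left: "\<forall>\<^sub>F s' in at_left s. Nc m 0 s' \<omega> = card {i. i < cnt m \<omega> \<and> 0 < pt m i \<omega> \<and> pt m i \<omega> < s}"
proof -
  have "\<forall>\<^sub>F s' in at_left s. \<forall>i\<in>{..<cnt m \<omega>}. (pt m i \<omega> \<le> s' \<longleftrightarrow> pt m i \<omega> < s)"
  proof (rule eventually_ball_finite, simp, rule ballI)
    fix i
    show "\<forall>\<^sub>F s' in at_left s. (pt m i \<omega> \<le> s' \<longleftrightarrow> pt m i \<omega> < s)"
    proof (cases "pt m i \<omega> < s")
      case True
      then show ?thesis by (auto simp: eventually_at_left intro!: exI[of _ "pt m i \<omega>"])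
    next
      case False
      then show ?thesis by (auto simp: eventually_at_filter)
    qed
  qed
  then show ?thesis
  proof eventually_elim
    case (elim s')
    then show ?case unfolding Nc_def by (auto intro!: arg_cong[where f=card] Collect_cong)
  qed
qed

lemma X_cadlag: "cadlag_on T (\<lambda>t. X t \<omega>)"
proof (cases "good \<omega>")
  case False
  then show ?thesis by (auto simp: cadlag_on_def X_def JX_def)
next
  case True
  have X: "X t \<omega> = (\<Sum>m. real (Nc m 0 t \<omega>) *\<^sub>R w m)" for t
    using JX_indicator[of 0 \<omega> t] True by (simp add: X_def \<Phi>_def)
  have bd: "norm (real (Nc m 0 t \<omega>) *\<^sub>R w m) \<le> real (cnt m \<omega>) * norm (w m)" for m t
    using Nc_le_cnt[of m 0 t \<omega>] by (simp add: mult_right_mono)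
  note lim = suminf_tendsto_of_eventually_const[where M="\<lambda>m. real (cnt m \<omega>) * norm (w m)", OF _ _ good_summable[OF True]]
  show ?thesis
    unfolding cadlag_on_def X
  proof (intro conjI ballI)
    show "((\<lambda>t. \<Sum>m. real (Nc m 0 t \<omega>) *\<^sub>R w m) \<longlongrightarrow> (\<Sum>m. real (Nc m 0 t \<omega>) *\<^sub>R w m)) (at_right t)" for t
    proof (rule lim)
      show "\<forall>\<^sub>F x in at_right t. real (Nc m 0 x \<omega>) *\<^sub>R w m = real (Nc m 0 t \<omega>) *\<^sub>R w m" for m
        using eventually_Nc_right[where m=m and t=t and \<omega>=\<omega> and s=t] by eventually_elim simp
    qed (use bd in auto)
    show "\<exists>l. ((\<lambda>t. \<Sum>m. real (Nc m 0 t \<omega>) *\<^sub>R w m) \<longlongrightarrow> l) (at_left t)" for t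
    proof (rule exI, rule lim)
      show "\<forall>\<^sub>F x in at_left t. real (Nc m 0 x \<omega>) *\<^sub>R w m = real (card {i. i < cnt m \<omega> \<and> 0 < pt m i \<omega> \<and> pt m i \<omega> < t}) *\<^sub>R w m" for m
        using eventually_Nc_left[where m=m and \<omega>=\<omega> and s=t] by eventually_elim simp
    qed (use bd in auto)
  qed
qed

section \<open>The completed right-continuous filtration\<close>

definition M :: "(nat \<Rightarrow> real) measure" where
  "M = completion P"

sublocale M: prob_space M
proof (rule prob_spaceI)
  have "UNIV \<in> sets P" using sets.top[of P] by simp
  then show "emeasure M (space M) = 1"
    using P.emeasure_space_1 by (simp add: M_def)
qed

lemma space_M [simp]: "space M = UNIV"
  by (simp add: M_def)

lemma AE_M_iff: "(AE \<omega> in M. Q \<omega>) \<longleftrightarrow> (AE \<omega> in P. Q \<omega>)"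
  unfolding M_def by (rule AE_completion_iff)

lemma P_events_M: "a \<in> P.events \<Longrightarrow> a \<in> M.events" "a \<in> P.events \<Longrightarrow> M.prob a = P.prob a"
  by (simp_all add: M_def)

lemma P_measurable_M: "f \<in> measurable P N \<Longrightarrow> f \<in> measurable M N"
  unfolding M_def by (rule measurable_completion)

text \<open>The augmented past: events that agree almost surely with one generated by the counts up
  to \<open>u\<close>. All null sets are included.\<close>

definition H :: "real \<Rightarrow> (nat \<Rightarrow> real) set set" where
  "H u = {A \<in> M.events. \<exists>B\<in>sigma_sets UNIV (past u). AE \<omega> in M. \<omega> \<in> A \<longleftrightarrow> \<omega> \<in> B}"

lemma sigma_algebra_H: "sigma_algebra UNIV (H u)"
  unfolding sigma_algebra_iff2
proof (intro conjI ballI allI impI)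
  interpret G: sigma_algebra UNIV "sigma_sets UNIV (past u)" by (rule sigma_algebra_sigma_sets) auto
  show "H u \<subseteq> Pow UNIV" by auto
  show "{} \<in> H u" unfolding H_def by (intro CollectI conjI bexI[of _ "{}"]) auto
  show "UNIV - s \<in> H u" if "s \<in> H u" for s
  proof -
    from that obtain B where s: "s \<in> M.events" and B: "B \<in> sigma_sets UNIV (past u)" "AE \<omega> in M. \<omega> \<in> s \<longleftrightarrow> \<omega> \<in> B"
      unfolding H_def by blast
    have "UNIV - s \<in> M.events" using sets.compl_sets[OF s] by simp
    moreover have "UNIV - B \<in> sigma_sets UNIV (past u)" using G.compl_sets[OF B(1)] .
    ultimately show ?thesis unfolding H_def using B(2) by (intro CollectI conjI bexI[of _ "UNIV - B"]) auto
  qed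
  show "(\<Union>i. A i) \<in> H u" if A: "range A \<subseteq> H u" for A :: "nat \<Rightarrow> (nat \<Rightarrow> real) set"
  proof -
    have Ai: "A i \<in> H u" for i using A by blast
    have "\<exists>B\<in>sigma_sets UNIV (past u). AE \<omega> in M. \<omega> \<in> A i \<longleftrightarrow> \<omega> \<in> B" for i
      using Ai[of i] unfolding H_def mem_Collect_eq by (rule conjunct2)
    then obtain B where B: "\<And>i. B i \<in> sigma_sets UNIV (past u)" "\<And>i. AE \<omega> in M. \<omega> \<in> A i \<longleftrightarrow> \<omega> \<in> B i"
      by metis
    have "AE \<omega> in M. \<forall>i. \<omega> \<in> A i \<longleftrightarrow> \<omega> \<in> B i" using B(2) by (simp add: AE_all_countable)
    then have "AE \<omega> in M. \<omega> \<in> (\<Union>i. A i) \<longleftrightarrow> \<omega> \<in> (\<Union>i. B i)" by eventually_elim auto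
    moreover have "(\<Union>i. B i) \<in> sigma_sets UNIV (past u)" using B(1) by (intro G.countable_UN) auto
    moreover have "A i \<in> M.events" for i using Ai[of i] unfolding H_def mem_Collect_eq by (rule conjunct1)
    then have "(\<Union>i. A i) \<in> M.events" by (intro sets.countable_UN) auto
    ultimately show ?thesis
      unfolding H_def mem_Collect_eq by (intro conjI bexI[of _ "\<Union>i. B i"])
  qed
qed

text \<open>Intersecting over all u > t, also beyond \<open>T\<close>, builds in
  right-continuity.\<close>

definition F :: "real \<Rightarrow> (nat \<Rightarrow> real) measure" where
  "F t = sigma UNIV (\<Inter>u\<in>{t<..}. H u)"

lemma sigma_algebra_Inter_H: "sigma_algebra UNIV (\<Inter>u\<in>{t<..}. H u)"
proof -
  interpret H: sigma_algebra UNIV "H u" for u by (rule sigma_algebra_H)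
  show ?thesis
    unfolding sigma_algebra_iff2
  proof (intro conjI ballI allI impI)
    show "(\<Inter>u\<in>{t<..}. H u) \<subseteq> Pow UNIV" by auto
    show "{} \<in> (\<Inter>u\<in>{t<..}. H u)" by auto
    show "UNIV - s \<in> (\<Inter>u\<in>{t<..}. H u)" if "s \<in> (\<Inter>u\<in>{t<..}. H u)" for s
      using that by blast
    show "(\<Union>i. A i) \<in> (\<Inter>u\<in>{t<..}. H u)" if "range A \<subseteq> (\<Inter>u\<in>{t<..}. H u)" for A :: "nat \<Rightarrow> (nat \<Rightarrow> real) set"
    proof
      fix u assume "u \<in> {t<..}"
      then have "range A \<subseteq> H u" using that by blast
      then show "(\<Union>i. A i) \<in> H u" by (intro H.countable_UN) auto
    qed
  qed
qed

lemma sets_F: "sets (F t) = (\<Inter>u\<in>{t<..}. H u)"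
  unfolding F_def by (rule sigma_algebra.sets_measure_of_eq[OF sigma_algebra_Inter_H])

lemma space_F [simp]: "space (F t) = UNIV"
  unfolding F_def by (simp add: space_measure_of_conv)

lemma usual: "usual_conditions T M F"
  unfolding usual_conditions_def
proof (intro conjI ballI)
  show "prob_space M" by (rule M.prob_space_axioms)
  show "complete_measure M" unfolding M_def by (rule completion.complete_measure_axioms)
  show "subalgebra M (F t)" for t
    unfolding subalgebra_def sets_F H_def using gt_ex[of t] by auto
  show "sets (F s) \<subseteq> sets (F t)" if "t \<in> {s..T}" for s t
    unfolding sets_F using that by (intro INT_anti_mono) auto
  show "null_sets M \<subseteq> sets (F 0)"
  proof
    fix A assume A: "A \<in> null_sets M"
    from AE_not_in[OF A] have "AE \<omega> in M. \<omega> \<in> A \<longleftrightarrow> \<omega> \<in> {}" by eventually_elim auto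
    moreover have "A \<in> M.events" using A by auto
    ultimately show "A \<in> sets (F 0)"
      unfolding sets_F H_def by (auto intro: bexI[OF _ sigma_sets.Empty])
  qed
  show "sets (F t) = (\<Inter>s\<in>{t<..T}. sets (F s))" if t: "t \<in> {0..<T}" for t
  proof
    show "sets (F t) \<subseteq> (\<Inter>s\<in>{t<..T}. sets (F s))"
      unfolding sets_F by auto
    show "(\<Inter>s\<in>{t<..T}. sets (F s)) \<subseteq> sets (F t)"
    proof
      fix A assume A: "A \<in> (\<Inter>s\<in>{t<..T}. sets (F s))"
      have "A \<in> H u" if "t < u" for u
      proof -
        \<comment> \<open>The minimum keeps the intermediate time \<open>s\<close> in
          {t<..T}.\<close>
        have "t < min u T" using that t by auto
        then obtain s where "t < s" "s < min u T" using dense by blast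
        then have "A \<in> sets (F s)" using A by auto
        then show ?thesis using \<open>s < min u T\<close> by (auto simp: sets_F)
      qed
      then show "A \<in> sets (F t)" by (simp add: sets_F)
    qed
  qed
qed

end

section \<open>The Levy property\<close>

context jump_process
begin

lemma \<Phi>_event:
  assumes G: "\<And>m C. {\<omega>. N m \<omega> \<in> C} \<in> G" "G \<subseteq> Pow UNIV" and B: "B \<in> sets borel"
  shows "{\<omega>. \<Phi> (\<lambda>m. N m \<omega>) \<in> B} \<in> sigma_sets UNIV G"
proof -
  let ?S = "sigma UNIV G"
  have sets: "sets ?S = sigma_sets UNIV G" and space: "space ?S = UNIV"
    using G(2) by (auto simp: sets_measure_of space_measure_of_conv)
  have "N m \<in> measurable ?S (count_space UNIV)" for m
  proof (rule measurableI)
    fix C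
    have "N m -` C \<inter> space ?S = {\<omega>. N m \<omega> \<in> C}" unfolding space by auto
    then show "N m -` C \<inter> space ?S \<in> sets ?S" unfolding sets using G(1) by (simp add: sigma_sets.Basic)
  qed auto
  then have "(\<lambda>\<omega> m. N m \<omega>) \<in> measurable ?S (PiM UNIV (\<lambda>_. count_space UNIV))"
    by (intro measurable_PiM_single') auto
  then have "(\<lambda>\<omega>. \<Phi> (\<lambda>m. N m \<omega>)) \<in> borel_measurable ?S"
    by (rule measurable_compose[OF _ \<Phi>_measurable])
  from measurable_sets[OF this B] show ?thesis by (simp add: sets space vimage_def)
qed

lemma AE_X_eq_\<Phi>: "AE \<omega> in M. \<forall>s t. 0 \<le> s \<longrightarrow> s \<le> t \<longrightarrow> X t \<omega> - X s \<omega> = \<Phi> (\<lambda>m. Nc m s t \<omega>)"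
  unfolding AE_M_iff using AE_good by eventually_elim (simp add: X_diff JX_indicator)

lemma X_0: "X 0 \<omega> = 0"
  by (simp add: X_def JX_def Sf_def)

lemma X_adapted:
  assumes "0 \<le> t"
  shows "X t \<in> borel_measurable (F t)"
proof (rule measurableI)
  fix B :: "'b set" assume B: "B \<in> sets borel"
  have "X t -` B \<in> H u" if "t < u" for u
  proof -
    have "{\<omega>. \<Phi> (\<lambda>m. Nc m 0 t \<omega>) \<in> B} \<in> sigma_sets UNIV (past u)"
    proof (rule \<Phi>_event[OF _ _ B])
      fix m C
      have "{\<omega>. Nc m 0 t \<omega> \<in> C} = {\<omega>. \<forall>p\<in>{(m, t)}. Nc (fst p) 0 (snd p) \<omega> \<in> C}" by simp
      moreover have "finite {(m, t)}" "\<forall>p\<in>{(m, t)}. snd p \<le> u" using that by auto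
      ultimately show "{\<omega>. Nc m 0 t \<omega> \<in> C} \<in> past u" unfolding past_def by (intro CollectI exI conjI)
    qed auto
    moreover have "AE \<omega> in M. \<omega> \<in> X t -` B \<longleftrightarrow> \<omega> \<in> {\<omega>. \<Phi> (\<lambda>m. Nc m 0 t \<omega>) \<in> B}"
      using AE_X_eq_\<Phi>
    proof eventually_elim
      case (elim \<omega>)
      then have "X t \<omega> - X 0 \<omega> = \<Phi> (\<lambda>m. Nc m 0 t \<omega>)" using assms by blast
      then show ?case by (simp add: X_0)
    qed
    moreover have "X t -` B \<in> M.events"
      using measurable_sets[OF P_measurable_M[OF X_measurable] B] by simp
    ultimately show ?thesis unfolding H_def by (intro CollectI conjI bexI)
  qed
  then show "X t -` B \<inter> space (F t) \<in> sets (F t)" by (simp add: sets_F)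
qed simp

lemma sigma_past_events: "sigma_sets UNIV (past u) \<subseteq> P.events"
  using sets.sigma_sets_subset[OF past_events] by simp

lemma past_fut_indep:
  assumes "a \<in> sigma_sets UNIV (past u)" "b \<in> fut u t"
  shows "P.prob (a \<inter> b) = P.prob a * P.prob b"
proof -
  have "P.indep_set (past u) (fut u t)"
    unfolding P.indep_sets2_eq using past_events fut_events past_fut_prob by blast
  from P.indep_set_sigma_sets[OF this Int_stable_past Int_stable_fut]
  have "P.indep_set (sigma_sets UNIV (past u)) (sigma_sets UNIV (fut u t))" by simp
  from P.indep_setD[OF this assms(1) sigma_sets.Basic[OF assms(2)]] show ?thesis .
qed

text \<open>\<open>F s\<close> may be larger than the past up to \<open>s\<close>. For every v > s,
  however, \<open>a\<close> belongs to \<open>H v\<close> and is independent of the counts on (v,t];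
  as v decreases to s, these counts eventually equal those on (s,t].\<close>

lemma F_fut_prob:
  assumes "s < t" "a \<in> sets (F s)" "C \<in> fut s t"
  shows "M.prob (a \<inter> C) = M.prob a * M.prob C"
proof -
  obtain J B where C: "C = {\<omega>. \<forall>m\<in>J. Nc m s t \<omega> \<in> B m}" and J: "finite J"
    using assms(3) unfolding fut_def by blast
  define D where "D v = {\<omega>. \<forall>m\<in>J. Nc m v t \<omega> \<in> B m}" for v
  have D: "D v \<in> fut v t" for v unfolding D_def fut_def using J by blast
  then have DP: "D v \<in> P.events" for v using fut_events by blast
  have a: "a \<in> M.events"
    using assms(2) gt_ex[of s] unfolding sets_F H_def by auto
  have eq: "M.prob (a \<inter> D v) = M.prob a * M.prob (D v)" if "s < v" for v
  proof -
    have "a \<in> H v" using assms(2) that by (auto simp: sets_F)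
    then obtain a' where a': "a' \<in> sigma_sets UNIV (past v)" "AE \<omega> in M. \<omega> \<in> a \<longleftrightarrow> \<omega> \<in> a'"
      unfolding H_def by blast
    have a'P: "a' \<in> P.events" using a'(1) sigma_past_events by blast
    have "M.prob (a \<inter> D v) = M.prob (a' \<inter> D v)"
    proof (rule M.finite_measure_eq_AE)
      show "AE \<omega> in M. \<omega> \<in> a \<inter> D v \<longleftrightarrow> \<omega> \<in> a' \<inter> D v"
        using a'(2) by eventually_elim simp
    qed (intro sets.Int a P_events_M(1)[OF a'P] P_events_M(1)[OF DP])+
    also have "\<dots> = P.prob a' * P.prob (D v)"
      unfolding P_events_M(2)[OF sets.Int[OF a'P DP]] by (rule past_fut_indep[OF a'(1) D])
    also have "P.prob a' = M.prob a"
      unfolding P_events_M(2)[OF a'P, symmetric]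
    proof (rule M.finite_measure_eq_AE)
      show "AE \<omega> in M. \<omega> \<in> a' \<longleftrightarrow> \<omega> \<in> a"
        using a'(2) by eventually_elim simp
    qed (intro a P_events_M(1)[OF a'P])+
    finally show ?thesis using P_events_M(2)[OF DP] by simp
  qed
  define v where "v k = s + (t - s) / real (k + 2)" for k :: nat
  have vs: "s < v k" for k using assms(1) by (simp add: v_def)
  have "v \<longlonglongrightarrow> s + 0"
    unfolding v_def by (intro tendsto_add tendsto_const real_tendsto_divide_at_top[OF tendsto_const] filterlim_compose[OF filterlim_real_sequentially] filterlim_add_const_nat_at_top)
  then have v: "filterlim v (at_right s) sequentially"
    using vs by (intro filterlim_at_withinI) auto
  have ev: "\<forall>\<^sub>F k in sequentially. \<omega> \<in> D (v k) \<longleftrightarrow> \<omega> \<in> C" for \<omega>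
  proof -
    have "\<forall>\<^sub>F s' in at_right s. \<forall>m\<in>J. Nc m s' t \<omega> = Nc m s t \<omega>"
    proof (rule eventually_ball_finite[OF J], rule ballI)
      fix m show "\<forall>\<^sub>F s' in at_right s. Nc m s' t \<omega> = Nc m s t \<omega>"
        using eventually_Nc_right[where m=m and t=t and \<omega>=\<omega> and s=s] by eventually_elim simp
    qed
    then have "\<forall>\<^sub>F s' in at_right s. \<omega> \<in> D s' \<longleftrightarrow> \<omega> \<in> C"
      by eventually_elim (simp add: D_def C)
    then show ?thesis using v by (rule eventually_compose_filterlim)
  qed
  have CM: "C \<in> M.events" using assms(3) fut_events P_events_M(1) by blast
  have DM: "D v \<in> M.events" for v using DP P_events_M(1) by blast
  have "(\<lambda>k. M.prob (a \<inter> D (v k))) \<longlonglongrightarrow> M.prob (a \<inter> C)"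
  proof (rule M.prob_tendsto)
    show "\<forall>\<^sub>F k in sequentially. (\<omega> \<in> a \<inter> D (v k)) \<longleftrightarrow> (\<omega> \<in> a \<inter> C)" for \<omega>
      using ev[of \<omega>] by eventually_elim auto
  qed (use a CM DM in auto)
  moreover have "(\<lambda>k. M.prob a * M.prob (D (v k))) \<longlonglongrightarrow> M.prob a * M.prob C"
    by (intro tendsto_mult tendsto_const M.prob_tendsto) (use CM DM ev in auto)
  ultimately show ?thesis using eq[OF vs] by (simp add: LIMSEQ_unique)
qed

lemma X_indep_increments:
  assumes "0 \<le> s" "s \<le> t"
  shows "M.indep_set (sets (F s)) (sets (vimage_algebra (space M) (\<lambda>\<omega>. X t \<omega> - X s \<omega>) borel))"
proof -
  have Fs: "sets (F s) \<subseteq> M.events"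
    using gt_ex[of s] unfolding sets_F H_def by auto
  have V: "sets (vimage_algebra (space M) (\<lambda>\<omega>. X t \<omega> - X s \<omega>) borel) = {(\<lambda>\<omega>. X t \<omega> - X s \<omega>) -` A |A. A \<in> sets borel}"
    by (subst sets_vimage_algebra2) auto
  have meas: "(\<lambda>\<omega>. X t \<omega> - X s \<omega>) \<in> borel_measurable M"
    by (rule P_measurable_M) measurable
  have ev: "(\<lambda>\<omega>. X t \<omega> - X s \<omega>) -` A \<in> M.events" if "A \<in> sets borel" for A
    using measurable_sets[OF meas that] by simp
  have "M.prob (a \<inter> (\<lambda>\<omega>. X t \<omega> - X s \<omega>) -` A) = M.prob a * M.prob ((\<lambda>\<omega>. X t \<omega> - X s \<omega>) -` A)"
    if a: "a \<in> sets (F s)" and A: "A \<in> sets borel" for a A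
  proof (cases "s = t")
    case True
    then show ?thesis using M.prob_space by (cases "0 \<in> A") auto
  next
    case False
    then have "s < t" using assms by simp
    have aM: "a \<in> M.events" using a Fs by blast
    have fut: "fut s t \<subseteq> M.events" using fut_events P_events_M(1) by blast
    have Int: "Int_stable (sets (F s))" by (rule sets.Int_stable)
    have "M.indep_set (sets (F s)) (fut s t)"
      unfolding M.indep_sets2_eq using Fs fut F_fut_prob[OF \<open>s < t\<close>] by blast
    from M.indep_set_sigma_sets[OF this Int Int_stable_fut]
    have ind: "M.indep_set (sigma_sets UNIV (sets (F s))) (sigma_sets UNIV (fut s t))" by simp
    let ?b = "{\<omega>. \<Phi> (\<lambda>m. Nc m s t \<omega>) \<in> A}"
    have b: "?b \<in> sigma_sets UNIV (fut s t)"
    proof (rule \<Phi>_event[OF _ _ A])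
      fix m C
      have "{\<omega>. Nc m s t \<omega> \<in> C} = {\<omega>. \<forall>m\<in>{m}. Nc m s t \<omega> \<in> C}" by simp
      moreover have "finite {m}" by simp
      ultimately show "{\<omega>. Nc m s t \<omega> \<in> C} \<in> fut s t" unfolding fut_def by (intro CollectI exI conjI)
    qed auto
    have bM: "?b \<in> M.events"
      using b sets.sigma_sets_subset[OF fut] by auto
    have AE: "AE \<omega> in M. \<omega> \<in> (\<lambda>\<omega>. X t \<omega> - X s \<omega>) -` A \<longleftrightarrow> \<omega> \<in> ?b"
      using AE_X_eq_\<Phi>
    proof eventually_elim
      case (elim \<omega>)
      then have "X t \<omega> - X s \<omega> = \<Phi> (\<lambda>m. Nc m s t \<omega>)" using assms by blast
      then show ?case by simp
    qed
    have "M.prob (a \<inter> (\<lambda>\<omega>. X t \<omega> - X s \<omega>) -` A) = M.prob (a \<inter> ?b)"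
    proof (rule M.finite_measure_eq_AE)
      show "AE \<omega> in M. \<omega> \<in> a \<inter> (\<lambda>\<omega>. X t \<omega> - X s \<omega>) -` A \<longleftrightarrow> \<omega> \<in> a \<inter> ?b"
        using AE by eventually_elim simp
    qed (intro sets.Int aM bM ev[OF A])+
    also have "\<dots> = M.prob a * M.prob ?b"
      by (rule M.indep_setD[OF ind sigma_sets.Basic[OF a] b])
    also have "M.prob ?b = M.prob ((\<lambda>\<omega>. X t \<omega> - X s \<omega>) -` A)"
    proof (rule M.finite_measure_eq_AE)
      show "AE \<omega> in M. \<omega> \<in> ?b \<longleftrightarrow> \<omega> \<in> (\<lambda>\<omega>. X t \<omega> - X s \<omega>) -` A"
        using AE by eventually_elim simp
    qed (intro bM ev[OF A])+
    finally show ?thesis .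
  qed
  then show ?thesis
    unfolding M.indep_sets2_eq V using Fs ev by blast
qed

lemma distr_X_diff:
  assumes "0 \<le> s" "s \<le> t"
  shows "distr M borel (\<lambda>\<omega>. X t \<omega> - X s \<omega>)
    = distr (distr P (PiM UNIV (\<lambda>_. count_space UNIV)) (\<lambda>\<omega> m. Nc m s t \<omega>)) borel \<Phi>"
proof (rule measure_eqI)
  fix A assume "A \<in> sets (distr M borel (\<lambda>\<omega>. X t \<omega> - X s \<omega>))"
  then have A [measurable]: "A \<in> sets borel" by simp
  have meas: "(\<lambda>\<omega>. X t \<omega> - X s \<omega>) \<in> borel_measurable P" by measurable
  have "emeasure (distr M borel (\<lambda>\<omega>. X t \<omega> - X s \<omega>)) A = emeasure P ((\<lambda>\<omega>. X t \<omega> - X s \<omega>) -` A)"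
    using measurable_sets[OF meas A] by (subst emeasure_distr[OF P_measurable_M[OF meas] A]) (simp add: M_def)
  also have "\<dots> = emeasure P {\<omega>. \<Phi> (\<lambda>m. Nc m s t \<omega>) \<in> A}"
  proof (rule emeasure_eq_AE)
    show "AE \<omega> in P. \<omega> \<in> (\<lambda>\<omega>. X t \<omega> - X s \<omega>) -` A \<longleftrightarrow> \<omega> \<in> {\<omega>. \<Phi> (\<lambda>m. Nc m s t \<omega>) \<in> A}"
      using AE_X_eq_\<Phi>[unfolded AE_M_iff]
    proof eventually_elim
      case (elim \<omega>)
      then have "X t \<omega> - X s \<omega> = \<Phi> (\<lambda>m. Nc m s t \<omega>)" using assms by blast
      then show ?case by simp
    qed
    show "(\<lambda>\<omega>. X t \<omega> - X s \<omega>) -` A \<in> P.events" using measurable_sets[OF meas A] by simp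
    have "{\<omega>\<in>space P. \<Phi> (\<lambda>m. Nc m s t \<omega>) \<in> A} \<in> P.events" by measurable
    then show "{\<omega>. \<Phi> (\<lambda>m. Nc m s t \<omega>) \<in> A} \<in> P.events" by simp
  qed
  also have "\<dots> = emeasure (distr (distr P (PiM UNIV (\<lambda>_. count_space UNIV)) (\<lambda>\<omega> m. Nc m s t \<omega>)) borel \<Phi>) A"
    by (subst distr_distr) (auto simp: emeasure_distr comp_def vimage_def)
  finally show "emeasure (distr M borel (\<lambda>\<omega>. X t \<omega> - X s \<omega>)) A = \<dots>" .
qed simp

lemma X_diff_norm:
  assumes "0 \<le> s" "s \<le> t"
  shows "(\<integral>\<^sup>+\<omega>. ennreal (norm (X t \<omega> - X s \<omega>)) \<partial>P) \<le> ennreal (total_rate * (t - s))"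
proof -
  have "(\<integral>\<^sup>+\<omega>. ennreal (norm (X t \<omega> - X s \<omega>)) \<partial>P) \<le> ennreal total_rate * (\<integral>\<^sup>+x\<in>{0..T}. ennreal \<bar>indicat_real {s<..t} x\<bar> \<partial>lborel)"
    unfolding X_diff[OF assms] by (rule JX_norm[where b=1]) (auto simp: indicator_def)
  also have "(\<integral>\<^sup>+x\<in>{0..T}. ennreal \<bar>indicat_real {s<..t} x\<bar> \<partial>lborel) \<le> (\<integral>\<^sup>+x. indicator {s<..t} x \<partial>lborel)"
    by (intro nn_integral_mono) (auto simp: indicator_def)
  also have "\<dots> = ennreal (t - s)" using assms by simp
  finally show ?thesis
    using total_rate_nonneg by (simp add: ennreal_mult' mult_left_mono)
qed

text \<open>Markov's inequality for the L^1 bound of increments, giving continuity in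
  probability.\<close>

lemma X_prob_bound:
  assumes "0 \<le> s" "0 \<le> t" "0 < \<epsilon>"
  shows "M.prob {\<omega>\<in>space M. norm (X s \<omega> - X t \<omega>) > \<epsilon>} \<le> total_rate * \<bar>s - t\<bar> / \<epsilon>"
proof -
  have bd: "(\<integral>\<^sup>+\<omega>. ennreal (norm (X s \<omega> - X t \<omega>)) \<partial>P) \<le> ennreal (total_rate * \<bar>s - t\<bar>)"
    using X_diff_norm[of s t] X_diff_norm[of t s] assms by (cases "s \<le> t") (auto simp: norm_minus_commute)
  let ?A = "{\<omega>\<in>space P. norm (X s \<omega> - X t \<omega>) > \<epsilon>}"
  have A: "?A \<in> P.events" by measurable
  have "ennreal \<epsilon> * emeasure P ?A = (\<integral>\<^sup>+\<omega>. ennreal \<epsilon> * indicator ?A \<omega> \<partial>P)"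
    using A by (simp add: nn_integral_cmult)
  also have "\<dots> \<le> (\<integral>\<^sup>+\<omega>. ennreal (norm (X s \<omega> - X t \<omega>)) \<partial>P)"
    by (intro nn_integral_mono) (auto simp: indicator_def intro!: ennreal_leI)
  finally have "ennreal (\<epsilon> * P.prob ?A) \<le> ennreal (total_rate * \<bar>s - t\<bar>)"
    using bd assms by (simp add: P.emeasure_eq_measure ennreal_mult)
  then have "\<epsilon> * P.prob ?A \<le> total_rate * \<bar>s - t\<bar>"
    using total_rate_nonneg by (subst (asm) ennreal_le_iff) auto
  moreover have "M.prob {\<omega>\<in>space M. norm (X s \<omega> - X t \<omega>) > \<epsilon>} = P.prob ?A"
    using P_events_M(2)[OF A] by simp
  ultimately show ?thesis using assms by (simp add: field_simps)
qed

lemma levy: "levy_process T M F X"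
  unfolding levy_process_def
proof (intro conjI ballI allI impI)
  show "cadlag_on T (\<lambda>t. X t \<omega>)" for \<omega> by (rule X_cadlag)
  show "X t \<in> borel_measurable (F t)" if "t \<in> {0..T}" for t using that by (intro X_adapted) auto
  show "AE \<omega> in M. X 0 \<omega> = 0" by (simp add: X_0)
  show "M.indep_set (sets (F s)) (sets (vimage_algebra (space M) (\<lambda>\<omega>. X t \<omega> - X s \<omega>) borel))"
    if "s \<in> {0..T}" "t \<in> {s..T}" for s t
    using that by (intro X_indep_increments) auto
  show "distr M borel (\<lambda>\<omega>. X (s + h) \<omega> - X s \<omega>) = distr M borel (\<lambda>\<omega>. X h \<omega> - X 0 \<omega>)"
    if "0 \<le> s \<and> 0 \<le> h \<and> s + h \<le> T" for s h
    using that Nc_stationary[of s h] distr_X_diff[of s "s + h"] distr_X_diff[of 0 h] by simp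
  show "((\<lambda>s. M.prob {\<omega> \<in> space M. norm (X s \<omega> - X t \<omega>) > \<epsilon>}) \<longlongrightarrow> 0) (at t within {0..T})"
    if t: "t \<in> {0..T}" and \<epsilon>: "0 < \<epsilon>" for t \<epsilon>
  proof (rule tendsto_sandwich)
    show "\<forall>\<^sub>F s in at t within {0..T}. 0 \<le> M.prob {\<omega> \<in> space M. norm (X s \<omega> - X t \<omega>) > \<epsilon>}" by simp
    show "\<forall>\<^sub>F s in at t within {0..T}. M.prob {\<omega> \<in> space M. norm (X s \<omega> - X t \<omega>) > \<epsilon>} \<le> total_rate * \<bar>s - t\<bar> / \<epsilon>"
      unfolding eventually_at_filter using X_prob_bound[OF _ _ \<epsilon>] t by (intro always_eventually) auto
    show "((\<lambda>s. total_rate * \<bar>s - t\<bar> / \<epsilon>) \<longlongrightarrow> 0) (at t within {0..T})"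
      using \<epsilon> by (auto intro!: tendsto_eq_intros)
  qed simp
qed

lemma step_integral_eq_JX:
  assumes "step_nodes t n s"
  shows "step_integral X n s a \<omega> = JX (step_fun n s a) \<omega>"
proof -
  have nodes: "0 \<le> s j" if "j \<le> n" for j
    using that
  proof (induction j)
    case 0
    then show ?case using assms by (simp add: step_nodes_def)
  next
    case (Suc j)
    then have "0 \<le> s j" "s j \<le> s (Suc j)" using assms by (auto simp: step_nodes_def)
    then show ?case by linarith
  qed
  have "step_integral X n s a \<omega> = (\<Sum>j<n. a j *\<^sub>R JX (indicator {s j<..s (Suc j)}) \<omega>)"
    unfolding step_integral_def
    by (intro sum.cong refl, subst X_diff) (use nodes assms in \<open>auto simp: step_nodes_def\<close>)
  also have "\<dots> = JX (\<lambda>x. \<Sum>j<n. a j * indicator {s j<..s (Suc j)} x) \<omega>"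
    by (rule JX_sum[symmetric]) (simp add: indicator_def)
  finally show ?thesis by (simp add: step_fun_def[abs_def])
qed

end

section \<open>The Volterra integral\<close>

locale volterra_kernel = jump_process T rate w
  for T rate and w :: "nat \<Rightarrow> 'b::euclidean_space" +
  fixes \<kappa> :: "nat \<Rightarrow> real"
  assumes \<kappa>_nonneg: "0 \<le> \<kappa> j" and summable_\<kappa>: "summable (\<lambda>j. \<kappa> j / 2 ^ (j ^ 3))"
begin

abbreviation ell :: "nat \<Rightarrow> real" where
  "ell j \<equiv> 1 / 2 ^ (j ^ 3)"

definition wt :: "real \<Rightarrow> nat \<Rightarrow> real" where
  "wt t j = (if ell j \<le> t then digit_bump j t else 0)"

lemma wt_bounds: "0 \<le> wt t j" "wt t j \<le> 1"
  by (auto simp: wt_def digit_bump_bounds)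

text \<open>The full kernel may be unbounded near 0, while linearity of \<open>JX\<close> is
  available for bounded functions; truncations are the bridge.\<close>

definition partial_ker :: "nat \<Rightarrow> real \<Rightarrow> real \<Rightarrow> real" where
  "partial_ker J t s = (\<Sum>j<J. wt t j * \<kappa> j * indicator {0<..ell j} s)"

definition ker :: "real \<Rightarrow> real \<Rightarrow> real" where
  "ker t s = (\<Sum>j. wt t j * \<kappa> j * indicator {0<..ell j} s)"

definition z :: "real \<Rightarrow> (nat \<Rightarrow> real) \<Rightarrow> 'b" where
  "z t \<omega> = digit_path (\<lambda>j. \<kappa> j *\<^sub>R X (ell j) \<omega>) t"

text \<open>Bounds the L^1 norm of the kernel beyond its first \<open>J\<close> terms, uniformly in
  \<open>t\<close>; times \<open>total_rate\<close> it bounds the mean of the matching remainder of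
  \<open>z\<close>.\<close>

definition tail :: "nat \<Rightarrow> real" where
  "tail J = (\<Sum>j. \<kappa> (j + J) * ell (j + J))"

lemma summable_tail: "summable (\<lambda>j. \<kappa> (j + J) * ell (j + J))"
  using summable_\<kappa> by (subst summable_iff_shift[where f="\<lambda>j. \<kappa> j * ell j"]) simp

lemma tail_nonneg: "0 \<le> tail J"
  unfolding tail_def by (intro suminf_nonneg summable_tail) (simp add: \<kappa>_nonneg)

lemma tail_tendsto: "tail \<longlonglongrightarrow> 0"
proof -
  have s: "summable (\<lambda>j. \<kappa> j * ell j)" using summable_tail[of 0] by simp
  have eq: "tail J = (\<Sum>j. \<kappa> j * ell j) - (\<Sum>j<J. \<kappa> j * ell j)" for J
    using suminf_minus_initial_segment[OF s, of J] by (simp add: tail_def)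
  have "(\<lambda>J. (\<Sum>j. \<kappa> j * ell j) - (\<Sum>j<J. \<kappa> j * ell j)) \<longlonglongrightarrow> (\<Sum>j. \<kappa> j * ell j) - (\<Sum>j. \<kappa> j * ell j)"
    by (intro tendsto_diff tendsto_const summable_LIMSEQ s)
  then show ?thesis by (simp add: eq[abs_def])
qed

lemma wt_\<kappa>_le: "\<bar>wt t j * \<kappa> j\<bar> \<le> \<kappa> j"
  using wt_bounds[of t j] \<kappa>_nonneg[of j] by (simp add: abs_mult mult_left_le_one_le)

text \<open>For fixed s > 0 only finitely many of the shrinking intervals (0, ell j] contain
  \<open>s\<close>.\<close>

lemma ker_summable: "summable (\<lambda>j. wt t j * \<kappa> j * indicator {0<..ell j} s)"
proof (cases "s > 0")
  case True
  then obtain n where n: "(1 / 2) ^ n < s" using real_arch_pow_inv[of s "1/2"] by auto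
  have "indicat_real {0<..ell j} s = 0" if "n \<le> j" for j
  proof -
    have "j \<le> j ^ 3" by (cases "j = 0") (auto intro!: self_le_power)
    then have "(1 / 2 :: real) ^ (j ^ 3) \<le> (1 / 2) ^ n" using that by (intro power_decreasing) auto
    with n show ?thesis by (simp add: power_one_over)
  qed
  then show ?thesis by (intro summable_finite[of "{..<n}"]) (auto simp: not_less)
qed simp

lemma ker_measurable [measurable]: "ker t \<in> borel_measurable borel"
  unfolding ker_def[abs_def] by measurable

lemma partial_ker_measurable [measurable]: "partial_ker J t \<in> borel_measurable borel"
  unfolding partial_ker_def[abs_def] by measurable

lemma ker_tail: "(\<integral>\<^sup>+x. ennreal \<bar>ker t x - partial_ker J t x\<bar> \<partial>lborel) \<le> ennreal (tail J)"
proof -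
  let ?\<tau> = "\<lambda>j x. wt t j * \<kappa> j * indicator {0<..ell j} x"
  have nn: "0 \<le> ?\<tau> j x" for j x using wt_bounds \<kappa>_nonneg by simp
  have eq: "ennreal \<bar>ker t x - partial_ker J t x\<bar> = (\<Sum>j. ennreal (?\<tau> (j + J) x))" for x
  proof -
    have s: "summable (\<lambda>j. ?\<tau> (j + J) x)" using ker_summable[of t x] by (subst summable_iff_shift)
    have "ker t x - partial_ker J t x = (\<Sum>j. ?\<tau> (j + J) x)"
      unfolding ker_def partial_ker_def using suminf_minus_initial_segment[OF ker_summable[of t x], of J] by simp
    moreover have "0 \<le> (\<Sum>j. ?\<tau> (j + J) x)" by (rule suminf_nonneg[OF s nn])
    ultimately show ?thesis by (simp add: suminf_ennreal2[OF nn s])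
  qed
  have "(\<integral>\<^sup>+x. ennreal \<bar>ker t x - partial_ker J t x\<bar> \<partial>lborel) = (\<Sum>j. (\<integral>\<^sup>+x. ennreal (?\<tau> (j + J) x) \<partial>lborel))"
    unfolding eq by (rule nn_integral_suminf) measurable
  also have "\<dots> \<le> (\<Sum>j. ennreal (\<kappa> (j + J) * ell (j + J)))"
  proof (intro suminf_le)
    fix j
    have "(\<integral>\<^sup>+x. ennreal (?\<tau> (j + J) x) \<partial>lborel) \<le> (\<integral>\<^sup>+x. ennreal (\<kappa> (j + J)) * indicator {0<..ell (j + J)} x \<partial>lborel)"
      using wt_\<kappa>_le[of t "j + J"] by (intro nn_integral_mono) (auto simp: indicator_def intro!: ennreal_leI)
    also have "\<dots> = ennreal (\<kappa> (j + J)) * ennreal (ell (j + J))"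
      by (subst nn_integral_cmult_indicator) auto
    finally show "(\<integral>\<^sup>+x. ennreal (?\<tau> (j + J) x) \<partial>lborel) \<le> ennreal (\<kappa> (j + J) * ell (j + J))"
      by (simp only: ennreal_mult'[OF \<kappa>_nonneg])
  qed auto
  also have "\<dots> = ennreal (tail J)"
    unfolding tail_def by (rule suminf_ennreal2[OF _ summable_tail]) (simp add: \<kappa>_nonneg)
  finally show ?thesis .
qed

lemma X_ell_norm: "(\<integral>\<^sup>+\<omega>. ennreal (norm (\<kappa> j *\<^sub>R X (ell j) \<omega>)) \<partial>P) \<le> ennreal (total_rate * (\<kappa> j * ell j))"
proof -
  have "(\<integral>\<^sup>+\<omega>. ennreal (norm (\<kappa> j *\<^sub>R X (ell j) \<omega>)) \<partial>P) = ennreal (\<kappa> j) * (\<integral>\<^sup>+\<omega>. ennreal (norm (X (ell j) \<omega>)) \<partial>P)"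
    by (subst nn_integral_cmult[symmetric]) (auto simp: \<kappa>_nonneg ennreal_mult' intro!: nn_integral_cong)
  also have "\<dots> \<le> ennreal (\<kappa> j) * ennreal (total_rate * ell j)"
    using X_diff_norm[of 0 "ell j"] by (intro mult_left_mono) (auto simp: X_0)
  also have "\<dots> = ennreal (total_rate * (\<kappa> j * ell j))"
    using \<kappa>_nonneg total_rate_nonneg by (simp add: ennreal_mult'[symmetric] mult_ac)
  finally show ?thesis .
qed

lemma X_ell_tail: "(\<integral>\<^sup>+\<omega>. (\<Sum>j. ennreal (norm (\<kappa> (j + J) *\<^sub>R X (ell (j + J)) \<omega>))) \<partial>P) \<le> ennreal (total_rate * tail J)"
proof -
  have "(\<integral>\<^sup>+\<omega>. (\<Sum>j. ennreal (norm (\<kappa> (j + J) *\<^sub>R X (ell (j + J)) \<omega>))) \<partial>P)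
      = (\<Sum>j. (\<integral>\<^sup>+\<omega>. ennreal (norm (\<kappa> (j + J) *\<^sub>R X (ell (j + J)) \<omega>)) \<partial>P))"
    by (rule nn_integral_suminf) measurable
  also have "\<dots> \<le> (\<Sum>j. ennreal (total_rate * (\<kappa> (j + J) * ell (j + J))))"
    by (intro suminf_le X_ell_norm) auto
  also have "\<dots> = ennreal (total_rate * tail J)"
    unfolding tail_def suminf_mult[OF summable_tail, symmetric]
    by (rule suminf_ennreal2[OF _ summable_mult[OF summable_tail]]) (simp add: \<kappa>_nonneg total_rate_nonneg)
  finally show ?thesis .
qed

text \<open>The series of norms has finite mean. This also supplies the summability assumed in
  \<open>digit_path_blocks\<close>.\<close>

lemma AE_summable_X: "AE \<omega> in P. summable (\<lambda>j. norm (\<kappa> j *\<^sub>R X (ell j) \<omega>))"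
proof -
  have "(\<integral>\<^sup>+\<omega>. (\<Sum>j. ennreal (norm (\<kappa> j *\<^sub>R X (ell j) \<omega>))) \<partial>P) \<noteq> \<infinity>"
    using X_ell_tail[of 0] by (auto simp: top_unique)
  then have "AE \<omega> in P. (\<Sum>j. ennreal (norm (\<kappa> j *\<^sub>R X (ell j) \<omega>))) \<noteq> \<infinity>"
    by (intro nn_integral_PInf_AE) auto
  then show ?thesis
    by eventually_elim (rule summable_suminf_not_top, auto)
qed

lemma z_measurable [measurable]: "z t \<in> borel_measurable P"
  unfolding z_def[abs_def] digit_path_def by measurable

lemma z_tail: "(\<integral>\<^sup>+\<omega>. ennreal (norm (JX (partial_ker J t) \<omega> - z t \<omega>)) \<partial>P) \<le> ennreal (total_rate * tail J)"
proof -
  have "(\<integral>\<^sup>+\<omega>. ennreal (norm (JX (partial_ker J t) \<omega> - z t \<omega>)) \<partial>P)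
    \<le> (\<integral>\<^sup>+\<omega>. (\<Sum>j. ennreal (norm (\<kappa> (j + J) *\<^sub>R X (ell (j + J)) \<omega>))) \<partial>P)"
  proof (rule nn_integral_mono_AE)
    show "AE \<omega> in P. ennreal (norm (JX (partial_ker J t) \<omega> - z t \<omega>)) \<le> (\<Sum>j. ennreal (norm (\<kappa> (j + J) *\<^sub>R X (ell (j + J)) \<omega>)))"
      using AE_summable_X
    proof eventually_elim
      case (elim \<omega>)
      let ?x = "\<lambda>j. \<kappa> j *\<^sub>R X (ell j) \<omega>"
      have le: "norm (wt t j *\<^sub>R ?x j) \<le> norm (?x j)" for j
      proof -
        have "\<bar>wt t j\<bar> * norm (?x j) \<le> norm (?x j)"
          using wt_bounds[of t j] by (intro mult_left_le_one_le) auto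
        then show ?thesis unfolding norm_scaleR .
      qed
      have s: "summable (\<lambda>j. norm (wt t j *\<^sub>R ?x j))"
        by (rule summable_comparison_test[OF _ elim]) (use le in auto)
      have s1: "summable (\<lambda>j. norm (?x (j + J)))" using elim by (subst summable_iff_shift[where f="\<lambda>j. norm (?x j)"])
      have s2: "summable (\<lambda>j. norm (wt t (j + J) *\<^sub>R ?x (j + J)))"
        using s by (subst summable_iff_shift[where f="\<lambda>j. norm (wt t j *\<^sub>R ?x j)"])
      have "JX (partial_ker J t) \<omega> = (\<Sum>j<J. (wt t j * \<kappa> j) *\<^sub>R JX (indicator {0<..ell j}) \<omega>)"
        unfolding partial_ker_def[abs_def] by (rule JX_sum) (simp add: indicator_def)
      then have 1: "JX (partial_ker J t) \<omega> = (\<Sum>j<J. wt t j *\<^sub>R ?x j)" by (simp add: X_def)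
      have "z t \<omega> = (\<Sum>j. wt t j *\<^sub>R ?x j)" by (simp add: z_def digit_path_def wt_def)
      also have "\<dots> = (\<Sum>j. wt t (j + J) *\<^sub>R ?x (j + J)) + (\<Sum>j<J. wt t j *\<^sub>R ?x j)"
        by (rule suminf_split_initial_segment[OF summable_norm_cancel[OF s]])
      finally have "norm (JX (partial_ker J t) \<omega> - z t \<omega>) = norm (\<Sum>j. wt t (j + J) *\<^sub>R ?x (j + J))"
        using 1 by simp
      also have "\<dots> \<le> (\<Sum>j. norm (wt t (j + J) *\<^sub>R ?x (j + J)))" by (rule summable_norm[OF s2])
      also have "\<dots> \<le> (\<Sum>j. norm (?x (j + J)))" by (rule suminf_le[OF le s2 s1])
      finally show ?case
        using suminf_ennreal2[OF norm_ge_zero s1] by (simp add: ennreal_leI)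
    qed
  qed
  also have "\<dots> \<le> ennreal (total_rate * tail J)" by (rule X_ell_tail)
  finally show ?thesis .
qed

text \<open>\<open>JX_norm\<close> extended to the unbounded kernel, with \<open>z t\<close> as its
  integral: insert a truncation, apply \<open>JX_norm\<close> to the bounded difference, and let the
  truncation error vanish.\<close>

lemma JX_minus_z:
  assumes [measurable]: "g \<in> borel_measurable borel" and b: "\<And>x. \<bar>g x\<bar> \<le> b"
  shows "(\<integral>\<^sup>+\<omega>. ennreal (norm (JX g \<omega> - z t \<omega>)) \<partial>P) \<le> ennreal total_rate * (\<integral>\<^sup>+x\<in>{0..T}. ennreal \<bar>ker t x - g x\<bar> \<partial>lborel)"
proof (rule ennreal_le_epsilon)
  let ?A = "\<integral>\<^sup>+x\<in>{0..T}. ennreal \<bar>ker t x - g x\<bar> \<partial>lborel"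
  fix e :: real assume "0 < e"
  \<comment> \<open>One tail is the distance between the kernels, the other that between the
    integrals.\<close>
  have "(\<lambda>J. 2 * (total_rate * tail J)) \<longlonglongrightarrow> 2 * (total_rate * 0)"
    by (intro tendsto_mult tendsto_const tail_tendsto)
  then have "\<forall>\<^sub>F J in sequentially. 2 * (total_rate * tail J) < e"
    using \<open>0 < e\<close> by (intro order_tendstoD) auto
  then obtain J where J: "2 * (total_rate * tail J) < e" by (auto simp: eventually_sequentially)
  let ?p = "partial_ker J t"
  have pb: "\<bar>?p x\<bar> \<le> (\<Sum>j<J. \<kappa> j)" for x
    unfolding partial_ker_def
    by (intro order.trans[OF sum_abs] sum_mono) (use wt_\<kappa>_le[of t] \<kappa>_nonneg in \<open>auto simp: indicator_def\<close>)
  have diff_b: "\<bar>g x - ?p x\<bar> \<le> b + (\<Sum>j<J. \<kappa> j)" for x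
    using b[of x] pb[of x] by linarith
  have "(\<integral>\<^sup>+\<omega>. ennreal (norm (JX g \<omega> - z t \<omega>)) \<partial>P)
    \<le> (\<integral>\<^sup>+\<omega>. ennreal (norm (JX (\<lambda>x. g x - ?p x) \<omega>)) + ennreal (norm (JX ?p \<omega> - z t \<omega>)) \<partial>P)"
  proof (rule nn_integral_mono)
    fix \<omega>
    have "JX g \<omega> - z t \<omega> = JX (\<lambda>x. g x - ?p x) \<omega> + (JX ?p \<omega> - z t \<omega>)"
      using JX_diff[where f=g and b=b and g="?p" and c="\<Sum>j<J. \<kappa> j" and \<omega>=\<omega>, OF b pb] by simp
    then have "norm (JX g \<omega> - z t \<omega>) \<le> norm (JX (\<lambda>x. g x - ?p x) \<omega>) + norm (JX ?p \<omega> - z t \<omega>)"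
      by (metis norm_triangle_ineq)
    then show "ennreal (norm (JX g \<omega> - z t \<omega>)) \<le> ennreal (norm (JX (\<lambda>x. g x - ?p x) \<omega>)) + ennreal (norm (JX ?p \<omega> - z t \<omega>))"
      by (simp add: ennreal_leI flip: ennreal_plus)
  qed
  also have "\<dots> = (\<integral>\<^sup>+\<omega>. ennreal (norm (JX (\<lambda>x. g x - ?p x) \<omega>)) \<partial>P) + (\<integral>\<^sup>+\<omega>. ennreal (norm (JX ?p \<omega> - z t \<omega>)) \<partial>P)"
    by (rule nn_integral_add) measurable
  also have "\<dots> \<le> ennreal total_rate * (\<integral>\<^sup>+x\<in>{0..T}. ennreal \<bar>g x - ?p x\<bar> \<partial>lborel) + ennreal (total_rate * tail J)"
    by (intro add_mono JX_norm[where b="b + (\<Sum>j<J. \<kappa> j)"] z_tail diff_b) measurable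
  also have "(\<integral>\<^sup>+x\<in>{0..T}. ennreal \<bar>g x - ?p x\<bar> \<partial>lborel) \<le> ?A + ennreal (tail J)"
  proof -
    have "(\<integral>\<^sup>+x\<in>{0..T}. ennreal \<bar>g x - ?p x\<bar> \<partial>lborel) \<le> (\<integral>\<^sup>+x. ennreal \<bar>ker t x - g x\<bar> * indicator {0..T} x + ennreal \<bar>ker t x - ?p x\<bar> \<partial>lborel)"
      by (intro nn_integral_mono) (auto simp: indicator_def intro!: ennreal_leI simp flip: ennreal_plus)
    also have "\<dots> = ?A + (\<integral>\<^sup>+x. ennreal \<bar>ker t x - ?p x\<bar> \<partial>lborel)"
    proof (rule nn_integral_add)
      have [measurable]: "ker t \<in> borel_measurable lborel" "g \<in> borel_measurable lborel" "?p \<in> borel_measurable lborel"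
        using ker_measurable[of t] partial_ker_measurable[of J t] assms(1) by simp_all
      show "(\<lambda>x. ennreal \<bar>ker t x - g x\<bar> * indicator {0..T} x) \<in> borel_measurable lborel"
        by (intro borel_measurable_times_ennreal measurable_compose[OF _ measurable_ennreal] borel_measurable_abs borel_measurable_diff) simp_all
      show "(\<lambda>x. ennreal \<bar>ker t x - ?p x\<bar>) \<in> borel_measurable lborel"
        by (intro measurable_compose[OF _ measurable_ennreal] borel_measurable_abs borel_measurable_diff) simp_all
    qed
    also have "\<dots> \<le> ?A + ennreal (tail J)" by (intro add_left_mono ker_tail)
    finally show ?thesis .
  qed
  also have "ennreal total_rate * (?A + ennreal (tail J)) + ennreal (total_rate * tail J)
    = ennreal total_rate * ?A + ennreal (2 * (total_rate * tail J))"
  proof -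
    have "0 \<le> total_rate * tail J" using total_rate_nonneg tail_nonneg by simp
    then have "ennreal (2 * (total_rate * tail J)) = ennreal (total_rate * tail J) + ennreal (total_rate * tail J)"
      by (simp flip: ennreal_plus)
    then show ?thesis
      using total_rate_nonneg by (simp add: distrib_left ennreal_mult' add.assoc)
  qed
  also have "\<dots> \<le> ennreal total_rate * ?A + ennreal e"
    using J by (intro add_left_mono ennreal_leI) auto
  finally show "(\<integral>\<^sup>+\<omega>. ennreal (norm (JX g \<omega> - z t \<omega>)) \<partial>P) \<le> ennreal total_rate * ?A + ennreal e"
    by (simp add: mult_left_mono add_right_mono)
qed

lemma ker_eq_0: "t < s \<Longrightarrow> ker t s = 0"
proof -
  assume "t < s"
  then have "wt t j * \<kappa> j * indicator {0<..ell j} s = 0" for j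
    by (auto simp: wt_def indicator_def)
  then show ?thesis unfolding ker_def by (simp only: suminf_zero)
qed

lemma integrable_ker: "integrable lborel (ker t)"
proof (rule integrableI_bounded)
  have "(\<integral>\<^sup>+x. ennreal (norm (ker t x)) \<partial>lborel) \<le> ennreal (tail 0)"
    using ker_tail[of t 0] by (simp add: partial_ker_def)
  then show "(\<integral>\<^sup>+x. ennreal (norm (ker t x)) \<partial>lborel) < \<infinity>" by (rule le_less_trans) simp
qed simp

lemma in_Lp_ker: "in_Lp (restrict_space lborel {0..t}) 1 (ker t)"
  unfolding in_Lp_def
proof
  show "ker t \<in> borel_measurable (restrict_space lborel {0..t})"
    by (rule measurable_restrict_space1) simp
  have "set_integrable lborel {0..t} (\<lambda>x. norm (ker t x))"
    unfolding set_integrable_def by (intro integrable_mult_indicator integrable_norm integrable_ker) auto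
  then show "integrable (restrict_space lborel {0..t}) (\<lambda>x. norm (ker t x) powr 1)"
    by (subst integrable_restrict_space) (auto simp: set_integrable_def)
qed

lemma integrable_MI:
  assumes [measurable]: "Y \<in> borel_measurable P" and "(\<integral>\<^sup>+\<omega>. ennreal (norm (Y \<omega>)) \<partial>P) < \<infinity>"
  shows "in_Lp M 1 Y"
proof -
  have "integrable P Y" using assms by (intro integrableI_bounded) auto
  then have "integrable M Y" unfolding M_def by (subst integrable_completion) auto
  then show ?thesis using P_measurable_M[OF assms(1)] by (simp add: in_Lp_def)
qed

lemma step_fun_measurable [measurable]: "step_fun n s a \<in> borel_measurable borel"
  unfolding step_fun_def[abs_def] by measurable

lemma step_fun_bound: "\<bar>step_fun n s a x\<bar> \<le> (\<Sum>j<n. \<bar>a j\<bar>)"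
  unfolding step_fun_def
  by (intro order.trans[OF sum_abs] sum_mono) (auto simp: indicator_def)

lemma step_fun_eq_0:
  assumes "step_nodes t n s" "t < x"
  shows "step_fun n s a x = 0"
proof -
  have mono: "s j \<le> s n" if "j \<le> n" for j
    using that
  proof (induction rule: inc_induct)
    case (step k)
    then have "s k \<le> s (Suc k)" using assms(1) by (auto simp: step_nodes_def)
    then show ?case using step by linarith
  qed simp
  have zero: "a j * indicator {s j<..s (Suc j)} x = 0" if "j < n" for j
    using mono[of "Suc j"] that assms by (auto simp: step_nodes_def indicator_def)
  show ?thesis
    unfolding step_fun_def by (rule sum.neutral, rule ballI, rule zero) simp
qed

text \<open>\<open>JX_minus_z\<close> for step functions dominates the L^1 distance of the integrals
  by that of the integrands, whichever approximating sequence is given.\<close>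

lemma is_integral_z:
  assumes t: "t \<in> {0..T}"
  shows "is_integral M X 1 1 t (ker t) (z t)"
  unfolding is_integral_def
proof (intro allI impI)
  fix n :: "nat \<Rightarrow> nat" and s a :: "nat \<Rightarrow> nat \<Rightarrow> real"
  assume "(\<forall>m. step_nodes t (n m) (s m)) \<and>
    (\<lambda>m. LINT u:{0..t}|lborel. \<bar>ker t u - step_fun (n m) (s m) (a m) u\<bar> powr 1) \<longlonglongrightarrow> 0"
  then have nodes: "\<And>m. step_nodes t (n m) (s m)"
    and lim: "(\<lambda>m. LINT u:{0..t}|lborel. \<bar>ker t u - step_fun (n m) (s m) (a m) u\<bar> powr 1) \<longlonglongrightarrow> 0" by auto
  let ?g = "\<lambda>m. step_fun (n m) (s m) (a m)"
  let ?L = "\<lambda>m. LINT u:{0..t}|lborel. \<bar>ker t u - ?g m u\<bar> powr 1"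
  have SJ: "step_integral X (n m) (s m) (a m) = JX (?g m)" for m
    using step_integral_eq_JX[OF nodes] by auto
  have z_fin: "(\<integral>\<^sup>+\<omega>. ennreal (norm (z t \<omega>)) \<partial>P) < \<infinity>"
  proof -
    \<comment> \<open>The empty truncation integrates to 0, so \<open>z_tail\<close> bounds the mean
      norm of \<open>z t\<close> itself.\<close>
    have "JX (partial_ker 0 t) \<omega> = 0" for \<omega>
      by (simp add: partial_ker_def[abs_def] JX_def Sf_def)
    then show ?thesis using z_tail[of 0 t] by (simp add: le_less_trans[OF _ ennreal_less_top])
  qed
  have g_fin: "(\<integral>\<^sup>+\<omega>. ennreal (norm (JX (?g m) \<omega>)) \<partial>P) < \<infinity>" for m
  proof -
    let ?b = "\<Sum>j<n m. \<bar>a m j\<bar>"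
    have "(\<integral>\<^sup>+x\<in>{0..T}. ennreal \<bar>?g m x\<bar> \<partial>lborel) \<le> (\<integral>\<^sup>+x. ennreal ?b * indicator {0..T} x \<partial>lborel)"
      by (intro nn_integral_mono) (auto simp: indicator_def intro!: ennreal_leI step_fun_bound)
    also have "\<dots> = ennreal ?b * ennreal T" using T_pos by (subst nn_integral_cmult_indicator) auto
    finally have "ennreal total_rate * (\<integral>\<^sup>+x\<in>{0..T}. ennreal \<bar>?g m x\<bar> \<partial>lborel) \<le> ennreal total_rate * (ennreal ?b * ennreal T)"
      by (rule mult_left_mono) simp
    also have "\<dots> < \<infinity>" by (simp add: ennreal_mult_less_top)
    finally show ?thesis using JX_norm[of "?g m" ?b] step_fun_bound by (auto intro: le_less_trans)
  qed
  have bound: "(\<integral>\<omega>. norm (JX (?g m) \<omega> - z t \<omega>) \<partial>M) \<le> total_rate * ?L m" for m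
  proof (rule integral_real_bounded)
    have set_int: "integrable lborel (\<lambda>u. indicator {0..t} u *\<^sub>R (\<bar>ker t u - ?g m u\<bar> powr 1))"
    proof -
      have "integrable lborel (\<lambda>u. indicator {0..t} u *\<^sub>R ?g m u)"
        by (rule integrableI_bounded_set_indicator[where B="\<Sum>j<n m. \<bar>a m j\<bar>"]) (auto simp: step_fun_bound emeasure_lborel_Icc_eq)
      moreover have "integrable lborel (\<lambda>u. indicator {0..t} u *\<^sub>R ker t u)"
        by (intro integrable_mult_indicator integrable_ker) auto
      ultimately have "integrable lborel (\<lambda>u. norm (indicator {0..t} u *\<^sub>R ker t u - indicator {0..t} u *\<^sub>R ?g m u))"
        by (intro integrable_norm Bochner_Integration.integrable_diff)
      also have "(\<lambda>u. norm (indicator {0..t} u *\<^sub>R ker t u - indicator {0..t} u *\<^sub>R ?g m u)) = (\<lambda>u. indicator {0..t} u *\<^sub>R (\<bar>ker t u - ?g m u\<bar> powr 1))"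
        by (auto simp: indicator_def)
      finally show ?thesis .
    qed
    have L0: "0 \<le> ?L m" unfolding set_lebesgue_integral_def by (intro Bochner_Integration.integral_nonneg) simp
    then show "0 \<le> total_rate * ?L m" using total_rate_nonneg by simp
    have "(\<integral>\<^sup>+x\<in>{0..T}. ennreal \<bar>ker t x - ?g m x\<bar> \<partial>lborel) \<le> (\<integral>\<^sup>+u. ennreal (indicator {0..t} u *\<^sub>R (\<bar>ker t u - ?g m u\<bar> powr 1)) \<partial>lborel)"
    \<comment> \<open>Beyond \<open>t\<close> both the kernel and the step function vanish, so
      integration over {0..T} reduces to {0..t}.\<close>
    proof (intro nn_integral_mono)
      fix u
      show "ennreal \<bar>ker t u - ?g m u\<bar> * indicator {0..T} u \<le> ennreal (indicator {0..t} u *\<^sub>R (\<bar>ker t u - ?g m u\<bar> powr 1))"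
        using ker_eq_0[of t u] step_fun_eq_0[OF nodes[of m], of u "a m"] by (cases "t < u") (auto simp: indicator_def)
    qed
    also have "\<dots> = ennreal (?L m)"
      unfolding set_lebesgue_integral_def by (rule nn_integral_eq_integral[OF set_int]) simp
    finally have "(\<integral>\<^sup>+\<omega>. ennreal (norm (JX (?g m) \<omega> - z t \<omega>)) \<partial>P) \<le> ennreal total_rate * ennreal (?L m)"
      using JX_minus_z[OF step_fun_measurable step_fun_bound, of "n m" "s m" "a m" t]
      by (meson mult_left_mono order_trans zero_le)
    then show "(\<integral>\<^sup>+\<omega>. ennreal (norm (JX (?g m) \<omega> - z t \<omega>)) \<partial>M) \<le> ennreal (total_rate * ?L m)"
      unfolding M_def nn_integral_completion using total_rate_nonneg by (simp add: ennreal_mult')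
  qed
  show "tendsto_Lp M 1 (\<lambda>m. step_integral X (n m) (s m) (a m)) (z t)"
    unfolding tendsto_Lp_def SJ
  proof (intro conjI allI)
    show "in_Lp M 1 (JX (?g m))" for m by (rule integrable_MI[OF _ g_fin]) measurable
    show "in_Lp M 1 (z t)" by (rule integrable_MI[OF _ z_fin]) measurable
    have "(\<lambda>m. total_rate * ?L m) \<longlonglongrightarrow> total_rate * 0" by (intro tendsto_mult tendsto_const lim)
    then have "(\<lambda>m. \<integral>\<omega>. norm (JX (?g m) \<omega> - z t \<omega>) \<partial>M) \<longlonglongrightarrow> 0"
    proof -
      assume up: "(\<lambda>m. total_rate * ?L m) \<longlonglongrightarrow> total_rate * 0"
      show ?thesis
      proof (rule tendsto_sandwich[OF always_eventually always_eventually tendsto_const])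
        show "\<forall>m. 0 \<le> (\<integral>\<omega>. norm (JX (?g m) \<omega> - z t \<omega>) \<partial>M)"
          by (intro allI Bochner_Integration.integral_nonneg norm_ge_zero)
        show "\<forall>m. (\<integral>\<omega>. norm (JX (?g m) \<omega> - z t \<omega>) \<partial>M) \<le> total_rate * ?L m"
          by (intro allI bound)
        show "(\<lambda>m. total_rate * ?L m) \<longlonglongrightarrow> 0"
          using up by simp
      qed
    qed
    then show "(\<lambda>m. \<integral>\<omega>. norm (JX (?g m) \<omega> - z t \<omega>) powr 1 \<partial>M) \<longlonglongrightarrow> 0" by simp
  qed
qed

lemma volterra: "volterra_levy_process T M F X ker z"
  unfolding volterra_levy_process_def
proof (intro conjI exI ballI)
  show "usual_conditions T M F" by (rule usual)
  show "levy_process T M F X" by (rule levy)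
  show "in_Lp (restrict_space lborel {0..t}) 1 (ker t)" for t by (rule in_Lp_ker)
  show "is_integral M X 1 1 t (ker t) (z t)" if "t \<in> {0..T}" for t by (rule is_integral_z[OF that])
qed auto

lemma measurable_z: "measurable_process T M z"
proof -
  have [measurable]: "digit_bump j \<in> borel_measurable (restrict_space borel {0..T})" for j
    by (rule measurable_restrict_space1) simp
  have [measurable]: "(\<lambda>t. t) \<in> borel_measurable (restrict_space borel {0..T})"
    by (rule measurable_restrict_space1) simp
  have [measurable]: "X t \<in> borel_measurable M" for t by (rule P_measurable_M) measurable
  have [measurable]: "Measurable.pred (restrict_space borel {0..T}) (\<lambda>t. ell j \<le> t)" for j by measurable
  show ?thesis
    unfolding measurable_process_def z_def digit_path_def split_beta' by measurable
qed

end

section \<open>The concrete process\<close>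

text \<open>The exponents behind \<open>dev_rate\<close>: the first inequality makes jumps of a
  slower process m < j before ell j improbable, the second makes those of the faster processes m > j
  negligible. The surplus m + j gives geometric decay in both indices.\<close>

lemma power_sum_exponent_bound:
  fixes m j :: nat
  shows "m < j \<Longrightarrow> m ^ 3 + m + (m + j) \<le> j ^ 3"
    and "j < m \<Longrightarrow> 2 * j ^ 2 + j + (m + j) \<le> 2 * m ^ 2"
proof -
  have le: "a \<le> b * c" if "a \<le> b" "0 < c" for a b c :: nat
    using mult_le_mono[of a b 1 c] that by simp
  show "m ^ 3 + m + (m + j) \<le> j ^ 3" if "m < j"
  proof -
    from that obtain a where a: "j = m + a" "0 < a" using less_imp_add_positive by blast
    have "j ^ 3 = m ^ 3 + 3 * (m ^ 2 * a) + 3 * (m * a ^ 2) + a * (a * a)"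
      unfolding a(1) power3_eq_cube power2_eq_square by (simp only: distrib_left distrib_right) simp
    moreover have "m \<le> m * a ^ 2" "a \<le> a * (a * a)" using a(2) by (auto intro!: le)
    ultimately show ?thesis using a(1) by linarith
  qed
  show "2 * j ^ 2 + j + (m + j) \<le> 2 * m ^ 2" if "j < m"
  proof -
    from that obtain a where a: "m = j + a" "0 < a" using less_imp_add_positive by blast
    have "2 * m ^ 2 = 2 * j ^ 2 + 4 * (j * a) + 2 * (a * a)"
      unfolding a(1) power2_eq_square by (simp only: distrib_left distrib_right) simp
    moreover have "j \<le> j * a" "a \<le> a * a" using a(2) by (auto intro!: le)
    ultimately show ?thesis using a(1) by linarith
  qed
qed

text \<open>The hypothesis makes \<open>p\<close> of order at most n^(1/3), so a quadratic in
  \<open>p\<close> is o(n). This lets inverse matrices with entries 2^O(p^2) satisfy the growth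
  condition.\<close>

lemma quadratic_le_cubic:
  fixes K \<delta> :: real
  assumes "0 \<le> K" "0 < \<delta>"
  shows "\<exists>C. \<forall>p n :: nat. (p = 0 \<or> (p - 1) ^ 3 < n) \<longrightarrow> K * (real p + 1) ^ 2 \<le> C + \<delta> * real n"
proof -
  \<comment> \<open>Above this threshold r = p - 1 satisfies p + 1 \<le> 3 r and 9 K r^2 \<le>
    \<delta> r^3 \<le> \<delta> n; below it a constant suffices.\<close>
  define R where "R = 9 * K / \<delta> + 1"
  have R: "0 \<le> R" using assms by (simp add: R_def)
  have "K * (real p + 1) ^ 2 \<le> K * (R + 2) ^ 2 + \<delta> * real n" if p: "p = 0 \<or> (p - 1) ^ 3 < n" for p n :: nat
  proof (cases "real p \<le> R + 1")
    case True
    then have "K * (real p + 1) ^ 2 \<le> K * (R + 2) ^ 2"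
      using assms R by (intro mult_left_mono power_mono) auto
    moreover have "0 \<le> \<delta> * real n" using assms by simp
    ultimately show ?thesis by linarith
  next
    case False
    define r where "r = p - 1"
    have rp: "real p = real r + 1" "real r > R" using False R by (auto simp: r_def)
    have "R \<ge> 1" using assms by (simp add: R_def)
    then have r1: "1 \<le> real r" using rp by linarith
    have "9 * K \<le> \<delta> * real r" using rp(2) assms by (simp add: R_def field_simps)
    have "K * (real p + 1) ^ 2 \<le> K * (3 * real r) ^ 2"
      unfolding rp using assms r1 by (intro mult_left_mono power_mono) auto
    also have "\<dots> = 9 * K * (real r) ^ 2" by (simp add: power2_eq_square)
    also have "\<dots> \<le> \<delta> * real r * (real r) ^ 2"
      by (rule mult_right_mono[OF \<open>9 * K \<le> \<delta> * real r\<close>]) simp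
    also have "\<dots> = \<delta> * real (r ^ 3)" by (simp add: power3_eq_cube power2_eq_square)
    also have "\<dots> \<le> \<delta> * real n"
    proof (intro mult_left_mono of_nat_mono)
      have "p \<noteq> 0" using rp r1 by auto
      then show "r ^ 3 \<le> n" using p by (simp add: r_def)
    qed (use assms in auto)
    finally have "K * (real p + 1) ^ 2 \<le> \<delta> * real n" .
    moreover have "0 \<le> K * (R + 2) ^ 2" using assms by simp
    ultimately show ?thesis by linarith
  qed
  then show ?thesis by (intro exI[of _ "K * (R + 2) ^ 2"] allI impI)
qed

text \<open>The lower bound gives injectivity; applied to the columns of the inverse, it bounds
  their norms by 1 / c.\<close>

lemma matrix_inverse_bound:
  fixes A :: "real^'n::finite^'n"
  assumes c: "0 < c" "\<And>x. c * norm x \<le> norm (A *v x)"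
  obtains B where "A ** B = mat 1" "B ** A = mat 1" "\<And>i j. \<bar>B$i$j\<bar> \<le> 1 / c"
proof -
  have "\<forall>x. A *v x = 0 \<longrightarrow> x = 0"
  proof (intro allI impI)
    fix x assume "A *v x = 0"
    then have "c * norm x \<le> 0" using c(2)[of x] by simp
    then show "x = 0" using c(1) by (simp add: mult_le_0_iff)
  qed
  then obtain B where BA: "B ** A = mat 1"
    using matrix_left_invertible_ker[of A] by blast
  then have AB: "A ** B = mat 1" by (simp add: matrix_left_right_inverse)
  have "\<bar>B$i$j\<bar> \<le> 1 / c" for i j
  proof -
    have "B$i$j = (B *v axis j 1)$i" by (simp add: matrix_vector_mult_basis column_def)
    then have "\<bar>B$i$j\<bar> \<le> norm (B *v axis j 1)" by (simp add: component_le_norm_cart)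
    also have "\<dots> \<le> 1 / c"
      using c(2)[of "B *v axis j 1"] c(1) AB by (simp add: matrix_vector_mul_assoc field_simps)
    finally show ?thesis .
  qed
  with AB BA show ?thesis by (rule that)
qed

section \<open>Choice of rates, jump sizes and kernel weights\<close>

locale concrete_process =
  fixes T :: real and e :: "'n::finite \<Rightarrow> nat"
  assumes T_pos: "0 < T" and bij_e: "bij_betw e UNIV {..<CARD('n)}"
begin

text \<open>With d = CARD('n), the indices d q, ..., d q + d - 1 point in all d directions, once
  each.\<close>

definition \<iota> :: "nat \<Rightarrow> 'n" where
  "\<iota> m = inv e (m mod CARD('n))"

text \<open>The mean number of jumps of process \<open>m\<close> up to time ell j \<le> T is 2^(m^3
  + m - j^3): it equals 2^j for m = j and is tiny for m < j.\<close>

definition rate :: "nat \<Rightarrow> real" where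
  "rate m = 2 ^ (m ^ 3 + m)"

text \<open>Smaller than 1 / rate by a factor 2^-(2 m^2), which makes the expected total jump length
  finite and the processes m > j negligible against the \<open>j\<close>-th at time ell j.\<close>

definition size :: "nat \<Rightarrow> real" where
  "size m = 1 / 2 ^ (2 * m ^ 2 + m ^ 3 + m)"

definition w :: "nat \<Rightarrow> real^'n" where
  "w m = size m *\<^sub>R axis (\<iota> m) 1"

text \<open>Cancels the cubic part of \<open>size j\<close>, except for a factor 2^-j that keeps the
  kernel integrable.\<close>

definition \<kappa> :: "nat \<Rightarrow> real" where
  "\<kappa> j = 2 ^ (j ^ 3) / 2 ^ j"

lemma size_pos: "0 < size m"
  by (simp add: size_def)

lemma norm_w: "norm (w m) = size m"
  using size_pos[of m] by (simp add: w_def)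

lemma rate_size: "rate m * size m = 1 / 2 ^ (2 * m ^ 2)"
  by (simp add: rate_def size_def power_add)

sublocale volterra_kernel T rate w \<kappa>
proof
  show "0 < T" by (rule T_pos)
  show "0 < rate m" for m by (simp add: rate_def)
  show "0 \<le> \<kappa> j" for j by (simp add: \<kappa>_def)
  have "summable (\<lambda>m. (1 / 2 :: real) ^ m)" by (simp add: summable_geometric)
  then show "summable (\<lambda>j. \<kappa> j / 2 ^ (j ^ 3))"
    by (simp add: \<kappa>_def power_one_over)
  show "summable (\<lambda>m. rate m * norm (w m))"
  proof (rule summable_comparison_test[OF _ \<open>summable (\<lambda>m. (1 / 2 :: real) ^ m)\<close>])
    have "(1 / 2 :: real) ^ (2 * m ^ 2) \<le> (1 / 2) ^ m" for m
      by (rule power_decreasing) (auto simp: power2_eq_square intro: order.trans[OF le_square])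
    then show "\<exists>N. \<forall>n\<ge>N. norm (rate n * norm (w n)) \<le> (1 / 2) ^ n"
      by (simp add: norm_w rate_size power_one_over)
  qed
qed

text \<open>For m < j the weight is 1, because a sum below 1 then forces the integer count to be 0;
  for m > j it is the relative jump size. Process \<open>j\<close> itself is the signal and gets
  weight 0.\<close>

definition dev :: "nat \<Rightarrow> nat \<Rightarrow> real" where
  "dev j m = (if m < j then 1 else if j < m then size m / size j else 0)"

lemma dev_nonneg: "0 \<le> dev j m"
  using size_pos by (auto simp: dev_def intro: less_imp_le)

lemma dev_rate: "dev j m * (rate m * ell j) \<le> (1 / 2) ^ m * (1 / 2) ^ j"
proof -
  have le: "(2::real) ^ a / 2 ^ b \<le> (1 / 2) ^ m * (1 / 2) ^ j" if "a + (m + j) \<le> b" for a b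
  proof -
    have "(2::real) ^ a * 2 ^ (m + j) \<le> 2 ^ b" using that by (simp flip: power_add)
    then show ?thesis by (simp add: power_one_over power_add field_simps)
  qed
  consider "m < j" | "j < m" | "m = j" by linarith
  then show ?thesis
  proof cases
    case 1
    with le[OF power_sum_exponent_bound(1)[OF 1]] show ?thesis
      by (simp add: dev_def rate_def)
  next
    case 2
    have "dev j m * (rate m * ell j) = rate m * size m * (ell j / size j)"
      using 2 by (simp add: dev_def mult_ac)
    also have "ell j / size j = 2 ^ (2 * j ^ 2 + j)"
      by (simp add: size_def power_add)
    finally show ?thesis
      using le[OF power_sum_exponent_bound(2)[OF 2]] by (simp add: rate_size)
  qed (simp add: dev_def)
qed

lemma nn_integral_Nc: "(\<integral>\<^sup>+\<omega>. ennreal (real (Nc m 0 (ell j) \<omega>)) \<partial>P) \<le> ennreal (rate m * ell j)"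
proof -
  have "(\<integral>\<^sup>+\<omega>. ennreal (real (Nc m 0 (ell j) \<omega>)) \<partial>P) = ennreal (rate m) * (\<integral>\<^sup>+x\<in>{0..T}. ennreal (indicat_real {0<..ell j} x) \<partial>lborel)"
    unfolding Sf_indicator[OF order_refl, symmetric] by (rule campbell) auto
  also have "(\<integral>\<^sup>+x\<in>{0..T}. ennreal (indicat_real {0<..ell j} x) \<partial>lborel) \<le> (\<integral>\<^sup>+x. indicator {0<..ell j} x \<partial>lborel)"
    by (intro nn_integral_mono) (auto simp: indicator_def)
  also have "\<dots> = ennreal (ell j)" by simp
  finally show ?thesis
    by (simp only: ennreal_mult'[OF less_imp_le[OF rate_pos]] mult_left_mono zero_le)
qed

text \<open>\<open>W j\<close> dominates the distance of \<open>X (ell j)\<close> from the positive multiples of \<open>size j\<close> in direction \<open>\<iota> j\<close>,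
  in units of \<open>size j\<close>.\<close>

definition W :: "nat \<Rightarrow> (nat \<Rightarrow> real) \<Rightarrow> ennreal" where
  "W j \<omega> = indicator {\<omega>. ell j \<le> T \<and> Nc j 0 (ell j) \<omega> = 0} \<omega> + (\<Sum>m. ennreal (dev j m * real (Nc m 0 (ell j) \<omega>)))"

lemma W_measurable [measurable]: "W j \<in> borel_measurable P"
  unfolding W_def[abs_def] indicator_def by measurable

text \<open>Process \<open>j\<close> has no jump up to ell j with probability exp(-2^j) \<le> 2^-j;
  the geometric series over \<open>m\<close> from \<open>dev_rate\<close> contributes the other 2 in
  the constant 3.\<close>

lemma nn_integral_W: "(\<integral>\<^sup>+\<omega>. W j \<omega> \<partial>P) \<le> ennreal (3 * (1 / 2) ^ j)"
proof -
  let ?A = "{\<omega>. ell j \<le> T \<and> Nc j 0 (ell j) \<omega> = 0}"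
  have A [measurable]: "?A \<in> P.events"
  proof -
    have "{\<omega>\<in>space P. ell j \<le> T \<and> Nc j 0 (ell j) \<omega> = 0} \<in> P.events" by measurable
    then show ?thesis by simp
  qed
  have "emeasure P ?A \<le> ennreal ((1 / 2) ^ j)"
  proof (cases "ell j \<le> T")
    case True
    have "P.prob ?A = exp (- (2 ^ j))"
      using True Nc_prob[of 0 "ell j" j 0] by (simp add: poisson_mass_def rate_def power_add)
    also have "\<dots> \<le> (1 / 2) ^ j"
    proof -
      have "(2::real) ^ j \<le> exp (2 ^ j)" using exp_ge_add_one_self[of "2 ^ j :: real"] by linarith
      then show ?thesis by (simp add: exp_minus power_one_over inverse_eq_divide frac_le)
    qed
    finally show ?thesis by (simp add: P.emeasure_eq_measure ennreal_leI)
  qed simp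
  moreover have "(\<integral>\<^sup>+\<omega>. (\<Sum>m. ennreal (dev j m * real (Nc m 0 (ell j) \<omega>))) \<partial>P) \<le> ennreal (2 * (1 / 2) ^ j)"
  proof -
    have "(\<integral>\<^sup>+\<omega>. (\<Sum>m. ennreal (dev j m * real (Nc m 0 (ell j) \<omega>))) \<partial>P)
        = (\<Sum>m. (\<integral>\<^sup>+\<omega>. ennreal (dev j m * real (Nc m 0 (ell j) \<omega>)) \<partial>P))"
      by (rule nn_integral_suminf) measurable
    also have "\<dots> \<le> (\<Sum>m. ennreal ((1 / 2) ^ m * (1 / 2) ^ j))"
    proof (intro suminf_le)
      fix m
      have "(\<integral>\<^sup>+\<omega>. ennreal (dev j m * real (Nc m 0 (ell j) \<omega>)) \<partial>P) = ennreal (dev j m) * (\<integral>\<^sup>+\<omega>. ennreal (real (Nc m 0 (ell j) \<omega>)) \<partial>P)"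
        by (subst nn_integral_cmult[symmetric]) (auto simp: ennreal_mult' dev_nonneg intro!: nn_integral_cong)
      also have "\<dots> \<le> ennreal (dev j m) * ennreal (rate m * ell j)"
        by (intro mult_left_mono nn_integral_Nc) simp
      also have "\<dots> = ennreal (dev j m * (rate m * ell j))" by (simp only: ennreal_mult'[OF dev_nonneg])
      also have "\<dots> \<le> ennreal ((1 / 2) ^ m * (1 / 2) ^ j)" by (rule ennreal_leI[OF dev_rate])
      finally show "(\<integral>\<^sup>+\<omega>. ennreal (dev j m * real (Nc m 0 (ell j) \<omega>)) \<partial>P) \<le> \<dots>" .
    qed auto
    also have "\<dots> = ennreal (\<Sum>m. (1 / 2) ^ m * (1 / 2) ^ j)"
      by (rule suminf_ennreal2) (auto intro: summable_mult2)
    also have "(\<Sum>m. (1 / 2 :: real) ^ m * (1 / 2) ^ j) = 2 * (1 / 2) ^ j"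
      using suminf_mult2[of "\<lambda>m. (1 / 2 :: real) ^ m" "(1 / 2) ^ j"] suminf_geometric[of "1 / 2 :: real"] by simp
    finally show ?thesis .
  qed
  moreover have "(\<integral>\<^sup>+\<omega>. W j \<omega> \<partial>P) = emeasure P ?A + (\<integral>\<^sup>+\<omega>. (\<Sum>m. ennreal (dev j m * real (Nc m 0 (ell j) \<omega>))) \<partial>P)"
    unfolding W_def by (subst nn_integral_add) auto
  ultimately have "(\<integral>\<^sup>+\<omega>. W j \<omega> \<partial>P) \<le> ennreal ((1 / 2) ^ j) + ennreal (2 * (1 / 2) ^ j)"
    by (simp only: add_mono)
  also have "\<dots> = ennreal (3 * (1 / 2) ^ j)" by (subst ennreal_plus[symmetric]) auto
  finally show ?thesis .
qed

text \<open>Borel-Cantelli in summed form: the means of \<open>W j\<close> are summable, so the sum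
  of the \<open>W j\<close> is almost surely finite and its terms tend to 0.\<close>

lemma AE_W_small:
  assumes "0 < \<eta>"
  shows "AE \<omega> in P. \<forall>\<^sub>F j in sequentially. W j \<omega> < ennreal \<eta>"
proof -
  have "(\<integral>\<^sup>+\<omega>. (\<Sum>j. W j \<omega>) \<partial>P) = (\<Sum>j. (\<integral>\<^sup>+\<omega>. W j \<omega> \<partial>P))"
    by (rule nn_integral_suminf) measurable
  also have "\<dots> \<le> (\<Sum>j. ennreal (3 * (1 / 2) ^ j))"
    by (intro suminf_le nn_integral_W) auto
  also have "\<dots> = ennreal (\<Sum>j. 3 * (1 / 2) ^ j)"
    by (rule suminf_ennreal2) (auto intro: summable_mult)
  finally have "(\<integral>\<^sup>+\<omega>. (\<Sum>j. W j \<omega>) \<partial>P) \<noteq> \<infinity>" by (auto simp: top_unique)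
  then have "AE \<omega> in P. (\<Sum>j. W j \<omega>) \<noteq> \<infinity>"
    by (intro nn_integral_PInf_AE) measurable
  then show ?thesis
  proof eventually_elim
    case (elim \<omega>)
    have fin: "W j \<omega> < top" for j
      using elim sum_le_suminf[of "\<lambda>j. W j \<omega>" "{j}"] by (auto simp: less_top top_unique)
    then have W: "W j \<omega> = ennreal (enn2real (W j \<omega>))" for j by simp
    have "summable (\<lambda>j. enn2real (W j \<omega>))"
      using elim fin by (intro summable_suminf_not_top) auto
    then have "(\<lambda>j. enn2real (W j \<omega>)) \<longlonglongrightarrow> 0" by (rule summable_LIMSEQ_zero)
    then have "\<forall>\<^sub>F j in sequentially. enn2real (W j \<omega>) < \<eta>" using assms by (rule order_tendstoD)
    then show ?case
    proof eventually_elim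
      case (elim j)
      then show ?case using assms by (subst W) (simp add: ennreal_lessI)
    qed
  qed
qed

text \<open>W j < 1 forces at least one jump of process \<open>j\<close> and, counts being integers,
  none of the processes m < j. Besides the jumps of process \<open>j\<close> only those of m > j
  remain, and \<open>dev\<close> measures them in units of \<open>size j\<close>.\<close>

lemma W_small_imp:
  assumes g: "good \<omega>" and W: "W j \<omega> < ennreal \<eta>" and \<eta>: "\<eta> \<le> 1" and T: "ell j \<le> T"
  obtains N where "1 \<le> N" "norm (X (ell j) \<omega> - (real N * size j) *\<^sub>R axis (\<iota> j) 1) \<le> \<eta> * size j"
proof -
  let ?N = "\<lambda>m. Nc m 0 (ell j) \<omega>"
  have le: "(\<Sum>m. ennreal (dev j m * real (?N m))) \<le> W j \<omega>" by (simp add: W_def)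
  have "W j \<omega> < 1" using W \<eta> by (meson ennreal_le_1 order_less_le_trans)
  have "?N j \<noteq> 0"
  proof
    assume "?N j = 0"
    then have "1 \<le> W j \<omega>" using T by (simp add: W_def)
    with \<open>W j \<omega> < 1\<close> show False by simp
  qed
  have dev_le: "ennreal (dev j m * real (?N m)) < 1" for m
  proof -
    have "ennreal (dev j m * real (?N m)) = (\<Sum>m\<in>{m}. ennreal (dev j m * real (?N m)))" by simp
    also have "\<dots> \<le> (\<Sum>m. ennreal (dev j m * real (?N m)))" by (rule sum_le_suminf) auto
    also note le
    also note \<open>W j \<omega> < 1\<close>
    finally show ?thesis .
  qed
  have zero: "?N m = 0" if "m < j" for m
    using dev_le[of m] that by (simp add: dev_def)
  have s: "summable (\<lambda>m. dev j m * real (?N m))"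
    using le W by (intro summable_suminf_not_top) (auto simp: dev_nonneg top_unique)
  have "ennreal (\<Sum>m. dev j m * real (?N m)) = (\<Sum>m. ennreal (dev j m * real (?N m)))"
    by (rule suminf_ennreal2[symmetric, OF _ s]) (simp add: dev_nonneg)
  also note le
  also note W
  finally have "ennreal (\<Sum>m. dev j m * real (?N m)) < ennreal \<eta>" .
  then have sum_less: "(\<Sum>m. dev j m * real (?N m)) < \<eta>"
    by (meson ennreal_leI not_less)
  have sX: "summable (\<lambda>m. norm (real (?N m) *\<^sub>R w m))"
    using JX_summable[where f="indicator {0<..ell j}" and b=1 and \<omega>=\<omega>] g by (simp add: Sf_indicator indicator_def)
  let ?D = "\<lambda>m. if m = j then 0 else real (?N m) *\<^sub>R w m"
  \<comment> \<open>For m < j both sides are 0, so the weight 1 in place of the true ratio of sizes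
    does no harm.\<close>
  have nD: "norm (?D m) = size j * (dev j m * real (?N m))" for m
    using zero[of m] size_pos[of j] size_pos[of m] by (auto simp: dev_def norm_w)
  have sD: "summable (\<lambda>m. norm (?D m))" unfolding nD by (rule summable_mult[OF s])
  have "X (ell j) \<omega> = (\<Sum>m. real (?N m) *\<^sub>R w m)"
    using JX_indicator[of 0 \<omega> "ell j"] g by (simp add: X_def \<Phi>_def)
  also have "\<dots> = (\<Sum>m. ?D m + (if m = j then real (?N j) *\<^sub>R w j else 0))"
    by (intro arg_cong[where f=suminf]) auto
  also have "\<dots> = (\<Sum>m. ?D m) + (\<Sum>m. if m = j then real (?N j) *\<^sub>R w j else 0)"
    by (intro suminf_add[symmetric] summable_norm_cancel[OF sD] sums_summable[OF sums_single])
  also have "(\<Sum>m. if m = j then real (?N j) *\<^sub>R w j else 0) = real (?N j) *\<^sub>R w j"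
    by (rule sums_unique[symmetric, OF sums_single])
  finally have X: "X (ell j) \<omega> = (\<Sum>m. ?D m) + real (?N j) *\<^sub>R w j" .
  have "(real (?N j) * size j) *\<^sub>R axis (\<iota> j) 1 = real (?N j) *\<^sub>R w j" by (simp add: w_def)
  then have "X (ell j) \<omega> - (real (?N j) * size j) *\<^sub>R axis (\<iota> j) 1 = (\<Sum>m. ?D m)"
    unfolding X by simp
  then have "norm (X (ell j) \<omega> - (real (?N j) * size j) *\<^sub>R axis (\<iota> j) 1) \<le> (\<Sum>m. norm (?D m))"
    using summable_norm[OF sD] by simp
  also have "\<dots> = size j * (\<Sum>m. dev j m * real (?N m))"
    unfolding nD by (rule suminf_mult[OF s])
  also have "\<dots> \<le> \<eta> * size j" using sum_less size_pos[of j] by (simp add: mult.commute)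
  finally show ?thesis using \<open>?N j \<noteq> 0\<close> by (intro that[of "?N j"]) auto
qed

text \<open>The cubic exponents cancel; the quadratic that is left can be absorbed by
  \<open>quadratic_le_cubic\<close>.\<close>

lemma \<kappa>_size: "\<kappa> j * size j = 1 / 2 ^ (2 * j + 2 * j ^ 2)"
proof -
  have "2 * j ^ 2 + j ^ 3 + j + j = j ^ 3 + (2 * j + 2 * j ^ 2)" by simp
  then have "(2::real) ^ j * 2 ^ (2 * j ^ 2 + j ^ 3 + j) = 2 ^ (j ^ 3) * 2 ^ (2 * j + 2 * j ^ 2)"
    by (simp only: power_add[symmetric]) (simp add: add_ac)
  then show ?thesis by (simp add: \<kappa>_def size_def field_simps)
qed

text \<open>Diagonal dominance. Column \<open>i\<close> is c i * N i times an axis vector, up to an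
  error of norm at most c i / (2 d) with d = CARD('n). Hence \<open>x\<close> is mapped to y plus an
  error of norm at most |y| / 2, while |y| is at least the smallest c i times |x|. The 1 in the
  exponent is the lost factor 2.\<close>

lemma block_lower_bound:
  fixes q :: nat
  defines "s i \<equiv> CARD('n) * q + e i"
  assumes X: "\<And>j. CARD('n) * q \<le> j \<Longrightarrow> \<exists>N\<ge>1::nat. norm (X (ell j) \<omega> - (real N * size j) *\<^sub>R axis (\<iota> j) 1)
      \<le> 1 / (2 * real CARD('n)) * size j"
  shows "1 / 2 ^ (1 + 2 * (CARD('n) * (q + 1)) + 2 * (CARD('n) * (q + 1)) ^ 2) * norm x
    \<le> norm ((\<chi> a i. (\<kappa> (s i) *\<^sub>R X (ell (s i)) \<omega>) $ a) *v x)"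
proof -
  let ?d = "CARD('n)" and ?J = "CARD('n) * (q + 1)"
  have e_less: "e i < ?d" for i using bij_e by (auto simp: bij_betw_def)
  have inj_e: "inj e" using bij_e by (simp add: bij_betw_def)
  have \<iota>: "\<iota> (s i) = i" for i using e_less[of i] inj_e by (simp add: \<iota>_def s_def)
  have "\<exists>N\<ge>1::nat. norm (X (ell (s i)) \<omega> - (real N * size (s i)) *\<^sub>R axis i 1) \<le> 1 / (2 * real ?d) * size (s i)" for i
    using X[of "s i"] \<iota>[of i] by (simp add: s_def)
  then obtain N where N: "\<And>i. 1 \<le> N i"
      "\<And>i. norm (X (ell (s i)) \<omega> - (real (N i) * size (s i)) *\<^sub>R axis i 1) \<le> 1 / (2 * real ?d) * size (s i)"
    by metis
  define c where "c i = \<kappa> (s i) * size (s i)" for i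
  define E where "E i = X (ell (s i)) \<omega> - (real (N i) * size (s i)) *\<^sub>R axis i 1" for i
  \<comment> \<open>Collects the main terms. The counts N i \<ge> 1 have no upper bound but can only
    enlarge it, so the errors are compared with \<open>y\<close>.\<close>
  define y where "y = (\<chi> i. x$i * (c i * real (N i)))"
  have c_ge: "1 / 2 ^ (2 * ?J + 2 * ?J ^ 2) \<le> c i" for i
  proof -
    have "s i \<le> ?J" using e_less[of i] by (simp add: s_def)
    then have "2 * s i + 2 * s i ^ 2 \<le> 2 * ?J + 2 * ?J ^ 2" by (intro add_mono mult_left_mono power_mono) auto
    then have "(2::real) ^ (2 * s i + 2 * s i ^ 2) \<le> 2 ^ (2 * ?J + 2 * ?J ^ 2)" by (intro power_increasing) auto
    then show ?thesis unfolding c_def \<kappa>_size by (intro divide_left_mono) auto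
  qed
  have c_pos: "0 < c i" for i by (simp add: c_def \<kappa>_size)
  have "(\<chi> a i. (\<kappa> (s i) *\<^sub>R X (ell (s i)) \<omega>) $ a) *v x = (\<Sum>i\<in>UNIV. x$i *\<^sub>R (\<kappa> (s i) *\<^sub>R X (ell (s i)) \<omega>))"
    by (simp add: vec_eq_iff matrix_vector_mult_def sum_component mult_ac)
  also have "\<dots> = (\<Sum>i\<in>UNIV. y$i *\<^sub>R axis i 1 + (x$i * \<kappa> (s i)) *\<^sub>R E i)"
    by (intro sum.cong refl) (simp add: y_def E_def c_def scaleR_right_diff_distrib mult_ac)
  also have "\<dots> = y + (\<Sum>i\<in>UNIV. (x$i * \<kappa> (s i)) *\<^sub>R E i)"
    using basis_expansion[of y] by (simp add: sum.distrib scalar_mult_eq_scaleR)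
  finally have A: "(\<chi> a i. (\<kappa> (s i) *\<^sub>R X (ell (s i)) \<omega>) $ a) *v x = y + (\<Sum>i\<in>UNIV. (x$i * \<kappa> (s i)) *\<^sub>R E i)" .
  have "norm (\<Sum>i\<in>UNIV. (x$i * \<kappa> (s i)) *\<^sub>R E i) \<le> (\<Sum>i\<in>(UNIV::'n set). norm y / (2 * real ?d))"
  proof (rule sum_norm_le)
    fix i
    have "norm ((x$i * \<kappa> (s i)) *\<^sub>R E i) = \<bar>x$i\<bar> * \<kappa> (s i) * norm (E i)"
      by (simp add: abs_mult \<kappa>_nonneg)
    also have "\<dots> \<le> \<bar>x$i\<bar> * \<kappa> (s i) * (1 / (2 * real ?d) * size (s i))"
      using N(2)[of i] \<kappa>_nonneg[of "s i"] by (intro mult_left_mono) (auto simp: E_def)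
    also have "\<dots> = \<bar>x$i\<bar> * (c i * 1) / (2 * real ?d)" by (simp add: c_def)
    also have "\<dots> \<le> \<bar>x$i\<bar> * (c i * real (N i)) / (2 * real ?d)"
      using N(1)[of i] c_pos[of i] by (intro divide_right_mono mult_left_mono) auto
    also have "\<dots> = \<bar>y$i\<bar> / (2 * real ?d)" using c_pos[of i] by (simp add: y_def abs_mult)
    also have "\<dots> \<le> norm y / (2 * real ?d)" by (intro divide_right_mono component_le_norm_cart) simp
    finally show "norm ((x$i * \<kappa> (s i)) *\<^sub>R E i) \<le> norm y / (2 * real ?d)" .
  qed
  then have "norm (\<Sum>i\<in>UNIV. (x$i * \<kappa> (s i)) *\<^sub>R E i) \<le> norm y / 2" by simp
  then have "norm y / 2 \<le> norm (y + (\<Sum>i\<in>UNIV. (x$i * \<kappa> (s i)) *\<^sub>R E i))"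
    using norm_triangle_ineq4[of "y + (\<Sum>i\<in>UNIV. (x$i * \<kappa> (s i)) *\<^sub>R E i)" "\<Sum>i\<in>UNIV. (x$i * \<kappa> (s i)) *\<^sub>R E i"] by simp
  moreover have "1 / 2 ^ (2 * ?J + 2 * ?J ^ 2) * norm x \<le> norm y"
  proof -
    let ?c = "1 / 2 ^ (2 * ?J + 2 * ?J ^ 2) :: real"
    have "norm (?c *\<^sub>R x) \<le> norm y"
    proof (rule norm_le_componentwise_cart)
      fix i
      have "?c * \<bar>x$i\<bar> \<le> (c i * real (N i)) * \<bar>x$i\<bar>"
      proof (rule mult_right_mono)
        have "c i * 1 \<le> c i * real (N i)" using N(1)[of i] c_pos[of i] by (intro mult_left_mono) auto
        then show "?c \<le> c i * real (N i)" using c_ge[of i] by simp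
      qed simp
      then show "norm ((?c *\<^sub>R x)$i) \<le> norm (y$i)"
        using c_pos[of i] by (simp add: y_def abs_mult mult.commute)
    qed
    then show ?thesis by simp
  qed
  ultimately show ?thesis unfolding A by (simp add: power_add)
qed

text \<open>For almost every \<omega> the estimates on X (ell j) hold from some index q0 on that
  depends on \<omega>, and \<open>digit_path_blocks\<close> is interpreted for that \<omega>. In the
  growth condition q0 affects only the constant.\<close>

lemma AE_local_time:
  "AE \<omega> in M. \<exists>L. is_local_time T (\<lambda>t. z t \<omega>) L \<and> (\<forall>t\<in>{0..T}. L t \<in> test_functions) \<and>
    (\<forall>\<gamma>\<in>{0<..<1}. L \<in> holder_test \<gamma> T)"
proof -
  let ?d = "CARD('n)" and ?\<eta> = "1 / (2 * real CARD('n))"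
  have d: "1 \<le> ?d" using zero_less_card_finite[where 'a='n] by linarith
  then have "1 \<le> 2 * real ?d" by linarith
  then have \<eta>: "0 < ?\<eta>" "?\<eta> \<le> 1" by auto
  have "AE \<omega> in P. \<exists>L. is_local_time T (\<lambda>t. z t \<omega>) L \<and> (\<forall>t\<in>{0..T}. L t \<in> test_functions) \<and>
    (\<forall>\<gamma>\<in>{0<..<1}. L \<in> holder_test \<gamma> T)"
    using AE_W_small[OF \<eta>(1)] AE_good AE_summable_X
  proof eventually_elim
    case (elim \<omega>)
    have "(\<lambda>j. (1 / 2 :: real) ^ j) \<longlonglongrightarrow> 0" by (intro LIMSEQ_power_zero) simp
    then have "\<forall>\<^sub>F j in sequentially. (1 / 2 :: real) ^ j < T" using T_pos by (rule order_tendstoD)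
    then have "\<forall>\<^sub>F j in sequentially. W j \<omega> < ennreal ?\<eta> \<and> ell j \<le> T"
      using elim(1)
    proof eventually_elim
      case (elim j)
      have "j \<le> j ^ 3" by (cases "j = 0") (auto intro!: self_le_power)
      then have "(1 / 2 :: real) ^ (j ^ 3) \<le> (1 / 2) ^ j" by (intro power_decreasing) auto
      with elim show ?case by (simp add: power_one_over)
    qed
    then obtain q0 where q0: "\<And>j. q0 \<le> j \<Longrightarrow> W j \<omega> < ennreal ?\<eta> \<and> ell j \<le> T"
      by (auto simp: eventually_sequentially)
    have X: "\<exists>N\<ge>1::nat. norm (X (ell j) \<omega> - (real N * size j) *\<^sub>R axis (\<iota> j) 1) \<le> ?\<eta> * size j" if "q0 \<le> j" for j
      using W_small_imp[OF elim(2), of j ?\<eta>] q0[OF that] \<eta>(2) by metis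
    \<comment> \<open>Of order n^(1/3): rows from \<open>p n\<close> on consist of digits that are
      free at level \<open>n\<close>.\<close>
    define p where "p n = (LEAST p. n \<le> p ^ 3)" for n :: nat
    have "n \<le> n ^ 3" for n :: nat by (cases "n = 0") (auto intro!: self_le_power)
    then have p: "n \<le> p n ^ 3" for n unfolding p_def by (rule LeastI)
    have p': "p n = 0 \<or> (p n - 1) ^ 3 < n" for n
    proof (cases "p n = 0")
      case False
      then have "p n - 1 < (LEAST p. n \<le> p ^ 3)" by (simp add: p_def)
      from not_less_Least[OF this] show ?thesis by simp
    qed simp
    \<comment> \<open>Adding q0 moves every block into the range of the estimates; multiplying by ?d
      in \<open>block\<close> aligns it with the cycle of directions and only increases the
      indices.\<close>
    define q where "q n = q0 + p n" for n
    define block where "block n i = ?d * q n + e i" for n i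
    define J where "J n = ?d * (q n + 1)" for n
    define c :: "nat \<Rightarrow> real" where "c n = 1 / 2 ^ (1 + 2 * J n + 2 * J n ^ 2)" for n
    have q_le: "q n \<le> ?d * q n" for n using mult_le_mono1[OF d, of "q n"] by simp
    let ?v = "\<lambda>j. \<kappa> j *\<^sub>R X (ell j) \<omega>"
    have low: "c n * norm x \<le> norm ((\<chi> a i. ?v (block n i) $ a) *v x)" for n x
      unfolding c_def J_def block_def
    proof (rule block_lower_bound)
      fix j assume "?d * q n \<le> j"
      moreover have "q0 \<le> ?d * q n" using q_le[of n] unfolding q_def by linarith
      ultimately show "\<exists>N\<ge>1::nat. norm (X (ell j) \<omega> - (real N * size j) *\<^sub>R axis (\<iota> j) 1) \<le> ?\<eta> * size j"
        by (intro X) simp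
    qed
    have c_pos: "0 < c n" for n by (simp add: c_def)
    let ?R = "\<lambda>n B. (\<chi> a i. ?v (block n i) $ a) ** B = mat 1 \<and> B ** (\<chi> a i. ?v (block n i) $ a) = mat 1 \<and> (\<forall>i j. \<bar>B$i$j\<bar> \<le> 1 / c n)"
    have "\<forall>n. \<exists>B. ?R n B"
      by (rule allI, rule matrix_inverse_bound[OF c_pos low]) blast
    from choice[OF this] obtain Bm where Bm: "\<And>n. ?R n (Bm n)" by (elim exE) (rule that, erule spec)
    interpret D: digit_path_blocks ?v block Bm "\<lambda>n. 1 / c n"
    proof
      show "summable (\<lambda>j. norm (?v j))" by (rule elim(3))
      show "inj (block n)" for n
        using bij_e by (auto simp: block_def inj_on_def bij_betw_def)
      show "n \<le> block n i ^ 3" for n i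
      proof -
        have "p n \<le> block n i" using q_le[of n] unfolding block_def q_def by linarith
        then have "p n ^ 3 \<le> block n i ^ 3" by (rule power_mono) simp
        with p[of n] show ?thesis by linarith
      qed
      show "1 \<le> 1 / c n" for n
        using one_le_power[of "2::real" "1 + 2 * J n + 2 * J n ^ 2"] by (simp add: c_def)
      show "\<exists>C. \<forall>n. 1 / c n \<le> C * 2 powr (\<delta> * real n)" if "0 < \<delta>" for \<delta>
      proof -
        \<comment> \<open>From 1 + 2 J + 2 J^2 \<le> 5 J^2 for J \<ge> 1 and J n \<le> d (q0 + 1) (p
          n + 1), where d = CARD('n).\<close>
        define K where "K = 5 * (real ?d * (real q0 + 1)) ^ 2"
        have "0 \<le> K" by (simp add: K_def)
        from quadratic_le_cubic[OF this \<open>0 < \<delta>\<close>]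
        obtain C where C: "\<forall>p n :: nat. p = 0 \<or> (p - 1) ^ 3 < n \<longrightarrow> K * (real p + 1) ^ 2 \<le> C + \<delta> * real n" ..
        have "1 / c n \<le> 2 powr C * 2 powr (\<delta> * real n)" for n
        proof -
          have "1 * 1 \<le> J n" unfolding J_def by (intro mult_le_mono d) simp
          then have J1: "1 \<le> real (J n)" by simp
          have "real (1 + 2 * J n + 2 * J n ^ 2) \<le> 5 * real (J n) ^ 2"
          proof -
            have "real (1 + 2 * J n + 2 * J n ^ 2) = 1 + 2 * real (J n) + 2 * real (J n) ^ 2" by simp
            moreover have "real (J n) \<le> real (J n) ^ 2" using self_le_power[OF J1, of 2] by simp
            ultimately show ?thesis using J1 by linarith
          qed
          also have "\<dots> \<le> 5 * (real ?d * (real q0 + 1) * (real (p n) + 1)) ^ 2"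
          proof (intro mult_left_mono power_mono)
            have "real (J n) = real ?d * (real q0 + real (p n) + 1)" by (simp add: J_def q_def distrib_left)
            also have "\<dots> \<le> real ?d * ((real q0 + 1) * (real (p n) + 1))"
              by (intro mult_left_mono) (auto simp: algebra_simps)
            finally show "real (J n) \<le> real ?d * (real q0 + 1) * (real (p n) + 1)" by (simp only: mult.assoc)
          qed auto
          also have "\<dots> = K * (real (p n) + 1) ^ 2" by (simp only: K_def power_mult_distrib mult.assoc)
          also have "\<dots> \<le> C + \<delta> * real n" using C p' by blast
          finally have "2 powr real (1 + 2 * J n + 2 * J n ^ 2) \<le> 2 powr (C + \<delta> * real n)"
            by (intro powr_mono) auto
          moreover have "1 / c n = 2 powr real (1 + 2 * J n + 2 * J n ^ 2)"
            unfolding c_def by (subst powr_realpow) auto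
          ultimately show ?thesis by (simp add: powr_add)
        qed
        then show ?thesis by blast
      qed
    qed (use Bm in simp_all)
    have "(\<lambda>t. z t \<omega>) = digit_path ?v" by (auto simp: z_def)
    with D.digit_path_local_time[OF T_pos] show ?case by simp
  qed
  then show ?thesis by (simp only: AE_M_iff)
qed

end

text \<open>Real sequences serve as sample space because countably many jump numbers and candidate
  times carry all the randomness.\<close>

theorem corollary2:
  fixes T :: real
  assumes "T > 0"
  shows "\<exists>\<C> :: ((nat \<Rightarrow> real) measure \<times> (real \<Rightarrow> (nat \<Rightarrow> real) \<Rightarrow> real ^ 'n::finite)) set.
    \<C> \<noteq> {} \<and>
    (\<forall>(M, z)\<in>\<C>.
      (\<exists>F X k. volterra_levy_process T M F X k z) \<and>
      measurable_process T M z \<and>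
      (AE \<omega> in M. \<exists>L. is_local_time T (\<lambda>t. z t \<omega>) L \<and>
         (\<forall>t\<in>{0..T}. L t \<in> test_functions) \<and>
         (\<forall>\<gamma>\<in>{0<..<1}. L \<in> holder_test \<gamma> T)))"
proof -
  obtain e :: "'n \<Rightarrow> nat" where "bij_betw e UNIV {0..<CARD('n)}"
    using ex_bij_betw_finite_nat[of "UNIV :: 'n set"] by auto
  then interpret concrete_process T e
    using assms by unfold_locales (auto simp: atLeast0LessThan)
  show ?thesis
    using volterra measurable_z AE_local_time by (intro exI[of _ "{(M, z)}"]) auto
qed

end
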